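(* Let $S_1,\dots,S_7$ be the finite groups given by their identifiers in the Small Groups Library, where the identifier $(n,i)$ denotes the $i$-th group of order $n$ in that library: $$S_1=\mathrm{SmallGroup}(168,43),\quad S_2=\mathrm{SmallGroup}(1008,289),\quad S_3=\mathrm{SmallGroup}(1344,6967),$$ $$S_4=\mathrm{SmallGroup}(21,1),\quad S_5=\mathrm{SmallGroup}(96,166),\quad S_6=\mathrm{SmallGroup}(336,136),\quad S_7=\mathrm{SmallGroup}(336,208).$$ Set $G=S_1\times S_2\times S_3$ and $H=S_4\times S_5\times S_6\times S_7$. For a finite group $X$ let $o_X:\mathbb{N}_{>0}\to\mathbb{N}$ be the function such that $o_X(n)$ is the number of elements of $X$ of order exactly $n$. Then $o_G=o_H$, the group $G$ is solvable, and the group $H$ is not solvable.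
   Context: The order type of a finite group $X$ is the function $o_X:\mathbb{N}_{>0}\to\mathbb{N}$ where $o_X(n)$ is the number of elements of order $n$ in $X$. Identifiers: a group $S$ has Id $(n,i)$ if $S$ is isomorphic to the $i$-th group of order $n$ in the Small Groups Library of Besche, Eick and O'Brien, available as SmallGroup(n, i) in the computer algebra systems GAP and Magma, and as libgap.SmallGroup(n, i) in SageMath. The Id determines the group up to isomorphism. The groups have the following structural descriptions (the semidirect products in these descriptions do not by themselves uniquely determine the group up to isomorphism; the Id does): - $S_1$, Id $(168,43)$: $C_2^3\rtimes(C_7\rtimes C_3)$; - $S_2$, Id $(1008,289)$: $C_7\rtimes(C_3\times(C_3\rtimes Q_{16}))$; - $S_3$, Id $(1344,6967)$: $C_7\rtimes(((C_4\times D_8)\rtimes C_2)\rtimes C_3)$; - $S_4$, Id $(21,1)$: $C_7\rtimes C_3$; - $S_5$, Id $(96,166)$: $C_{12}\times Q_8$; - $S_6$, Id $(336,136)$: $C_7\rtimes(C_4\times A_4)$; - $S_7$, Id $(336,208)$: $\mathrm{PGL}_2(7)$. Here $C_i$ and $D_i$ denote the cyclic and the dihedral group of order $i$, respectively, $Q_i$ is the (generalized) quaternion group of order $i$, and $A_4$ is the alternating group of degree $4$. *)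

theory Defs
  imports "HOL-Analysis.Cartesian_Space" "HOL-Library.Numeral_Type" "HOL-Algebra.Algebra"
begin

section \<open>Order types\<close>

definition order_type :: "('a, 'b) monoid_scheme \<Rightarrow> nat \<Rightarrow> nat" where
  "order_type G n = card {x \<in> carrier G. group.ord G x = n}"


section \<open>Building blocks\<close>

abbreviation cyc :: "nat \<Rightarrow> int monoid" where
  "cyc \<equiv> integer_mod_group"

definition semidirect ::
  "('a, 'c) monoid_scheme \<Rightarrow> ('b, 'd) monoid_scheme \<Rightarrow> ('b \<Rightarrow> 'a \<Rightarrow> 'a) \<Rightarrow> ('a \<times> 'b) monoid" where
  "semidirect N K \<phi> =
     \<lparr>carrier = carrier N \<times> carrier K,
      monoid.mult = (\<lambda>(n, k) (n', k'). (n \<otimes>\<^bsub>N\<^esub> \<phi> k n', k \<otimes>\<^bsub>K\<^esub> k')),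
      one = (\<one>\<^bsub>N\<^esub>, \<one>\<^bsub>K\<^esub>)\<rparr>"

definition dihedral_group :: "nat \<Rightarrow> (int \<times> int) monoid" where
  "dihedral_group n =
     semidirect (cyc (n div 2)) (cyc 2) (\<lambda>k a. ((-1) ^ nat k * a) mod int (n div 2))"

text \<open>The pair \<open>(i, j)\<close> stands for \<open>x\<^sup>i y\<^sup>j\<close> in the group of order \<open>n\<close> (a multiple of 4) with presentation
  \<open>\<langle>x, y | x\<^sup>n\<^sup>/\<^sup>2 = 1, y\<^sup>2 = x\<^sup>n\<^sup>/\<^sup>4, y x y\<^sup>-\<^sup>1 = x\<^sup>-\<^sup>1\<rangle>\<close>.\<close>

definition quaternion_group :: "nat \<Rightarrow> (int \<times> int) monoid" where
  "quaternion_group n =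
     \<lparr>carrier = {0..<int (n div 2)} \<times> {0..<2},
      monoid.mult = (\<lambda>(i, j) (i', j').
        ((i + (-1) ^ nat j * i' + int (n div 4) * (j * j')) mod int (n div 2), (j + j') mod 2)),
      one = (0, 0)\<rparr>"

definition general_linear_group :: "('a::comm_ring_1 ^ 'n ^ 'n) monoid" where
  "general_linear_group = \<lparr>carrier = {A. invertible A}, monoid.mult = (**), one = mat 1\<rparr>"

definition projective_linear_group :: "('a::comm_ring_1 ^ 'n ^ 'n) set monoid" where
  "projective_linear_group =
     general_linear_group Mod {A. invertible A \<and> (\<exists>c. A = mat c)}"


section \<open>The seven groups\<close>

text \<open>\<open>SmallGroup_n_i\<close> is an explicit model of the group with Id \<open>(n, i)\<close> in the Small Groups Library. The
  models follow the structural descriptions of these groups, with the actions spelt out. Among the groups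
  fitting such a description, the actions chosen for the Ids \<open>(1008, 289)\<close> and \<open>(1344, 6967)\<close> are, up to
  isomorphism, the only ones for which \<open>S\<^sub>1 \<times> S\<^sub>2 \<times> S\<^sub>3\<close> and \<open>S\<^sub>4 \<times> S\<^sub>5 \<times> S\<^sub>6 \<times> S\<^sub>7\<close> have the same order type.\<close>

definition SmallGroup_21_1 :: "(int \<times> int) monoid" where
  "SmallGroup_21_1 = semidirect (cyc 7) (cyc 3) (\<lambda>k a. (2 ^ nat k * a) mod 7)"

text \<open>The affine semilinear group of the field with 8 elements \<open>\<bbbF>\<^sub>2[t]/(t\<^sup>3 + t + 1)\<close>: the triple
  \<open>(v\<^sub>0, v\<^sub>1, v\<^sub>2)\<close> stands for \<open>v\<^sub>0 + v\<^sub>1 t + v\<^sub>2 t\<^sup>2\<close>, and the generators of \<open>C\<^sub>7\<close> and \<open>C\<^sub>3\<close> act as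
  multiplication by \<open>t\<close> and as the Frobenius map.\<close>

definition F8_mult_t :: "int \<times> int \<times> int \<Rightarrow> int \<times> int \<times> int" where
  "F8_mult_t = (\<lambda>(v0, v1, v2). (v2, (v0 + v2) mod 2, v1))"

definition F8_frobenius :: "int \<times> int \<times> int \<Rightarrow> int \<times> int \<times> int" where
  "F8_frobenius = (\<lambda>(v0, v1, v2). (v0, v2, (v1 + v2) mod 2))"

definition SmallGroup_168_43 :: "((int \<times> int \<times> int) \<times> (int \<times> int)) monoid" where
  "SmallGroup_168_43 =
     semidirect (cyc 2 \<times>\<times> cyc 2 \<times>\<times> cyc 2) SmallGroup_21_1
       (\<lambda>(u, k). (F8_mult_t ^^ nat u) \<circ> (F8_frobenius ^^ nat k))"

text \<open>In \<open>C\<^sub>7 \<rtimes> (C\<^sub>3 \<times> (C\<^sub>3 \<rtimes> Q\<^sub>1\<^sub>6))\<close> the generator \<open>x\<close> of \<open>Q\<^sub>1\<^sub>6\<close> inverts the normal \<open>C\<^sub>3\<close> as well as \<open>C\<^sub>7\<close>,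
  and \<open>y\<close> centralises both.\<close>

definition SmallGroup_1008_289 :: "(int \<times> int \<times> int \<times> int \<times> int) monoid" where
  "SmallGroup_1008_289 =
     semidirect (cyc 7)
       (cyc 3 \<times>\<times> semidirect (cyc 3) (quaternion_group 16) (\<lambda>(i, j) b. ((-1) ^ nat i * b) mod 3))
       (\<lambda>(k, b, i, j) a. (2 ^ nat k * (-1) ^ nat i * a) mod 7)"

text \<open>A Sylow 2-subgroup \<open>(C\<^sub>4 \<times> D\<^sub>8) \<rtimes> C\<^sub>2\<close> of \<open>SmallGroup(1344, 6967)\<close>. Let \<open>p\<close>, \<open>(r, s)\<close>, \<open>z\<close> be the standard
  generators of \<open>C\<^sub>4\<close>, \<open>D\<^sub>8\<close>, \<open>C\<^sub>2\<close>. Then \<open>((i, j, k), l)\<close> stands for \<open>p\<^sup>i r\<^sup>j s\<^sup>k z\<^sup>l\<close>, and \<open>z\<close> acts by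
  \<open>p \<mapsto> p\<^sup>-\<^sup>1\<close>, \<open>r \<mapsto> r\<^sup>-\<^sup>1\<close>, \<open>s \<mapsto> p\<^sup>2 s\<close>.\<close>

definition sylow2_1344 :: "((int \<times> int \<times> int) \<times> int) monoid" where
  "sylow2_1344 =
     semidirect (cyc 4 \<times>\<times> dihedral_group 8) (cyc 2)
       (\<lambda>l. (\<lambda>(i, j, k). ((- i + 2 * k) mod 4, (- j) mod 4, k)) ^^ nat l)"

text \<open>The automorphism \<open>p \<mapsto> p\<^sup>2 s z\<close>, \<open>r \<mapsto> r\<close>, \<open>s \<mapsto> p z\<close>, \<open>z \<mapsto> s\<close> of order 3.\<close>

definition sylow2_1344_auto :: "(int \<times> int \<times> int) \<times> int \<Rightarrow> (int \<times> int \<times> int) \<times> int" where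
  "sylow2_1344_auto = (\<lambda>((i, j, k), l).
     ((2, 0, 1), 1) [^]\<^bsub>sylow2_1344\<^esub> nat i \<otimes>\<^bsub>sylow2_1344\<^esub>
     ((0, 1, 0), 0) [^]\<^bsub>sylow2_1344\<^esub> nat j \<otimes>\<^bsub>sylow2_1344\<^esub>
     ((1, 0, 0), 1) [^]\<^bsub>sylow2_1344\<^esub> nat k \<otimes>\<^bsub>sylow2_1344\<^esub>
     ((0, 0, 1), 0) [^]\<^bsub>sylow2_1344\<^esub> nat l)"

text \<open>On \<open>C\<^sub>7\<close>, the generator \<open>r\<close> acts by inversion, and \<open>p\<close>, \<open>s\<close>, \<open>z\<close> act trivially.\<close>

definition SmallGroup_1344_6967 :: "(int \<times> ((int \<times> int \<times> int) \<times> int) \<times> int) monoid" where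
  "SmallGroup_1344_6967 =
     semidirect (cyc 7)
       (semidirect sylow2_1344 (cyc 3) (\<lambda>c. sylow2_1344_auto ^^ nat c))
       (\<lambda>(((i, j, k), l), c) a. (2 ^ nat c * (-1) ^ nat j * a) mod 7)"

definition SmallGroup_96_166 :: "(int \<times> int \<times> int) monoid" where
  "SmallGroup_96_166 = cyc 12 \<times>\<times> quaternion_group 8"

text \<open>\<open>A\<^sub>4\<close> as the extension of its Klein four-group by a group of order 3 that permutes the three
  involutions cyclically.\<close>

definition A4 :: "((int \<times> int) \<times> int) monoid" where
  "A4 = semidirect (cyc 2 \<times>\<times> cyc 2) (cyc 3) (\<lambda>k. (\<lambda>(v, w). (w, (v + w) mod 2)) ^^ nat k)"

text \<open>On \<open>C\<^sub>7\<close>, the generator of \<open>C\<^sub>4\<close> acts by inversion, and \<open>A\<^sub>4\<close> acts through its quotient of order 3.\<close>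

definition SmallGroup_336_136 :: "(int \<times> int \<times> (int \<times> int) \<times> int) monoid" where
  "SmallGroup_336_136 =
     semidirect (cyc 7) (cyc 4 \<times>\<times> A4) (\<lambda>(c, v, k) a. (2 ^ nat k * (-1) ^ nat c * a) mod 7)"

text \<open>The type \<open>7\<close> is the field of integers modulo 7.\<close>

definition SmallGroup_336_208 :: "(7 ^ 2 ^ 2) set monoid" where
  "SmallGroup_336_208 = projective_linear_group"


section \<open>The models are groups\<close>

lemma group_semidirect:
  assumes "Group.group N" "Group.group K"
    and cl: "\<And>k n. k \<in> carrier K \<Longrightarrow> n \<in> carrier N \<Longrightarrow> \<phi> k n \<in> carrier N"
    and hom: "\<And>k n n'. k \<in> carrier K \<Longrightarrow> n \<in> carrier N \<Longrightarrow> n' \<in> carrier N \<Longrightarrow>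
           \<phi> k (n \<otimes>\<^bsub>N\<^esub> n') = \<phi> k n \<otimes>\<^bsub>N\<^esub> \<phi> k n'"
    and act: "\<And>k k' n. k \<in> carrier K \<Longrightarrow> k' \<in> carrier K \<Longrightarrow> n \<in> carrier N \<Longrightarrow>
           \<phi> (k \<otimes>\<^bsub>K\<^esub> k') n = \<phi> k (\<phi> k' n)"
    and one: "\<And>n. n \<in> carrier N \<Longrightarrow> \<phi> \<one>\<^bsub>K\<^esub> n = n"
  shows "Group.group (semidirect N K \<phi>)"
proof -
  interpret N: Group.group N by fact
  interpret K: Group.group K by fact
  show ?thesis
  proof (rule groupI)
    fix x assume "x \<in> carrier (semidirect N K \<phi>)"
    then obtain n k where x: "x = (n, k)" "n \<in> carrier N" "k \<in> carrier K"
      by (auto simp: semidirect_def)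
    let ?y = "(\<phi> (inv\<^bsub>K\<^esub> k) (inv\<^bsub>N\<^esub> n), inv\<^bsub>K\<^esub> k)"
    have "\<phi> (inv\<^bsub>K\<^esub> k) (inv\<^bsub>N\<^esub> n) \<otimes>\<^bsub>N\<^esub> \<phi> (inv\<^bsub>K\<^esub> k) n = \<phi> (inv\<^bsub>K\<^esub> k) \<one>\<^bsub>N\<^esub>"
      using x hom[of "inv\<^bsub>K\<^esub> k" "inv\<^bsub>N\<^esub> n" n] by simp
    moreover have "\<phi> (inv\<^bsub>K\<^esub> k) \<one>\<^bsub>N\<^esub> = \<one>\<^bsub>N\<^esub>"
      using x hom[of "inv\<^bsub>K\<^esub> k" "\<one>\<^bsub>N\<^esub>" "\<one>\<^bsub>N\<^esub>"] cl[of "inv\<^bsub>K\<^esub> k" "\<one>\<^bsub>N\<^esub>"]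
      by (metis K.inv_closed N.one_closed N.r_one N.l_cancel_one)
    ultimately have "?y \<otimes>\<^bsub>semidirect N K \<phi>\<^esub> x = \<one>\<^bsub>semidirect N K \<phi>\<^esub>"
      using x by (simp add: semidirect_def)
    moreover have "?y \<in> carrier (semidirect N K \<phi>)"
      using x cl by (simp add: semidirect_def)
    ultimately show "\<exists>y\<in>carrier (semidirect N K \<phi>). y \<otimes>\<^bsub>semidirect N K \<phi>\<^esub> x = \<one>\<^bsub>semidirect N K \<phi>\<^esub>"
      by blast
  qed (auto simp: semidirect_def cl hom act one N.m_assoc K.m_assoc)
qed

lemma semidirect_simps [simp]:
  "carrier (semidirect N K \<phi>) = carrier N \<times> carrier K"
  "(n, k) \<otimes>\<^bsub>semidirect N K \<phi>\<^esub> (n', k') = (n \<otimes>\<^bsub>N\<^esub> \<phi> k n', k \<otimes>\<^bsub>K\<^esub> k')"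
  "\<one>\<^bsub>semidirect N K \<phi>\<^esub> = (\<one>\<^bsub>N\<^esub>, \<one>\<^bsub>K\<^esub>)"
  by (simp_all add: semidirect_def)

lemma cyc_carrier_numeral [simp]:
  "carrier (cyc (numeral w)) = {0..<numeral w}"
  by (simp add: carrier_integer_mod_group)

lemma interval_unfold:
  "{0..<2::int} = {0, 1}" "{0..<3::int} = {0, 1, 2}" "{0..<4::int} = {0, 1, 2, 3}"
  "{0..<8::int} = {0, 1, 2, 3, 4, 5, 6, 7}"
  by auto

lemma group_semidirect_cyc:
  assumes "Group.group N" and "m > 0"
    and cl: "\<And>n. n \<in> carrier N \<Longrightarrow> f n \<in> carrier N"
    and hom: "\<And>n n'. n \<in> carrier N \<Longrightarrow> n' \<in> carrier N \<Longrightarrow> f (n \<otimes>\<^bsub>N\<^esub> n') = f n \<otimes>\<^bsub>N\<^esub> f n'"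
    and per: "\<And>n. n \<in> carrier N \<Longrightarrow> (f ^^ m) n = n"
  shows "Group.group (semidirect N (cyc m) (\<lambda>k. f ^^ nat k))"
proof (rule group_semidirect[OF assms(1) group_integer_mod_group])
  have cl': "(f ^^ k) n \<in> carrier N" if "n \<in> carrier N" for k n
    using that by (induction k) (auto simp: cl)
  then show "(f ^^ nat k) n \<in> carrier N" if "n \<in> carrier N" for k n using that .
  show "(f ^^ nat k) (n \<otimes>\<^bsub>N\<^esub> n') = (f ^^ nat k) n \<otimes>\<^bsub>N\<^esub> (f ^^ nat k) n'"
    if "n \<in> carrier N" "n' \<in> carrier N" for k n n'
  proof -
    have "(f ^^ m) (n \<otimes>\<^bsub>N\<^esub> n') = (f ^^ m) n \<otimes>\<^bsub>N\<^esub> (f ^^ m) n'" for m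
      using that by (induction m) (auto simp: hom cl')
    then show ?thesis .
  qed
  fix k k' n assume k: "k \<in> carrier (cyc m)" "k' \<in> carrier (cyc m)" and n: "n \<in> carrier N"
  have per': "(f ^^ (m * q)) n = n" for q
    by (induction q) (auto simp: per n funpow_add)
  have "nat k + nat k' = nat ((k + k') mod int m) + m * ((nat k + nat k') div m)"
    using k \<open>m > 0\<close> by (simp add: carrier_integer_mod_group nat_mod_distrib nat_add_distrib)
  then have "(f ^^ (nat k + nat k')) n = (f ^^ nat ((k + k') mod int m)) n"
    by (metis per' funpow_add comp_apply)
  then show "(f ^^ nat (k \<otimes>\<^bsub>cyc m\<^esub> k')) n = (f ^^ nat k) ((f ^^ nat k') n)"
    by (simp add: funpow_add)
qed simp_all

text \<open>Actions on a cyclic group by multiplication.\<close>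

lemma group_semidirect_mult:
  assumes "Group.group K" and "m > 0"
    and act: "\<And>k k'. k \<in> carrier K \<Longrightarrow> k' \<in> carrier K \<Longrightarrow>
           c (k \<otimes>\<^bsub>K\<^esub> k') mod int m = c k * c k' mod int m"
    and one: "c \<one>\<^bsub>K\<^esub> = 1"
  shows "Group.group (semidirect (cyc m) K (\<lambda>k a. (c k * a) mod int m))"
proof (rule group_semidirect[OF group_integer_mod_group assms(1)])
  show "(c (k \<otimes>\<^bsub>K\<^esub> k') * n) mod int m = (c k * ((c k' * n) mod int m)) mod int m"
    if "k \<in> carrier K" "k' \<in> carrier K" for k k' n
    using act[OF that] by (metis mod_mult_left_eq mod_mult_right_eq mult.assoc)
qed (use \<open>m > 0\<close> one in \<open>auto simp: carrier_integer_mod_group mod_simps algebra_simps\<close>)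

lemma neg_one_power_parity:
  "even a = (even b = even c) \<Longrightarrow> (-1 :: int) ^ a = (-1) ^ b * (-1) ^ c"
  by (cases "even b"; cases "even c") simp_all

lemma neg_one_power_mod:
  assumes "even m" "m > 0" "0 \<le> k" "0 \<le> k'"
  shows "(-1 :: int) ^ nat ((k + k') mod m) = (-1) ^ nat k * (-1) ^ nat k'"
proof -
  have "even (nat ((k + k') mod m)) \<longleftrightarrow> even (nat k + nat k')"
    using assms by (simp add: even_nat_iff dvd_mod_iff)
  then show ?thesis
    by (auto simp flip: power_add simp: minus_one_power_iff)
qed

lemma two_power_mod:
  assumes "0 \<le> k" "k < 3" "0 \<le> k'" "k' < 3"
  shows "(2 :: int) ^ nat ((k + k') mod 3) mod 7 = 2 ^ nat k * 2 ^ nat k' mod 7"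
proof -
  have "k \<in> {0, 1, 2}" "k' \<in> {0, 1, 2}" using assms by auto
  then show ?thesis by auto
qed

lemma two_neg_one_power_mod:
  assumes "even m" "m > 0" "0 \<le> k" "k < 3" "0 \<le> k'" "k' < 3" "0 \<le> i" "0 \<le> i'"
  shows "(2 ^ nat ((k + k') mod 3) * (-1) ^ nat ((i + i') mod m)) mod 7
     = (2 ^ nat k * (-1) ^ nat i) * (2 ^ nat k' * (-1) ^ nat i') mod (7 :: int)"
proof -
  have "(2 ^ nat ((k + k') mod 3) * (-1) ^ nat ((i + i') mod m)) mod 7
      = (2 ^ nat k * 2 ^ nat k') * ((-1) ^ nat i * (-1) ^ nat i') mod (7 :: int)"
    using neg_one_power_mod[of m i i'] assms
    by (intro mod_mult_cong two_power_mod) auto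
  then show ?thesis
    by (simp only: mult_ac)
qed

lemma group_SmallGroup_21_1: "Group.group SmallGroup_21_1"
  using group_semidirect_mult[of "cyc 3" 7 "\<lambda>k. 2 ^ nat k"]
  by (simp add: SmallGroup_21_1_def two_power_mod)

lemma group_dihedral_8: "Group.group (dihedral_group 8)"
  using group_semidirect_mult[of "cyc 2" 4 "\<lambda>k. (-1) ^ nat k"]
  by (simp add: dihedral_group_def neg_one_power_mod)

lemma group_quaternion:
  assumes "4 dvd n" "n > 0"
  shows "Group.group (quaternion_group n)"
proof -
  define N where "N = int (n div 2)"
  define h where "h = int (n div 4)"
  have N: "N = 2 * h" "N > 0"
    using assms by (auto simp: N_def h_def)
  have Q: "quaternion_group n = \<lparr>carrier = {0..<N} \<times> {0..<2},
      monoid.mult = (\<lambda>(i, j) (i', j'). ((i + (-1) ^ nat j * i' + h * (j * j')) mod N, (j + j') mod 2)),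
      one = (0, 0)\<rparr>"
    by (simp add: quaternion_group_def N_def h_def)
  have shift: "(a mod N - b + h) mod N = (a - b + h) mod N"
    "(a - b mod N + h) mod N = (a - b + h) mod N" for a b
    using mod_add_left_eq[of a N "h - b"] mod_diff_right_eq[of "a + h" b N]
    by (simp_all add: algebra_simps)
  show ?thesis
  proof (rule groupI)
    fix x y z
    assume c: "x \<in> carrier (quaternion_group n)" "y \<in> carrier (quaternion_group n)"
      "z \<in> carrier (quaternion_group n)"
    obtain i j i' j' i'' j'' where eq: "x = (i, j)" "y = (i', j')" "z = (i'', j'')"
      by (metis surj_pair)
    have j: "j = 0 \<or> j = 1" "j' = 0 \<or> j' = 1" "j'' = 0 \<or> j'' = 1"
      using c unfolding eq by (auto simp: Q)
    show "x \<otimes>\<^bsub>quaternion_group n\<^esub> y \<otimes>\<^bsub>quaternion_group n\<^esub> z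
        = x \<otimes>\<^bsub>quaternion_group n\<^esub> (y \<otimes>\<^bsub>quaternion_group n\<^esub> z)"
      using j unfolding eq Q
      apply (elim disjE; hypsubst; simp add: mod_simps)
      apply (simp_all only: shift)
      apply (simp_all add: mod_eq_dvd_iff N)
      done
  next
    fix x assume c: "x \<in> carrier (quaternion_group n)"
    obtain i j where eq: "x = (i, j)"
      by fastforce
    then have "j = 0 \<or> j = 1" "0 \<le> i" "i < N"
      using c by (auto simp: Q)
    then show "\<exists>y\<in>carrier (quaternion_group n). y \<otimes>\<^bsub>quaternion_group n\<^esub> x = \<one>\<^bsub>quaternion_group n\<^esub>"
      using N unfolding eq Q
      by (intro bexI[of _ "if j = 0 then ((- i) mod N, 0) else ((i + h) mod N, 1)"])
        (auto simp: mod_simps shift[unfolded N])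
  qed (use N in \<open>auto simp: Q\<close>)
qed

lemma group_SmallGroup_96_166: "Group.group SmallGroup_96_166"
  by (simp add: SmallGroup_96_166_def DirProd_group group_quaternion)

lemma group_A4: "Group.group A4"
  unfolding A4_def
  by (rule group_semidirect_cyc)
    (auto simp: DirProd_group interval_unfold numeral_3_eq_3)

lemma A4_iso_alt_group: "A4 \<cong> alt_group 4"
proof -
  define P :: "nat \<Rightarrow> nat \<Rightarrow> nat \<Rightarrow> nat \<Rightarrow> nat \<Rightarrow> nat" where
    "P = (\<lambda>a b c d n. if n = 1 then a else if n = 2 then b else if n = 3 then c else if n = 4 then d else n)"
  have P_comp: "P a b c d \<circ> P a' b' c' d' = P (P a b c d a') (P a b c d b') (P a b c d c') (P a b c d d')"
    for a b c d a' b' c' d'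
    by (rule ext) (simp add: P_def)
  have P_app: "P a b c d 1 = a" "P a b c d (Suc 0) = a" "P a b c d 2 = b" "P a b c d 3 = c" "P a b c d 4 = d" for a b c d
    by (simp_all add: P_def)
  have P_eq: "P a b c d = P a' b' c' d' \<longleftrightarrow> a = a' \<and> b = b' \<and> c = c' \<and> d = d'" for a b c d a' b' c' d'
  proof
    assume "P a b c d = P a' b' c' d'"
    then have "P a b c d n = P a' b' c' d' n" for n
      by simp
    from this[of 1] this[of 2] this[of 3] this[of 4] show "a = a' \<and> b = b' \<and> c = c' \<and> d = d'"
      by (simp only: P_app)
  qed simp
  have pow2: "f ^^ 2 = f \<circ> f" for f :: "int \<times> int \<Rightarrow> int \<times> int"
    by (simp add: numeral_2_eq_2)
  define h :: "(int \<times> int) \<times> int \<Rightarrow> nat \<Rightarrow> nat" where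
    "h = (\<lambda>((v, w), k). (if v = 1 then P 2 1 4 3 else P 1 2 3 4) \<circ> (if w = 1 then P 3 4 1 2 else P 1 2 3 4) \<circ>
       (if k = 0 then P 1 2 3 4 else if k = 1 then P 1 3 4 2 else P 1 4 2 3))"
  have tr: "P 2 1 4 3 = Transposition.transpose 1 2 \<circ> Transposition.transpose 3 4" "P 3 4 1 2 = Transposition.transpose 1 3 \<circ> Transposition.transpose 2 4"
    "P 1 3 4 2 = Transposition.transpose 2 3 \<circ> Transposition.transpose 3 4" "P 1 4 2 3 = Transposition.transpose 3 4 \<circ> Transposition.transpose 2 3" "P 1 2 3 4 = id"
    by (simp_all add: P_def Transposition.transpose_def fun_eq_iff)
  have alt_comp: "p \<circ> q \<in> carrier (alt_group 4)" if "p \<in> carrier (alt_group 4)" "q \<in> carrier (alt_group 4)" for p q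
    using monoid.m_closed[OF group.is_monoid[OF alt_group_is_group[of 4]] that] by (simp only: alt_group_mult)
  have alt_tr: "Transposition.transpose a b \<circ> Transposition.transpose c d \<in> carrier (alt_group 4)"
    if "a \<in> {1..4}" "b \<in> {1..4}" "c \<in> {1..4}" "d \<in> {1..4}" "a \<noteq> b" "c \<noteq> d" for a b c d :: nat
    using that unfolding alt_group_carrier
    by (simp add: evenperm_comp permutation_swap_id evenperm_swap permutes_compose permutes_swap_id)
  have id: "id \<in> carrier (alt_group 4)"
    by (simp add: alt_group_carrier permutes_id)
  have A4_carrier: "carrier A4 = ({0, 1} \<times> {0, 1}) \<times> {0, 1, 2}"
    by (simp add: A4_def interval_unfold)
  have gens: "P 1 2 3 4 \<in> carrier (alt_group 4)" "P 2 1 4 3 \<in> carrier (alt_group 4)"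
    "P 3 4 1 2 \<in> carrier (alt_group 4)" "P 1 3 4 2 \<in> carrier (alt_group 4)" "P 1 4 2 3 \<in> carrier (alt_group 4)"
    unfolding tr using id by (simp_all add: alt_tr)
  have h_closed': "h x \<in> carrier (alt_group 4)" for x
    unfolding h_def case_prod_unfold by (intro alt_comp; simp add: gens del: One_nat_def)
  then have h_closed: "h ` carrier A4 \<subseteq> carrier (alt_group 4)"
    by blast
  have hom: "h \<in> hom A4 (alt_group 4)"
  proof (rule homI)
    show "h x \<in> carrier (alt_group 4)" if "x \<in> carrier A4" for x
      by (rule h_closed')
    fix x y assume "x \<in> carrier A4" "y \<in> carrier A4"
    then obtain v w k v' w' k' where "x = ((v, w), k)" "y = ((v', w'), k')"
      and *: "v = 0 \<or> v = 1" "w = 0 \<or> w = 1" "k = 0 \<or> k = 1 \<or> k = 2"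
        "v' = 0 \<or> v' = 1" "w' = 0 \<or> w' = 1" "k' = 0 \<or> k' = 1 \<or> k' = 2"
      unfolding A4_carrier by blast
    then show "h (x \<otimes>\<^bsub>A4\<^esub> y) = h x \<otimes>\<^bsub>alt_group 4\<^esub> h y"
      unfolding alt_group_mult
      by (elim disjE; simp add: A4_def h_def P_comp P_eq P_app pow2)
  qed
  have inj: "inj_on h (carrier A4)"
    unfolding A4_carrier by (auto simp: inj_on_def h_def P_comp P_eq P_app)
  have "card (h ` carrier A4) = 12"
    using inj by (simp add: card_image) (simp add: A4_carrier card_cartesian_product)
  moreover have "card (carrier (alt_group 4)) = 12"
    using alt_group_card_carrier[of 4] by (simp add: eval_nat_numeral)
  ultimately have "h ` carrier A4 = carrier (alt_group 4)"
    using h_closed by (intro card_subset_eq) (auto simp: card_ge_0_finite)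
  then have "h \<in> iso A4 (alt_group 4)"
    using hom inj by (auto simp: iso_def bij_betw_def)
  then show ?thesis
    by (auto simp: is_iso_def)
qed

lemma group_SmallGroup_336_136: "Group.group SmallGroup_336_136"
proof -
  define c :: "int \<times> (int \<times> int) \<times> int \<Rightarrow> int" where
    "c = (\<lambda>(c, v, k). 2 ^ nat k * (-1) ^ nat c)"
  have "SmallGroup_336_136 = semidirect (cyc 7) (cyc 4 \<times>\<times> A4) (\<lambda>x a. (c x * a) mod int 7)"
    by (simp add: SmallGroup_336_136_def c_def case_prod_unfold)
  also have "Group.group \<dots>"
    by (rule group_semidirect_mult)
      (auto simp: DirProd_group group_A4, auto simp: c_def A4_def two_neg_one_power_mod)
  finally show ?thesis .
qed

lemma group_SmallGroup_168_43: "Group.group SmallGroup_168_43"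
proof -
  define \<phi> where "\<phi> = (\<lambda>(u, k). (F8_mult_t ^^ nat u) \<circ> (F8_frobenius ^^ nat k))"
  let ?V = "cyc 2 \<times>\<times> cyc 2 \<times>\<times> cyc 2"
  have frob: "F8_frobenius v \<in> carrier ?V" "F8_mult_t v \<in> carrier ?V" if "v \<in> carrier ?V" for v
    using that by (auto simp: F8_frobenius_def F8_mult_t_def)
  then have pow: "(F8_frobenius ^^ k) v \<in> carrier ?V" "(F8_mult_t ^^ k) v \<in> carrier ?V"
    if "v \<in> carrier ?V" for v k
    using that by (induction k) (simp_all del: carrier_DirProd cyc_carrier_numeral)
  have hom: "F8_frobenius (v \<otimes>\<^bsub>?V\<^esub> w) = F8_frobenius v \<otimes>\<^bsub>?V\<^esub> F8_frobenius w"
    "F8_mult_t (v \<otimes>\<^bsub>?V\<^esub> w) = F8_mult_t v \<otimes>\<^bsub>?V\<^esub> F8_mult_t w" for v w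
    by (simp_all add: F8_frobenius_def F8_mult_t_def DirProd_def case_prod_unfold mod_simps, simp_all add: algebra_simps)
  have homp: "(F8_frobenius ^^ k) (v \<otimes>\<^bsub>?V\<^esub> w) = (F8_frobenius ^^ k) v \<otimes>\<^bsub>?V\<^esub> (F8_frobenius ^^ k) w"
    "(F8_mult_t ^^ k) (v \<otimes>\<^bsub>?V\<^esub> w) = (F8_mult_t ^^ k) v \<otimes>\<^bsub>?V\<^esub> (F8_mult_t ^^ k) w" for v w k
    by (induction k) (simp_all add: hom)
  have elem: "v \<in> {0, 1} \<times> {0, 1} \<times> {0, 1}" if "v \<in> carrier ?V" for v
    using that by (simp add: interval_unfold(1))
  have conj: "F8_frobenius (F8_mult_t v) = (F8_mult_t ^^ 2) (F8_frobenius v)" if "v \<in> carrier ?V" for v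
  proof -
    have "(F8_mult_t ^^ 2) w = F8_mult_t (F8_mult_t w)" for w
      by (simp add: numeral_2_eq_2)
    then show ?thesis
      using elem[OF that] by (auto simp: F8_frobenius_def F8_mult_t_def)
  qed
  have conj_u: "F8_frobenius ((F8_mult_t ^^ u) v) = (F8_mult_t ^^ (2 * u)) (F8_frobenius v)"
    if "v \<in> carrier ?V" for u v
    by (induction u) (simp_all only: funpow.simps id_apply comp_apply mult_0_right mult_Suc_right funpow_add conj
        pow that)
  have conj_k: "(F8_frobenius ^^ k) ((F8_mult_t ^^ u) v) = (F8_mult_t ^^ (2 ^ k * u)) ((F8_frobenius ^^ k) v)"
    if "v \<in> carrier ?V" for k u v
    by (induction k) (simp_all only: funpow.simps id_apply comp_apply power_0 power_Suc mult_1 mult.assoc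
        conj_u pow that)
  have mod7: "(F8_mult_t ^^ (n mod 7)) v = (F8_mult_t ^^ n) v" if "v \<in> carrier ?V" for n v
  proof (rule funpow_mod_eq)
    show "(F8_mult_t ^^ 7) v = v"
      using elem[OF that] by (auto simp: F8_mult_t_def numeral_eq_Suc)
  qed
  have mod3: "(F8_frobenius ^^ (n mod 3)) v = (F8_frobenius ^^ n) v" if "v \<in> carrier ?V" for n v
  proof (rule funpow_mod_eq)
    show "(F8_frobenius ^^ 3) v = v"
      using elem[OF that] by (auto simp: F8_frobenius_def numeral_eq_Suc)
  qed
  have act: "(F8_mult_t ^^ nat ((u + (2 ^ nat k * u') mod 7) mod 7)) ((F8_frobenius ^^ nat ((k + k') mod 3)) v)
      = (F8_mult_t ^^ nat u) ((F8_frobenius ^^ nat k) ((F8_mult_t ^^ nat u') ((F8_frobenius ^^ nat k') v)))"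
    if "v \<in> carrier ?V" "0 \<le> u" "0 \<le> u'" "0 \<le> k" "0 \<le> k'" for v u u' k k'
  proof -
    have "nat ((u + (2 ^ nat k * u') mod 7) mod 7) = (nat u + 2 ^ nat k * nat u') mod 7"
      "nat ((k + k') mod 3) = (nat k + nat k') mod 3"
      using that(2-) by (simp_all add: mod_simps nat_mod_distrib nat_add_distrib nat_mult_distrib nat_power_eq)
    then show ?thesis
      by (simp only: mod7 mod3 pow that(1) funpow_add comp_apply conj_k)
  qed
  have "Group.group (semidirect ?V SmallGroup_21_1 \<phi>)"
  proof (rule group_semidirect)
    show "\<phi> k v \<in> carrier ?V" if "v \<in> carrier ?V" for k v
      by (simp only: \<phi>_def case_prod_unfold comp_apply pow that)
  next
    show "\<phi> (k \<otimes>\<^bsub>SmallGroup_21_1\<^esub> k') v = \<phi> k (\<phi> k' v)"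
      if "k \<in> carrier SmallGroup_21_1" "k' \<in> carrier SmallGroup_21_1" "v \<in> carrier ?V" for k k' v
    proof -
      obtain a b a' b' where eq: "k = (a, b)" "k' = (a', b')"
        by (metis surj_pair)
      have "0 \<le> a" "0 \<le> a'" "0 \<le> b" "0 \<le> b'"
        using that(1,2) by (simp_all add: eq SmallGroup_21_1_def)
      from act[OF that(3) this] show ?thesis
        by (simp add: eq \<phi>_def SmallGroup_21_1_def)
    qed
  qed (simp_all add: DirProd_group group_SmallGroup_21_1, simp_all add: \<phi>_def case_prod_unfold pow homp
        SmallGroup_21_1_def del: carrier_DirProd)
  then show ?thesis
    by (simp add: SmallGroup_168_43_def \<phi>_def)
qed

lemma group_SmallGroup_1008_289: "Group.group SmallGroup_1008_289"
proof -
  define c :: "int \<times> int \<Rightarrow> int" where "c = (\<lambda>(i, j). (-1) ^ nat i)"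
  define d :: "int \<times> int \<times> int \<times> int \<Rightarrow> int" where "d = (\<lambda>(k, b, q). 2 ^ nat k * c q)"
  have par: "even ((i + (-1) ^ nat j * i' + 4 * j'') mod 8 :: int) = even (i + i')" for i i' j j'' :: int
    by (simp add: dvd_mod_iff)
  have sgn: "(-1 :: int) ^ nat ((i + (-1) ^ nat j * i' + 4 * (j * j')) mod 8) = (-1) ^ nat i * (-1) ^ nat i'"
    if "0 \<le> i" "0 \<le> i'" for i i' j j'
    using par[of i j i' "j * j'"] that
    by (intro neg_one_power_parity) (simp_all add: even_nat_iff)
  have cQ: "c (q \<otimes>\<^bsub>quaternion_group 16\<^esub> q') = c q * c q'"
    if "q \<in> carrier (quaternion_group 16)" "q' \<in> carrier (quaternion_group 16)" for q q'
  proof -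
    obtain i j i' j' where eq: "q = (i, j)" "q' = (i', j')"
      by (metis surj_pair)
    have "0 \<le> i" "0 \<le> i'"
      using that by (simp_all add: eq quaternion_group_def)
    then show ?thesis
      by (simp add: eq c_def quaternion_group_def sgn)
  qed
  have Q: "Group.group (semidirect (cyc 3) (quaternion_group 16) (\<lambda>q b. (c q * b) mod int 3))"
    by (rule group_semidirect_mult)
      (simp_all add: group_quaternion cQ, simp add: c_def quaternion_group_def)
  have "SmallGroup_1008_289 = semidirect (cyc 7)
     (cyc 3 \<times>\<times> semidirect (cyc 3) (quaternion_group 16) (\<lambda>q b. (c q * b) mod int 3))
     (\<lambda>x a. (d x * a) mod int 7)"
    by (simp add: SmallGroup_1008_289_def c_def d_def case_prod_unfold)
  also have "Group.group \<dots>"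
  proof (rule group_semidirect_mult)
    show "Group.group (cyc 3 \<times>\<times> semidirect (cyc 3) (quaternion_group 16) (\<lambda>q b. (c q * b) mod int 3))"
      by (intro DirProd_group group_integer_mod_group Q)
  next
    fix k k'
    assume k: "k \<in> carrier (cyc 3 \<times>\<times> semidirect (cyc 3) (quaternion_group 16) (\<lambda>q b. (c q * b) mod int 3))"
      "k' \<in> carrier (cyc 3 \<times>\<times> semidirect (cyc 3) (quaternion_group 16) (\<lambda>q b. (c q * b) mod int 3))"
    obtain a b q a' b' q' where eq: "k = (a, b, q)" "k' = (a', b', q')"
      by (metis surj_pair)
    have *: "0 \<le> a" "a < 3" "0 \<le> a'" "a' < 3"
      "q \<in> carrier (quaternion_group 16)" "q' \<in> carrier (quaternion_group 16)"
      using k unfolding eq by simp_all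
    have 1: "2 ^ nat ((a + a') mod 3) * c (q \<otimes>\<^bsub>quaternion_group 16\<^esub> q') mod (7 :: int)
        = (2 ^ nat a * 2 ^ nat a') * (c q * c q') mod 7"
      by (simp only: cQ[OF *(5,6)] mod_mult_cong[OF two_power_mod[OF *(1-4)] refl])
    have 2: "d (k \<otimes>\<^bsub>cyc 3 \<times>\<times> semidirect (cyc 3) (quaternion_group 16) (\<lambda>q b. (c q * b) mod int 3)\<^esub> k')
        = 2 ^ nat ((a + a') mod 3) * c (q \<otimes>\<^bsub>quaternion_group 16\<^esub> q')"
      by (simp add: eq d_def)
    have 3: "d k * d k' = (2 ^ nat a * 2 ^ nat a') * (c q * c q')"
      by (simp add: eq d_def)
    show "d (k \<otimes>\<^bsub>cyc 3 \<times>\<times> semidirect (cyc 3) (quaternion_group 16) (\<lambda>q b. (c q * b) mod int 3)\<^esub> k') mod int 7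
        = d k * d k' mod int 7"
      using 1 unfolding 2 3 unfolding of_nat_numeral .
  qed (simp_all add: c_def d_def quaternion_group_def)
  finally show ?thesis .
qed

lemma group_sylow2_1344: "Group.group sylow2_1344"
proof -
  have D: "carrier (dihedral_group 8) = {0..<4} \<times> {0..<2}"
    by (simp add: dihedral_group_def)
  show ?thesis
    unfolding sylow2_1344_def
  proof (rule group_semidirect_cyc)
    fix x y
    assume "x \<in> carrier (cyc 4 \<times>\<times> dihedral_group 8)" "y \<in> carrier (cyc 4 \<times>\<times> dihedral_group 8)"
    then obtain i j k i' j' k' where *: "x = (i, j, k)" "y = (i', j', k')" "k \<in> {0, 1}" "k' \<in> {0, 1}"
      by (auto simp: D interval_unfold(1))
    show "(\<lambda>(i, j, k). ((- i + 2 * k) mod 4, - j mod 4, k)) (x \<otimes>\<^bsub>cyc 4 \<times>\<times> dihedral_group 8\<^esub> y)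
        = (\<lambda>(i, j, k). ((- i + 2 * k) mod 4, - j mod 4, k)) x \<otimes>\<^bsub>cyc 4 \<times>\<times> dihedral_group 8\<^esub>
          (\<lambda>(i, j, k). ((- i + 2 * k) mod 4, - j mod 4, k)) y"
      using *(3,4) unfolding *(1,2)
      by (auto simp: dihedral_group_def mod_simps; presburger)
  qed (auto simp: DirProd_group group_dihedral_8 D interval_unfold(1) mod_simps numeral_2_eq_2)
qed

lemma sylow2_1344_carrier: "z \<in> carrier sylow2_1344 \<longleftrightarrow>
    (\<exists>i j k l. z = ((i, j, k), l) \<and> i \<in> {0, 1, 2, 3} \<and> j \<in> {0, 1, 2, 3} \<and> k \<in> {0, 1} \<and> l \<in> {0, 1})"
  by (auto simp: sylow2_1344_def dihedral_group_def)

lemma sylow2_1344_mult: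
  assumes "k \<in> {0, 1}" "l \<in> {0, 1}"
  shows "((i, j, k), l) \<otimes>\<^bsub>sylow2_1344\<^esub> ((i', j', k'), l') =
    (((i + (if l = 0 then i' else 2 * k' - i')) mod 4,
      (j + (if k = l then j' else - j')) mod 4, (k + k') mod 2), (l + l') mod 2)"
  using assms
  by (auto simp: sylow2_1344_def dihedral_group_def mod_simps)

lemma sylow2_1344_auto:
  assumes "i \<in> {0, 1, 2, 3}" "j \<in> {0, 1, 2, 3}" "k \<in> {0, 1}" "l \<in> {0, 1}"
  shows "sylow2_1344_auto ((i, j, k), l) =
    (if even i then (((i + k + 2 * k * l) mod 4, j, l), k)
     else (((i + 1 - k - 2 * l + 2 * k * l) mod 4, j, 1 - l), 1 - k))"
proof -
  have one: "\<one>\<^bsub>sylow2_1344\<^esub> = ((0, 0, 0), 0)"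
    by (simp add: sylow2_1344_def dihedral_group_def)
  show ?thesis
    using assms by (auto simp: sylow2_1344_auto_def sylow2_1344_mult numeral_eq_Suc one)
qed

lemma sylow2_1344_auto_check:
  "let S = List.product [0, 1, 2, 3] (List.product [0, 1] [0, 1]);
      m = (\<lambda>(i, k, l) (i', k', l').
        ((i + (if l = 0 then i' else 2 * k' - i')) mod 4, (k + k') mod 2, (l + l') mod 2));
      a = (\<lambda>(i, k, l). if even i then ((i + k + 2 * k * l) mod 4, l, k)
        else ((i + 1 - k - 2 * l + 2 * k * l) mod 4, 1 - l, 1 - k))
    in (\<forall>x \<in> set S. \<forall>y \<in> set S. a (m x y) = m (a x) (a y)) \<and> (\<forall>x \<in> set S. a (a (a x)) = (x :: int \<times> int \<times> int))"
  by code_simp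

lemma group_sylow2_1344_auto:
  "Group.group (semidirect sylow2_1344 (cyc 3) (\<lambda>c. sylow2_1344_auto ^^ nat c))"
proof -
  define S :: "(int \<times> int \<times> int) set" where "S = {0, 1, 2, 3} \<times> {0, 1} \<times> {0, 1}"
  define m :: "int \<times> int \<times> int \<Rightarrow> int \<times> int \<times> int \<Rightarrow> int \<times> int \<times> int"
    where "m = (\<lambda>(i, k, l) (i', k', l').
        ((i + (if l = 0 then i' else 2 * k' - i')) mod 4, (k + k') mod 2, (l + l') mod 2))"
  define a :: "int \<times> int \<times> int \<Rightarrow> int \<times> int \<times> int"
    where "a = (\<lambda>(i, k, l). if even i then ((i + k + 2 * k * l) mod 4, l, k)
        else ((i + 1 - k - 2 * l + 2 * k * l) mod 4, 1 - l, 1 - k))"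
  have S: "set (List.product [0, 1, 2, 3] (List.product [0, 1] [0, 1])) = S"
    by (simp add: S_def)
  have hom: "a (m x y) = m (a x) (a y)" and per: "a (a (a x)) = x" if "x \<in> S" "y \<in> S" for x y
    using sylow2_1344_auto_check[unfolded Let_def S, folded m_def a_def] that by blast+
  have mod4: "j mod 4 \<in> {0, 1, 2, 3}" for j :: int
    by (simp only: insert_iff empty_iff) presburger
  have mod2: "j mod 2 \<in> {0, 1}" for j :: int
    by (simp only: insert_iff empty_iff) presburger
  have m_closed: "m x y \<in> S" for x y
    by (simp only: S_def m_def case_prod_unfold mem_Times_iff fst_conv snd_conv mod4 mod2 simp_thms)
  have a_closed: "a x \<in> S" if "x \<in> S" for x
    using that by (auto simp: S_def a_def)
  have a_eq: "fst (snd (a x)) = snd (snd (a x)) \<longleftrightarrow> fst (snd x) = snd (snd x)" if "x \<in> S" for x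
    using that by (auto simp: S_def a_def)
  define e :: "int \<Rightarrow> int \<times> int \<times> int \<Rightarrow> (int \<times> int \<times> int) \<times> int"
    where "e = (\<lambda>j (i, k, l). ((i, j, k), l))"
  have carrier: "\<exists>j x. z = e j x \<and> j \<in> {0, 1, 2, 3} \<and> x \<in> S" if zc: "z \<in> carrier sylow2_1344" for z
  proof -
    obtain i j k l where z: "z = ((i, j, k), l)" "j \<in> {0, 1, 2, 3}"
      "i \<in> {0, 1, 2, 3}" "k \<in> {0, 1}" "l \<in> {0, 1}"
      using zc unfolding sylow2_1344_carrier by blast
    then have "z = e j (i, k, l)" "(i, k, l) \<in> S"
      unfolding S_def e_def by (simp_all only: case_prod_conv mem_Times_iff fst_conv snd_conv simp_thms)
    then show ?thesis
      using z(2) by blast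
  qed
  have e_carrier: "e j x \<in> carrier sylow2_1344" if "j \<in> {0, 1, 2, 3}" "x \<in> S" for j x
  proof -
    obtain i k l where x: "x = (i, k, l)"
      by (metis surj_pair)
    show ?thesis
      using that unfolding x sylow2_1344_carrier S_def e_def mem_Times_iff fst_conv snd_conv case_prod_conv by blast
  qed
  have e_mult: "e j x \<otimes>\<^bsub>sylow2_1344\<^esub> e j' y = e ((j + (if fst (snd x) = snd (snd x) then j' else - j')) mod 4) (m x y)"
    if "x \<in> S" for j x j' y
  proof -
    obtain i k l i' k' l' where eq: "x = (i, k, l)" "y = (i', k', l')"
      by (metis surj_pair)
    have "k \<in> {0, 1}" "l \<in> {0, 1}"
      using that unfolding eq S_def mem_Times_iff fst_conv snd_conv by blast+
    then show ?thesis
      unfolding eq e_def m_def case_prod_conv fst_conv snd_conv by (rule sylow2_1344_mult)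
  qed
  have e_auto: "sylow2_1344_auto (e j x) = e j (a x)" if "j \<in> {0, 1, 2, 3}" "x \<in> S" for j x
  proof -
    obtain i k l where eq: "x = (i, k, l)"
      by (metis surj_pair)
    have kl: "i \<in> {0, 1, 2, 3}" "k \<in> {0, 1}" "l \<in> {0, 1}"
      using that(2) unfolding eq S_def mem_Times_iff fst_conv snd_conv by blast+
    show ?thesis
      unfolding eq e_def a_def case_prod_conv sylow2_1344_auto[OF kl(1) that(1) kl(2,3)]
      by (simp only: case_prod_conv split: if_split) blast
  qed
  show ?thesis
  proof (rule group_semidirect_cyc)
    fix z assume "z \<in> carrier sylow2_1344"
    then obtain j x where z: "z = e j x" "j \<in> {0, 1, 2, 3}" "x \<in> S"
      using carrier by blast
    show "sylow2_1344_auto z \<in> carrier sylow2_1344"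
      unfolding z(1) e_auto[OF z(2,3)] by (rule e_carrier[OF z(2) a_closed[OF z(3)]])
    show "(sylow2_1344_auto ^^ 3) z = z"
      by (simp only: z(1) numeral_3_eq_3 funpow.simps comp_apply id_apply e_auto z(2,3) a_closed per[OF z(3) z(3)])
    fix z' assume "z' \<in> carrier sylow2_1344"
    then obtain j' x' where z': "z' = e j' x'" "j' \<in> {0, 1, 2, 3}" "x' \<in> S"
      using carrier by blast
    show "sylow2_1344_auto (z \<otimes>\<^bsub>sylow2_1344\<^esub> z') = sylow2_1344_auto z \<otimes>\<^bsub>sylow2_1344\<^esub> sylow2_1344_auto z'"
      unfolding z(1) z'(1) e_auto[OF z(2,3)] e_auto[OF z'(2,3)] e_mult[OF z(3)]
        e_mult[OF a_closed[OF z(3)]] e_auto[OF mod4 m_closed] hom[OF z(3) z'(3)]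
        a_eq[OF z(3)] ..
  qed (simp_all add: group_sylow2_1344)
qed

lemma group_SmallGroup_1344_6967: "Group.group SmallGroup_1344_6967"
proof -
  let ?K = "semidirect sylow2_1344 (cyc 3) (\<lambda>c. sylow2_1344_auto ^^ nat c)"
  define s :: "(int \<times> int \<times> int) \<times> int \<Rightarrow> int" where "s = (\<lambda>((i, j, k), l). (-1) ^ nat j)"
  define d :: "((int \<times> int \<times> int) \<times> int) \<times> int \<Rightarrow> int" where "d = (\<lambda>(z, c). 2 ^ nat c * s z)"
  note C = sylow2_1344_carrier
  have s_auto: "s ((sylow2_1344_auto ^^ n) z) = s z \<and> (sylow2_1344_auto ^^ n) z \<in> carrier sylow2_1344"
    if "z \<in> carrier sylow2_1344" for n z
  proof (induction n)
    case (Suc n)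
    then obtain i j k l where z: "(sylow2_1344_auto ^^ n) z = ((i, j, k), l)"
        "i \<in> {0, 1, 2, 3}" "j \<in> {0, 1, 2, 3}" "k \<in> {0, 1}" "l \<in> {0, 1}"
      using C by blast
    have "sylow2_1344_auto ((i, j, k), l) \<in> carrier sylow2_1344"
      using z(2-) unfolding C sylow2_1344_auto[OF z(2-)] by auto
    then show ?case
      using Suc z(1) sylow2_1344_auto[OF z(2-)] by (simp add: s_def split: if_splits)
  qed (use that in auto)
  have s_mult: "s (z \<otimes>\<^bsub>sylow2_1344\<^esub> z') = s z * s z'"
    if zc: "z \<in> carrier sylow2_1344" and zc': "z' \<in> carrier sylow2_1344" for z z'
  proof -
    obtain i j k l where z: "z = ((i, j, k), l)" "j \<in> {0, 1, 2, 3}" "k \<in> {0, 1}" "l \<in> {0, 1}"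
      using zc unfolding C by blast
    obtain i' j' k' l' where z': "z' = ((i', j', k'), l')" "j' \<in> {0, 1, 2, 3}"
      using zc' unfolding C by blast
    have "(-1 :: int) ^ nat ((j + (if k = l then j' else - j')) mod 4) = (-1) ^ nat j * (-1) ^ nat j'"
      by (cases "k = l") (use z(2) z'(2) in auto)
    then show ?thesis
      unfolding z(1) z'(1) sylow2_1344_mult[OF z(3,4)] by (simp only: s_def case_prod_conv)
  qed
  have "SmallGroup_1344_6967 = semidirect (cyc 7) ?K (\<lambda>x a. (d x * a) mod int 7)"
    by (simp add: SmallGroup_1344_6967_def d_def s_def case_prod_unfold)
  also have "Group.group \<dots>"
  proof (rule group_semidirect_mult)
    fix x y assume x: "x \<in> carrier ?K" and y: "y \<in> carrier ?K"
    obtain z c z' c' where eq: "x = (z, c)" "y = (z', c')"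
      by (metis surj_pair)
    have *: "z \<in> carrier sylow2_1344" "z' \<in> carrier sylow2_1344"
      "0 \<le> c" "c < 3" "0 \<le> c'" "c' < 3"
      using x y unfolding eq by simp_all
    have 1: "2 ^ nat ((c + c') mod 3) * (s z * s z') mod (7 :: int)
        = (2 ^ nat c * 2 ^ nat c') * (s z * s z') mod 7"
      by (rule mod_mult_cong[OF two_power_mod[OF *(3-6)] refl])
    have "s (z \<otimes>\<^bsub>sylow2_1344\<^esub> (sylow2_1344_auto ^^ nat c) z') = s z * s z'"
      using s_auto[OF *(2)] s_mult[OF *(1)] by simp
    then have 2: "d (x \<otimes>\<^bsub>?K\<^esub> y) = 2 ^ nat ((c + c') mod 3) * (s z * s z')"
      by (simp add: eq d_def)
    have 3: "d x * d y = (2 ^ nat c * 2 ^ nat c') * (s z * s z')"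
      by (simp add: eq d_def)
    show "d (x \<otimes>\<^bsub>?K\<^esub> y) mod int 7 = d x * d y mod int 7"
      using 1 unfolding 2 3 unfolding of_nat_numeral .
  next
    show "d \<one>\<^bsub>?K\<^esub> = 1"
      by (simp add: d_def s_def sylow2_1344_def dihedral_group_def)
  qed (simp_all add: group_sylow2_1344_auto)
  finally show ?thesis .
qed

lemma group_general_linear_group:
  "Group.group (general_linear_group :: ('a::comm_ring_1 ^ 'n ^ 'n) monoid)"
proof (rule groupI)
  fix A :: "'a ^ 'n ^ 'n" assume "A \<in> carrier general_linear_group"
  then obtain B where "A ** B = mat 1" "B ** A = mat 1"
    by (auto simp: general_linear_group_def invertible_def)
  then show "\<exists>B\<in>carrier general_linear_group. B \<otimes>\<^bsub>general_linear_group\<^esub> A = \<one>\<^bsub>general_linear_group\<^esub>"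
    by (auto simp: general_linear_group_def invertible_def)
qed (auto simp: general_linear_group_def invertible_mult matrix_mul_assoc invertible_def[of "mat 1"])

lemma mat_mult_commute: "mat c ** A = A ** mat c" for A :: "'a::comm_ring_1 ^ 'n ^ 'n"
  by (simp add: matrix_matrix_mult_def mat_def vec_eq_iff if_distrib if_distribR mult.commute cong: if_cong)

lemma mat_mult_mat: "mat c ** mat d = (mat (c * d) :: 'a::comm_ring_1 ^ 'n ^ 'n)"
  by (simp add: matrix_matrix_mult_def mat_def vec_eq_iff if_distrib[of "\<lambda>x. x * _"] cong: if_cong)

lemma group_projective_linear_group:
  "Group.group (projective_linear_group :: ('a::comm_ring_1 ^ 'n ^ 'n) set monoid)"
proof -
  interpret GL: Group.group "general_linear_group :: ('a ^ 'n ^ 'n) monoid"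
    by (rule group_general_linear_group)
  let ?Z = "{A :: 'a ^ 'n ^ 'n. invertible A \<and> (\<exists>c. A = mat c)}"
  have "subgroup ?Z general_linear_group"
  proof (rule GL.subgroupI)
    show "?Z \<subseteq> carrier general_linear_group"
      by (auto simp: general_linear_group_def)
    show "?Z \<noteq> {}"
      by (auto simp: invertible_def intro: exI[of _ "mat 1"])
  next
    fix A B :: "'a ^ 'n ^ 'n" assume "A \<in> ?Z" "B \<in> ?Z"
    then show "A \<otimes>\<^bsub>general_linear_group\<^esub> B \<in> ?Z"
      by (auto simp: general_linear_group_def mat_mult_mat intro: invertible_mult)
  next
    fix A :: "'a ^ 'n ^ 'n" assume A: "A \<in> ?Z"
    then obtain c where c: "A = mat c" "A \<in> carrier general_linear_group"
      by (auto simp: general_linear_group_def)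
    define B where "B = inv\<^bsub>general_linear_group\<^esub> A"
    have B: "B ** A = mat 1" "invertible B"
      using GL.inv_closed[OF c(2)] GL.l_inv[OF c(2)] by (simp_all add: B_def general_linear_group_def)
    obtain i :: 'n where True
      by simp
    define d where "d = B $ i $ i"
    have "(B ** mat c) $ i $ i = 1"
      using B(1) c(1) by (simp add: mat_def)
    then have "d * c = 1"
      by (simp add: d_def matrix_matrix_mult_def mat_def if_distrib cong: if_cong)
    then have "A ** mat d = mat 1"
      by (simp add: c(1) mat_mult_mat mult.commute)
    then have "B = mat d"
      using B(1) by (metis matrix_mul_assoc matrix_mul_lid matrix_mul_rid)
    then show "inv\<^bsub>general_linear_group\<^esub> A \<in> ?Z"
      using B unfolding B_def by blast
  qed
  then have "?Z \<lhd> general_linear_group"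
    by (rule GL.normalI) (auto simp: r_coset_def l_coset_def general_linear_group_def mat_mult_commute)
  then show ?thesis
    unfolding projective_linear_group_def by (rule normal.factorgroup_is_group)
qed

lemma group_SmallGroup_336_208: "Group.group SmallGroup_336_208"
  unfolding SmallGroup_336_208_def by (rule group_projective_linear_group)

end

theory Submission
  imports Defs "HOL-Analysis.Determinants"
begin

text \<open>
  For a finite group \<open>X\<close> let \<open>t\<^sub>X(d)\<close> be the number of solutions of \<open>x\<^sup>d = 1\<close> in \<open>X\<close>. It is the sum of the
  values of the order type at the divisors of \<open>d\<close>, so by Moebius inversion \<open>t\<^sub>X\<close> and the order type determine each
  other (\<open>order_type_eqI\<close>). The advantage of \<open>t\<^sub>X\<close> is that it is multiplicative over direct products: the order
  types of \<open>G\<close> and \<open>H\<close> agree because, for every \<open>d\<close>, the two products of the numbers for the factors agree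
  (\<open>card_torsion_products_eq\<close>). These numbers depend only on which of 2, 4, 8, 3, 7 divide \<open>d\<close>.

  The factors \<open>S\<^sub>2\<close>, \<open>S\<^sub>3\<close>, \<open>S\<^sub>4\<close>, \<open>S\<^sub>6\<close> have the form \<open>C\<^sub>7 \<rtimes> K\<close>, where \<open>K\<close> acts through a character \<open>c\<close> with values
  in the nonzero residues modulo 7. If \<open>k\<^sup>d = 1\<close> and \<open>c k \<noteq> 1\<close>, then the geometric sum of \<open>c k\<close> vanishes and
  \<open>(a, k)\<^sup>d = 1\<close> for all seven \<open>a\<close>; if \<open>c k = 1\<close>, then this holds for all \<open>a\<close> or only for \<open>a = 0\<close>, according to
  whether 7 divides \<open>d\<close>. So \<open>t(d)\<close> follows from the number of solutions in \<open>K\<close> and in the kernel of \<open>c\<close>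
  (\<open>card_torsion_semidirect_prime\<close>). The groups \<open>K\<close> are built from cyclic and quaternion groups and from
  extensions \<open>N \<rtimes> C\<^sub>3\<close>, whose elements outside \<open>N\<close> are treated through their cubes
  (\<open>card_torsion_semidirect_cyc3\<close>). For \<open>S\<^sub>1\<close>, the solutions above each element of the Frobenius group of order
  21 are counted. For \<open>S\<^sub>7 = PGL\<^sub>2(7)\<close>, one has to count the matrices with a scalar \<open>d\<close>-th power. By Cayley and
  Hamilton, \<open>A\<^sup>d = u\<^sub>d A - D u\<^sub>d\<^sub>-\<^sub>1\<close> with the Lucas sequence \<open>u\<close> of the trace and the determinant \<open>D\<close> of \<open>A\<close>, so a
  non-scalar \<open>A\<close> qualifies iff \<open>u\<^sub>d = 0\<close> (\<open>GL7_pow_in_Z7_iff\<close>).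

  \<open>G\<close> is solvable since its factors arise from cyclic groups by iterated extensions. If \<open>H\<close> were solvable, so would be
  its factor \<open>PGL\<^sub>2(7)\<close>. But three elements of a solvable group with product 1 and pairwise coprime orders are
  trivial (\<open>solvable_seq_coprime_triple\<close>), whereas \<open>PGL\<^sub>2(7)\<close> contains elements of orders 2, 3, 7 with product 1.
\<close>


section \<open>Order types and solutions of \<open>x\<^sup>d = 1\<close>\<close>

text \<open>For abelian \<open>G\<close> this is the \<open>d\<close>-torsion subgroup; in general it is only a subset.\<close>

definition torsion :: "('a, 'b) monoid_scheme \<Rightarrow> nat \<Rightarrow> 'a set" where
  "torsion G d = {x \<in> carrier G. x [^]\<^bsub>G\<^esub> d = \<one>\<^bsub>G\<^esub>}"

lemma card_torsion_eq_sum_order_type: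
  assumes "Group.group G" "finite (carrier G)" "d > 0"
  shows "card (torsion G d) = (\<Sum>n | n dvd d. order_type G n)"
proof -
  have "torsion G d = (\<Union>n \<in> {n. n dvd d}. {x \<in> carrier G. group.ord G x = n})"
    using group.pow_eq_id[OF assms(1)] by (auto simp: torsion_def)
  also have "card \<dots> = (\<Sum>n | n dvd d. card {x \<in> carrier G. group.ord G x = n})"
    using assms by (intro card_UN_disjoint) auto
  finally show ?thesis
    by (simp add: order_type_def)
qed

text \<open>Moebius inversion: the sum over the divisors of \<open>n\<close> determines the term at \<open>n\<close> once the terms at
  the proper divisors are known.\<close>

lemma order_type_eqI:
  assumes "Group.group G" "finite (carrier G)" "Group.group H" "finite (carrier H)"
    and "\<And>d. d > 0 \<Longrightarrow> card (torsion G d) = card (torsion H d)" and "n > 0"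
  shows "order_type G n = order_type H n"
  using \<open>n > 0\<close>
proof (induction n rule: less_induct)
  case (less n)
  have split: "(\<Sum>m | m dvd n. f m) = f n + (\<Sum>m | m dvd n \<and> m < n. f m)" for f :: "nat \<Rightarrow> nat"
  proof -
    have "{m. m dvd n} = insert n {m. m dvd n \<and> m < n}"
      using less.prems by (auto dest: dvd_imp_le)
    then show ?thesis
      by simp
  qed
  have "(\<Sum>m | m dvd n. order_type G m) = (\<Sum>m | m dvd n. order_type H m)"
    using assms(5)[OF less.prems] less.prems assms(1-4)
    by (simp flip: card_torsion_eq_sum_order_type)
  moreover have "(\<Sum>m | m dvd n \<and> m < n. order_type G m) = (\<Sum>m | m dvd n \<and> m < n. order_type H m)"
    using less by (intro sum.cong) (auto intro!: less.IH dest: dvd_pos_nat)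
  ultimately show ?case
    by (simp only: split)
qed

lemma order_type_1:
  assumes "Group.group G"
  shows "order_type G 1 = 1"
proof -
  have "{x \<in> carrier G. group.ord G x = 1} = {\<one>\<^bsub>G\<^esub>}"
    using group.ord_eq_1[OF assms] group.ord_id[OF assms] monoid.one_closed[OF group.is_monoid[OF assms]] by auto
  then show ?thesis
    by (simp add: order_type_def)
qed

text \<open>If the numbers of elements of finitely many orders already add up to the size of the group, then no
  other order occurs. This turns finitely many values of \<open>card (torsion G d)\<close> into a formula valid for
  every \<open>d\<close>.\<close>

lemma card_torsion_by_census:
  assumes "Group.group G" "finite (carrier G)" "finite D" "(\<Sum>n\<in>D. order_type G n) = card (carrier G)"
  shows "card (torsion G d) = (\<Sum>n\<in>D. if n dvd d then order_type G n else 0)"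
proof -
  interpret Group.group G by fact
  have fin: "finite {x \<in> carrier G. ord x = n}" for n
    using assms(2) by simp
  have "card (\<Union>n\<in>D. {x \<in> carrier G. ord x = n}) = card (carrier G)"
    using assms(3,4) fin by (subst card_UN_disjoint) (auto simp: order_type_def)
  then have cover: "(\<Union>n\<in>D. {x \<in> carrier G. ord x = n}) = carrier G"
    using assms(2) by (intro card_subset_eq) auto
  have "ord x \<in> D" if "x \<in> carrier G" for x
    using cover that by blast
  then have "torsion G d = (\<Union>n\<in>{n\<in>D. n dvd d}. {x \<in> carrier G. ord x = n})"
    by (auto simp: torsion_def pow_eq_id)
  also have "card \<dots> = (\<Sum>n | n \<in> D \<and> n dvd d. order_type G n)"
    using assms(3) fin by (subst card_UN_disjoint) (auto simp: order_type_def)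
  also have "\<dots> = (\<Sum>n\<in>D. if n dvd d then order_type G n else 0)"
    using assms(3) by (intro sum.inter_filter)
  finally show ?thesis .
qed

lemma divisor_sets:
  "{n :: nat. n dvd 2} = {1, 2}" "{n :: nat. n dvd 3} = {1, 3}" "{n :: nat. n dvd 4} = {1, 2, 4}"
  "{n :: nat. n dvd 6} = {1, 2, 3, 6}" "{n :: nat. n dvd 7} = {1, 7}" "{n :: nat. n dvd 8} = {1, 2, 4, 8}"
proof -
  have *: "{n. n dvd m} = set (filter (\<lambda>n. n dvd m) [1..<m + 1])" if "m > 0" for m :: nat
    using that by (auto dest: dvd_imp_le dvd_pos_nat intro: Suc_leI)
  show "{n :: nat. n dvd 2} = {1, 2}" "{n :: nat. n dvd 3} = {1, 3}" "{n :: nat. n dvd 4} = {1, 2, 4}"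
    "{n :: nat. n dvd 6} = {1, 2, 3, 6}" "{n :: nat. n dvd 7} = {1, 7}" "{n :: nat. n dvd 8} = {1, 2, 4, 8}"
    by (subst *, simp, code_simp)+
qed

lemma DirProd_pow: "(x, y) [^]\<^bsub>G \<times>\<times> H\<^esub> (d::nat) = (x [^]\<^bsub>G\<^esub> d, y [^]\<^bsub>H\<^esub> d)"
  by (induction d) (simp_all add: nat_pow_def)

lemma torsion_DirProd: "torsion (G \<times>\<times> H) d = torsion G d \<times> torsion H d"
  by (auto simp: torsion_def DirProd_pow)

lemma card_torsion_iso:
  assumes "Group.group G" "Group.group H" "G \<cong> H"
  shows "card (torsion G d) = card (torsion H d)"
proof -
  obtain f where f: "f \<in> Group.iso G H"
    using assms(3) by (auto simp: is_iso_def)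
  interpret group_hom G H f
    using assms f by (simp add: group_hom_def group_hom_axioms_def Group.iso_def)
  have bij: "bij_betw f (carrier G) (carrier H)"
    using f by (simp add: Group.iso_def)
  have "f x [^]\<^bsub>H\<^esub> d = \<one>\<^bsub>H\<^esub> \<longleftrightarrow> x [^]\<^bsub>G\<^esub> d = \<one>\<^bsub>G\<^esub>" if "x \<in> carrier G" for x
    using inj_on_eq_iff[OF bij_betw_imp_inj_on[OF bij], of "x [^]\<^bsub>G\<^esub> d" "\<one>\<^bsub>G\<^esub>"] that
    by (simp flip: hom_nat_pow)
  moreover have carr: "carrier H = f ` carrier G"
    using bij by (simp add: bij_betw_def)
  ultimately have "torsion H d = f ` torsion G d"
    unfolding torsion_def carr by auto
  moreover have "inj_on f (torsion G d)"
    using bij by (auto simp: torsion_def bij_betw_def inj_on_def)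
  ultimately show ?thesis
    by (simp add: card_image)
qed


section \<open>Powers in semidirect products\<close>

text \<open>The second coordinates multiply as in \<open>K\<close>, so the laws of \<open>K\<close> are read off from those of the
  semidirect product.\<close>

lemma group_semidirect_right_factor:
  assumes "Group.group (semidirect N K \<phi>)" 
  shows "Group.group K"
proof -
  interpret S: Group.group "semidirect N K \<phi>" by fact
  have one: "\<one>\<^bsub>N\<^esub> \<in> carrier N" "\<one>\<^bsub>K\<^esub> \<in> carrier K"
    using S.one_closed by simp_all
  show ?thesis
  proof (rule groupI)
    fix k k' k'' assume k: "k \<in> carrier K" "k' \<in> carrier K" "k'' \<in> carrier K"
    show "k \<otimes>\<^bsub>K\<^esub> k' \<in> carrier K"
      using S.m_closed[of "(\<one>\<^bsub>N\<^esub>, k)" "(\<one>\<^bsub>N\<^esub>, k')"] k one by simp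
    show "k \<otimes>\<^bsub>K\<^esub> k' \<otimes>\<^bsub>K\<^esub> k'' = k \<otimes>\<^bsub>K\<^esub> (k' \<otimes>\<^bsub>K\<^esub> k'')"
      using S.m_assoc[of "(\<one>\<^bsub>N\<^esub>, k)" "(\<one>\<^bsub>N\<^esub>, k')" "(\<one>\<^bsub>N\<^esub>, k'')"] k one by simp
  next
    fix k assume k: "k \<in> carrier K"
    show "\<one>\<^bsub>K\<^esub> \<otimes>\<^bsub>K\<^esub> k = k"
      using S.l_one[of "(\<one>\<^bsub>N\<^esub>, k)"] k one by simp
    show "\<exists>k'\<in>carrier K. k' \<otimes>\<^bsub>K\<^esub> k = \<one>\<^bsub>K\<^esub>"
      using S.l_inv_ex[of "(\<one>\<^bsub>N\<^esub>, k)"] k one by auto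
  qed (use one in auto)
qed

lemma DirProd_eq_semidirect: "G \<times>\<times> H = semidirect G H (\<lambda>_ x. x)"
  by (auto simp: DirProd_def semidirect_def)

text \<open>The product \<open>x \<cdot> f x \<cdot> f (f x) \<cdots>\<close> with \<open>n\<close> factors, in the nested form that arises from powers in a
  semidirect product.\<close>

primrec twisted_pow :: "('a, 'b) monoid_scheme \<Rightarrow> ('a \<Rightarrow> 'a) \<Rightarrow> 'a \<Rightarrow> nat \<Rightarrow> 'a" where
  "twisted_pow G f x 0 = \<one>\<^bsub>G\<^esub>"
| "twisted_pow G f x (Suc n) = x \<otimes>\<^bsub>G\<^esub> f (twisted_pow G f x n)"

lemma twisted_pow_3: "twisted_pow G f x 3 = x \<otimes>\<^bsub>G\<^esub> f (x \<otimes>\<^bsub>G\<^esub> f (x \<otimes>\<^bsub>G\<^esub> f \<one>\<^bsub>G\<^esub>))"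
  by (simp add: numeral_3_eq_3)

lemma semidirect_pow:
  assumes "Group.group (semidirect N K \<phi>)" "n \<in> carrier N" "k \<in> carrier K"
  shows "(n, k) [^]\<^bsub>semidirect N K \<phi>\<^esub> (d :: nat) = (twisted_pow N (\<phi> k) n d, k [^]\<^bsub>K\<^esub> d)"
proof -
  interpret S: Group.group "semidirect N K \<phi>" by fact
  interpret K: Group.group K
    by (rule group_semidirect_right_factor[OF assms(1)])
  show ?thesis
  proof (induction d)
    case (Suc d)
    have "(n, k) [^]\<^bsub>semidirect N K \<phi>\<^esub> Suc d
        = (n, k) \<otimes>\<^bsub>semidirect N K \<phi>\<^esub> (n, k) [^]\<^bsub>semidirect N K \<phi>\<^esub> d"
      using assms(2,3) by (intro S.nat_pow_Suc2) simp
    then show ?case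
      by (simp only: Suc semidirect_simps twisted_pow.simps K.nat_pow_Suc2 assms(3))
  qed simp
qed

lemma mem_torsion_semidirect:
  assumes "Group.group (semidirect N K \<phi>)"
  shows "(n, k) \<in> torsion (semidirect N K \<phi>) d \<longleftrightarrow>
    n \<in> carrier N \<and> k \<in> torsion K d \<and> twisted_pow N (\<phi> k) n d = \<one>\<^bsub>N\<^esub>"
  using semidirect_pow[OF assms] by (auto simp: torsion_def)

lemma card_torsion_semidirect:
  assumes "Group.group (semidirect N K \<phi>)" "finite (carrier N)" "finite (carrier K)"
  shows "card (torsion (semidirect N K \<phi>) d)
    = (\<Sum>k \<in> torsion K d. card {n \<in> carrier N. twisted_pow N (\<phi> k) n d = \<one>\<^bsub>N\<^esub>})"
proof -
  have "bij_betw prod.swap (torsion (semidirect N K \<phi>) d)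
      (SIGMA k:torsion K d. {n \<in> carrier N. twisted_pow N (\<phi> k) n d = \<one>\<^bsub>N\<^esub>})"
    by (rule bij_betw_byWitness[of _ prod.swap]) (auto simp: mem_torsion_semidirect[OF assms(1)])
  then show ?thesis
    using assms(2,3) by (simp add: bij_betw_same_card torsion_def)
qed

lemma torsion_cyc:
  assumes "m > 0"
  shows "torsion (cyc m) d = {a \<in> {0..<int m}. int m dvd int d * a}"
  using assms by (auto simp: torsion_def carrier_integer_mod_group)

lemma torsion_cyc_prime:
  assumes "Factorial_Ring.prime p"
  shows "torsion (cyc p) d = (if p dvd d then {0..<int p} else {0})"
proof -
  have "int p dvd int d * a \<longleftrightarrow> p dvd d \<or> int p dvd a" for a
    using assms by (simp add: prime_dvd_mult_iff)
  then show ?thesis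
    using assms prime_gt_0_nat[OF assms] by (auto simp: torsion_cyc dest: zdvd_imp_le)
qed

lemma zero_in_torsion_cyc: "0 \<in> torsion (cyc m) d"
  by (simp add: torsion_def)

text \<open>Here \<open>(a, k)\<^sup>d = (s a, k\<^sup>d)\<close> with \<open>s = 1 + c k + \<dots> + (c k)\<^sup>d\<^sup>-\<^sup>1\<close>. If \<open>k\<^sup>d = 1\<close>, then
  \<open>(c k - 1) s = (c k)\<^sup>d - 1 = 0\<close> modulo \<open>p\<close>, so \<open>s\<close> vanishes unless \<open>c k = 1\<close>, in which case \<open>s = d\<close>.\<close>

lemma mem_torsion_semidirect_prime:
  assumes G: "Group.group (semidirect (cyc p) K (\<lambda>k a. (c k * a) mod int p))" and p: "Factorial_Ring.prime p"
  shows "(a, k) \<in> torsion (semidirect (cyc p) K (\<lambda>k a. (c k * a) mod int p)) d \<longleftrightarrow>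
    k \<in> torsion K d \<and> a \<in> (if c k mod int p \<noteq> 1 \<or> p dvd d then {0..<int p} else {0})"
proof -
  let ?S = "semidirect (cyc p) K (\<lambda>k a. (c k * a) mod int p)"
  interpret S: Group.group ?S by fact
  interpret K: Group.group K
    by (rule group_semidirect_right_factor[OF G])
  have p1: "int p > 1"
    using prime_gt_1_nat[OF p] by simp
  have carr: "carrier (cyc p) = {0..<int p}"
    using p1 by (simp add: carrier_integer_mod_group)
  \<comment> \<open>The group laws of the semidirect product force \<open>c\<close> to be a character modulo \<open>p\<close>.\<close>
  have c_mult: "c (k \<otimes>\<^bsub>K\<^esub> k') mod int p = c k * c k' mod int p"
    if "k \<in> carrier K" "k' \<in> carrier K" for k k'
    using S.m_assoc[of "(0, k)" "(0, k')" "(1, \<one>\<^bsub>K\<^esub>)"] that p1 by (simp add: carr mod_simps)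
  have c_one: "c \<one>\<^bsub>K\<^esub> mod int p = 1"
    using S.l_one[of "(1, \<one>\<^bsub>K\<^esub>)"] p1 by (simp add: carr)
  have c_pow: "c (k [^]\<^bsub>K\<^esub> n) mod int p = c k ^ n mod int p" if "k \<in> carrier K" for k and n :: nat
  proof (induction n)
    case (Suc n)
    then show ?case
      using that c_mult[of "k [^]\<^bsub>K\<^esub> n" k] by (metis K.nat_pow_Suc K.nat_pow_closed mod_mult_left_eq power_Suc2)
  qed (use c_one p1 in simp)
  have twisted: "twisted_pow (cyc p) (\<lambda>a. (c k * a) mod int p) a n = ((\<Sum>i<n. c k ^ i) * a) mod int p" for n
  proof (induction n)
    case (Suc n)
    have "(\<Sum>i<Suc n. c k ^ i) * a = a + c k * ((\<Sum>i<n. c k ^ i) * a)"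
      by (subst sum.lessThan_Suc_shift) (simp add: sum_distrib_left algebra_simps)
    then show ?case
      by (simp only: twisted_pow.simps Suc mult_integer_mod_group mod_simps)
  qed simp
  have geom: "int p dvd (\<Sum>i<d. c k ^ i) \<longleftrightarrow> (c k mod int p = 1 \<longrightarrow> p dvd d)"
    if "k \<in> torsion K d"
  proof (cases "c k mod int p = 1")
    case True
    have "(\<Sum>i<d. c k ^ i) mod int p = (\<Sum>i<d. c k ^ i mod int p) mod int p"
      by (simp add: mod_sum_eq)
    also have "\<dots> = (\<Sum>i<d. 1) mod int p"
      using True p1 by (intro arg_cong[of _ _ "\<lambda>x. x mod int p"] sum.cong) (simp_all flip: power_mod)
    finally show ?thesis
      using True by (simp add: dvd_eq_mod_eq_0) (simp flip: zmod_int)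
  next
    case False
    have "c k ^ d mod int p = 1"
      using that c_pow[of k d] c_one by (simp add: torsion_def)
    then have "int p dvd c k ^ d - 1"
      using p1 by (simp flip: mod_eq_dvd_iff)
    also have "c k ^ d - 1 = (c k - 1) * (\<Sum>i<d. c k ^ i)"
      by (rule power_diff_1_eq)
    finally have "int p dvd c k - 1 \<or> int p dvd (\<Sum>i<d. c k ^ i)"
      using p by (simp add: prime_dvd_mult_iff)
    moreover have "\<not> int p dvd c k - 1"
      using False p1 by (simp flip: mod_eq_dvd_iff)
    ultimately show ?thesis
      using False by blast
  qed
  show ?thesis
  proof (cases "k \<in> torsion K d \<and> a \<in> {0..<int p}")
    case True
    then have "(a, k) \<in> torsion ?S d \<longleftrightarrow> int p dvd (\<Sum>i<d. c k ^ i) * a"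
      by (simp add: mem_torsion_semidirect[OF G] twisted carr dvd_eq_mod_eq_0)
    also have "\<dots> \<longleftrightarrow> (c k mod int p = 1 \<longrightarrow> p dvd d) \<or> a = 0"
      using geom True p zdvd_imp_le[of "int p" a] by (auto simp: prime_dvd_mult_iff)
    finally show ?thesis
      using True by auto
  next
    case False
    then show ?thesis
      using p1 by (auto simp: mem_torsion_semidirect[OF G] carr split: if_splits)
  qed
qed

text \<open>The count for the semidirect product is thus governed by two counts for \<open>K\<close>: all solutions of
  \<open>k\<^sup>d = 1\<close>, and those in the kernel of the character \<open>c\<close>. The predicate \<open>P\<close> makes it possible to nest such
  extensions, where the kernel of an outer character has to be followed through an inner one.\<close>

lemma card_torsion_semidirect_prime:
  assumes G: "Group.group (semidirect (cyc p) K (\<lambda>k a. (c k * a) mod int p))"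
    and p: "Factorial_Ring.prime p" and fin: "finite (carrier K)"
  shows "card {x \<in> torsion (semidirect (cyc p) K (\<lambda>k a. (c k * a) mod int p)) d. P (snd x)}
    = p * card {k \<in> torsion K d. P k}
      - (if p dvd d then 0 else (p - 1) * card {k \<in> torsion K d. P k \<and> c k mod int p = 1})"
proof -
  let ?S = "semidirect (cyc p) K (\<lambda>k a. (c k * a) mod int p)"
  define A where "A = {k \<in> torsion K d. P k \<and> c k mod int p \<noteq> 1}"
  define B where "B = {k \<in> torsion K d. P k \<and> c k mod int p = 1}"
  have AB: "finite A" "finite B" "A \<inter> B = {}" "{k \<in> torsion K d. P k} = A \<union> B"
    using fin by (auto simp: A_def B_def torsion_def)
  have "{x \<in> torsion ?S d. P (snd x)} = {0..<int p} \<times> A \<union> (if p dvd d then {0..<int p} else {0}) \<times> B"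
    using mem_torsion_semidirect_prime[OF G p] by (auto simp: A_def B_def split: if_splits)
  also have "card \<dots> = p * card A + (if p dvd d then p else 1) * card B"
    using AB(1-3) by (subst card_Un_disjoint) (auto simp: card_cartesian_product)
  also have "\<dots> = p * card (A \<union> B) - (if p dvd d then 0 else (p - 1) * card B)"
    using prime_gt_0_nat[OF p] AB(1-3) by (simp add: card_Un_disjoint algebra_simps)
  finally show ?thesis
    by (simp only: AB(4) B_def)
qed

text \<open>An element outside \<open>N\<close> has order 3 modulo \<open>N\<close>, so \<open>d\<close> must be a multiple of 3; its cube lies in
  \<open>N\<close> and has to be a solution of \<open>x\<^sup>e = 1\<close> for \<open>e = d / 3\<close>.\<close>

lemma card_torsion_semidirect_cyc3:
  fixes N :: "('a, 'c) monoid_scheme"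
  assumes G: "Group.group (semidirect N (cyc 3) (\<lambda>k. f ^^ nat k))"
    and N: "Group.group N" and fin: "finite (carrier N)"
  shows "card {x \<in> torsion (semidirect N (cyc 3) (\<lambda>k. f ^^ nat k)) d. P (fst x) \<and> snd x = 0}
      = card {n \<in> torsion N d. P n}" (is ?thesis1)
    and "card (torsion (semidirect N (cyc 3) (\<lambda>k. f ^^ nat k)) d) = card (torsion N d) +
      (if 3 dvd d then \<Sum>c\<in>{1, 2}. card {n \<in> carrier N. twisted_pow N (f ^^ c) n 3 \<in> torsion N (d div 3)} else 0)"
      (is ?thesis2)
proof -
  let ?S = "semidirect N (cyc 3) (\<lambda>k. f ^^ nat k)"
  interpret N: Group.group N by fact
  interpret S: Group.group ?S by fact
  have pow0: "(n, 0) [^]\<^bsub>?S\<^esub> e = (n [^]\<^bsub>N\<^esub> e, 0)" if "n \<in> carrier N" for n and e :: nat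
  proof -
    have "twisted_pow N (f ^^ 0) n e = n [^]\<^bsub>N\<^esub> e"
      by (induction e) (use N.nat_pow_Suc2[OF that] in simp_all)
    then show ?thesis
      using semidirect_pow[OF G that, of 0 e] by simp
  qed
  have mem0: "(n, 0) \<in> torsion ?S d \<longleftrightarrow> n \<in> torsion N d" for n
    using pow0[of n d] by (auto simp: torsion_def)
  have tors0: "{x \<in> torsion ?S d. Q (fst x) \<and> snd x = 0} = {n \<in> torsion N d. Q n} \<times> {0}" for Q
  proof (rule Set.set_eqI)
    fix x :: "'a \<times> int"
    obtain n c where x: "x = (n, c)" by fastforce
    show "x \<in> {x \<in> torsion ?S d. Q (fst x) \<and> snd x = 0} \<longleftrightarrow> x \<in> {n \<in> torsion N d. Q n} \<times> {0}"
      unfolding x by (cases "c = 0") (simp_all add: mem0)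
  qed
  then show ?thesis1
    by (simp add: card_cartesian_product)
  define C where "C c = {n \<in> carrier N. twisted_pow N (f ^^ nat c) n 3 \<in> torsion N (d div 3)}" for c
  have mem: "(n, c) \<in> torsion ?S d \<longleftrightarrow> 3 dvd d \<and> n \<in> C c" if c: "c = 1 \<or> c = 2" for n c
  proof (cases "n \<in> carrier N \<and> 3 dvd d")
    case True
    then obtain e where e: "d = 3 * e" by blast
    have nc: "(n, c) \<in> carrier ?S"
      using True c by auto
    have "c [^]\<^bsub>cyc 3\<^esub> (3 :: nat) = 0"
      using c by auto
    then have 3: "(n, c) [^]\<^bsub>?S\<^esub> (3::nat) = (twisted_pow N (f ^^ nat c) n 3, 0)"
      using semidirect_pow[OF G, of n c 3] True c by auto
    then have cl: "twisted_pow N (f ^^ nat c) n 3 \<in> carrier N"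
      using S.nat_pow_closed[OF nc, of 3] by simp
    have "(n, c) [^]\<^bsub>?S\<^esub> d = ((n, c) [^]\<^bsub>?S\<^esub> (3::nat)) [^]\<^bsub>?S\<^esub> e"
      by (simp only: e S.nat_pow_pow[OF nc])
    also have "\<dots> = (twisted_pow N (f ^^ nat c) n 3 [^]\<^bsub>N\<^esub> e, 0)"
      unfolding 3 by (rule pow0[OF cl])
    finally show ?thesis
      using nc cl True by (auto simp: torsion_def C_def e)
  next
    case False
    have "\<not> 3 dvd int d * c" if "\<not> 3 dvd d"
    proof -
      have "\<not> 3 dvd int d"
        using that by presburger
      then show ?thesis
        using c by (auto; presburger)
    qed
    then have "c \<notin> torsion (cyc 3) d" if "\<not> 3 dvd d"
      using that by (simp add: torsion_def dvd_eq_mod_eq_0)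
    then show ?thesis
      using False by (auto simp: mem_torsion_semidirect[OF G] C_def)
  qed
  have card_c: "card {n \<in> carrier N. twisted_pow N (f ^^ nat c) n d = \<one>\<^bsub>N\<^esub>} = card (C c)"
    if "c = 1 \<or> c = 2" "3 dvd d" for c
  proof -
    have "c \<in> torsion (cyc 3) d"
      using that by (auto simp: torsion_cyc)
    then show ?thesis
      using mem[OF that(1)] that(2) by (auto simp: mem_torsion_semidirect[OF G] C_def intro!: arg_cong[of _ _ card])
  qed
  have card_0: "card {n \<in> carrier N. twisted_pow N (f ^^ nat 0) n d = \<one>\<^bsub>N\<^esub>} = card (torsion N d)"
    using mem0 by (auto simp: mem_torsion_semidirect[OF G] torsion_cyc intro!: arg_cong[of _ _ card])
  have "torsion (cyc 3) d = (if 3 dvd d then {0, 1, 2} else {0})"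
    using torsion_cyc_prime[of 3 d] by (simp add: interval_unfold)
  then have "card (torsion ?S d) = card (torsion N d) + (if 3 dvd d then card (C 1) + card (C 2) else 0)"
    unfolding card_torsion_semidirect[OF G fin finite_atLeastLessThan_int[of 0 3, folded cyc_carrier_numeral]]
    using card_0 card_c by simp
  then show ?thesis2
    by (simp add: C_def)
qed


section \<open>Cyclic and quaternion groups\<close>

text \<open>The condition \<open>m dvd d a\<close> says that \<open>a\<close> is a multiple of \<open>m / gcd m d\<close>.\<close>

lemma card_torsion_cyc:
  assumes "m > 0"
  shows "card (torsion (cyc m) d) = gcd m d"
proof -
  define g where "g = gcd m d"
  have g: "g > 0" "g dvd m" "g dvd d"
    using assms by (simp_all add: g_def)
  then obtain m' d' where md: "m = g * m'" "d = g * d'"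
    by (auto elim!: dvdE)
  have cop: "coprime (int m') (int d')"
    using gcd_coprime_exists[of m d] g assms md unfolding g_def
    by (metis coprime_int_iff div_gcd_coprime gcd_eq_0_iff nonzero_mult_div_cancel_left not_gr0)
  have m': "m' > 0"
    using assms md by auto
  have iff: "int m dvd int d * a \<longleftrightarrow> int m' dvd a" for a
  proof -
    have "int m dvd int d * a \<longleftrightarrow> int g * int m' dvd int g * (int d' * a)"
      by (simp add: md mult.assoc)
    also have "\<dots> \<longleftrightarrow> int m' dvd a"
      using g(1) cop by (simp add: coprime_dvd_mult_right_iff)
    finally show ?thesis .
  qed
  have "int m = int m' * int g"
    by (simp add: md)
  then have "torsion (cyc m) d = {a \<in> {0..<int m' * int g}. int m' dvd a}"
    unfolding torsion_cyc[OF assms] iff by simp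
  also have "\<dots> = (\<lambda>i. int m' * i) ` {0..<int g}"
    using m' by (auto simp: zero_le_mult_iff elim!: dvdE)
  finally have "torsion (cyc m) d = (\<lambda>i. int m' * i) ` {0..<int g}" .
  moreover have "inj_on (\<lambda>i. int m' * i) {0..<int g}"
    using m' by (simp add: inj_on_def)
  ultimately show ?thesis
    by (simp add: card_image g_def)
qed

lemma card_even_torsion_cyc:
  assumes "m > 0"
  shows "card {i \<in> torsion (cyc (2 * m)) d. even i} = gcd m d"
proof -
  have "{i \<in> torsion (cyc (2 * m)) d. even i} = (\<lambda>i. 2 * i) ` torsion (cyc m) d"
  proof -
    have "2 * i \<in> torsion (cyc (2 * m)) d \<longleftrightarrow> i \<in> torsion (cyc m) d" for i
    proof -
      have "int d * (2 * i) = 2 * (int d * i)"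
        by simp
      then show ?thesis
        using assms by (simp only: torsion_cyc) simp
    qed
    then show ?thesis
      by (auto elim!: evenE)
  qed
  then show ?thesis
    using assms by (simp add: card_image inj_on_def card_torsion_cyc)
qed

lemma card_even_below_8: "card {i \<in> {0..<8::int}. even i} = 4"
proof -
  have "{i \<in> {0..<8::int}. even i} = {0, 2, 4, 6}"
    by (simp add: interval_unfold) auto
  then show ?thesis
    by simp
qed

lemma one_quaternion_group [simp]: "\<one>\<^bsub>quaternion_group n\<^esub> = (0, 0)"
  by (simp add: quaternion_group_def)

text \<open>Outside the cyclic subgroup generated by \<open>x\<close> every element has order 4, because \<open>y\<close> inverts \<open>x\<close> and
  hence \<open>(x\<^sup>i y)\<^sup>2 = y\<^sup>2\<close>, which has order 2.\<close>

lemma card_torsion_quaternion: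
  assumes "h > 0"
  shows "card {x \<in> torsion (quaternion_group (4 * h)) d. P (fst x)} =
    card {i \<in> torsion (cyc (2 * h)) d. P i} + (if 4 dvd d then card {i \<in> carrier (cyc (2 * h)). P i} else 0)"
proof -
  define Q where "Q = quaternion_group (4 * h)"
  define H where "H = 2 * int h"
  have carr: "carrier (cyc (2 * h)) = {0..<2 * int h}" "carrier Q = {0..<2 * int h} \<times> {0, 1}"
    using assms by (auto simp: carrier_integer_mod_group Q_def quaternion_group_def)
  have one: "\<one>\<^bsub>Q\<^esub> = (0, 0)"
    by (simp add: Q_def quaternion_group_def)
  have mult: "(i, j) \<otimes>\<^bsub>Q\<^esub> (i', j') = ((i + (-1) ^ nat j * i' + int h * (j * j')) mod H, (j + j') mod 2)"
    for i j i' j'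
    by (simp add: H_def Q_def quaternion_group_def)
  have pow0: "(i, 0) [^]\<^bsub>Q\<^esub> n = ((int n * i) mod H, 0)" for i and n :: nat
    by (induction n) (simp_all add: one mult mod_simps ring_distribs add.commute)
  have pow1: "(i, 1) [^]\<^bsub>Q\<^esub> n = (((if even n then 0 else i) + int (n div 2) * int h) mod H, int (n mod 2))"
    for i and n :: nat
  proof (induction n)
    case (Suc n)
    have "Suc (2 * b) mod 2 = 1" for b :: nat
      by presburger
    moreover have "(int h + (i + int b * int h) mod H - i) mod H = (int h + int b * int h) mod H" for b :: nat
      using mod_add_left_eq[of "i + int b * int h" H "int h - i"] by (simp add: algebra_simps)
    ultimately show ?case
      by (cases "even n") (auto simp: Suc mult mod_simps algebra_simps elim!: evenE oddE)
  qed (simp add: one)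
  have mem0: "(i, 0) \<in> torsion Q d \<longleftrightarrow> i \<in> torsion (cyc (2 * h)) d" for i
    by (simp add: torsion_def carr one pow0 H_def)
  have mem1: "(i, 1) \<in> torsion Q d \<longleftrightarrow> i \<in> carrier (cyc (2 * h)) \<and> 4 dvd d" for i
  proof -
    have "(i, 1) [^]\<^bsub>Q\<^esub> d = (0, 0) \<longleftrightarrow> even d \<and> 2 * int h dvd int (d div 2) * int h"
      by (cases "even d") (simp_all add: pow1 H_def mod_eq_0_iff_dvd odd_iff_mod_2_eq_one del: of_nat_div)
    also have "\<dots> \<longleftrightarrow> even d \<and> even (int (d div 2))"
      using assms by (simp del: of_nat_div)
    also have "\<dots> \<longleftrightarrow> 4 dvd d"
      by presburger
    finally show ?thesis
      by (simp add: torsion_def carr one)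
  qed
  have tors: "{x \<in> torsion Q d. P (fst x)} = {i \<in> torsion (cyc (2 * h)) d. P i} \<times> {0} \<union>
      (if 4 dvd d then {i \<in> carrier (cyc (2 * h)). P i} \<times> {1 :: int} else {})" (is "_ = ?R")
  proof (rule Set.set_eqI)
    fix x :: "int \<times> int"
    obtain i j where x: "x = (i, j)" by fastforce
    have "j = 0 \<or> j = 1" if "x \<in> torsion Q d"
      using that x by (auto simp: torsion_def carr)
    moreover have "j = 0 \<or> j = 1" if "x \<in> ?R"
      using that x by (auto split: if_splits)
    ultimately show "x \<in> {x \<in> torsion Q d. P (fst x)} \<longleftrightarrow> x \<in> ?R"
    proof (cases "j = 0 \<or> j = 1")
      case True
      then show ?thesis
        unfolding x by (elim disjE) (simp_all add: mem0 mem1)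
    qed blast
  qed
  have "card {x \<in> torsion Q d. P (fst x)} =
      card {i \<in> torsion (cyc (2 * h)) d. P i} + (if 4 dvd d then card {i \<in> carrier (cyc (2 * h)). P i} else 0)"
  proof -
    have "card (U \<times> {0} \<union> V \<times> {1 :: int}) = card U + card V" if "finite U" "finite V" for U V :: "int set"
    proof -
      have "U \<times> {0} \<inter> V \<times> {1 :: int} = {}"
        by (simp add: Times_Int_Times)
      with that show ?thesis
        by (simp add: card_Un_disjoint card_cartesian_product)
    qed
    moreover have "finite {i \<in> torsion (cyc (2 * h)) d. P i}" "finite {i \<in> carrier (cyc (2 * h)). P i}"
      by (rule finite_subset[of _ "{0..<2 * int h}"]; auto simp: torsion_def carr)+
    ultimately have "card ({i \<in> torsion (cyc (2 * h)) d. P i} \<times> {0} \<union> {i \<in> carrier (cyc (2 * h)). P i} \<times> {1 :: int})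
        = card {i \<in> torsion (cyc (2 * h)) d. P i} + card {i \<in> carrier (cyc (2 * h)). P i}"
      by blast
    then show ?thesis
      unfolding tors by (cases "4 dvd d") (simp_all only: if_True if_False Un_empty_right card_cartesian_product, simp)
  qed
  then show ?thesis
    by (simp only: Q_def)
qed

lemma card_torsion_quaternion_8:
  "card (torsion (quaternion_group 8) d) = gcd 4 d + (if 4 dvd d then 4 else 0)"
  using card_torsion_quaternion[of 2 d "\<lambda>_. True"] by (simp add: card_torsion_cyc del: atLeastLessThan_iff)

lemma card_torsion_quaternion_16:
  "card (torsion (quaternion_group 16) d) = gcd 8 d + (if 4 dvd d then 8 else 0)"
  "card {x \<in> torsion (quaternion_group 16) d. even (fst x)} = gcd 4 d + (if 4 dvd d then 4 else 0)"
  using card_torsion_quaternion[of 4 d "\<lambda>_. True"] card_torsion_quaternion[of 4 d even] card_even_torsion_cyc[of 4 d]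
  by (simp_all add: card_torsion_cyc card_even_below_8 del: atLeastLessThan_iff)

lemma card_torsion_96_166:
  "card (torsion SmallGroup_96_166 d) = gcd 12 d * (gcd 4 d + (if 4 dvd d then 4 else 0))"
  by (simp add: SmallGroup_96_166_def torsion_DirProd card_cartesian_product card_torsion_cyc card_torsion_quaternion_8)


section \<open>Extensions of the cyclic group of order 7\<close>

text \<open>The powers of 2 are the squares modulo 7, and \<open>-1\<close> is not a square: the two kinds of factors of the
  characters below are independent.\<close>

lemma two_power_mod_7_eq_1:
  assumes "k \<in> {0..<3}"
  shows "2 ^ nat k mod (7::int) = 1 \<longleftrightarrow> k = 0"
    and "2 ^ nat k * (-1) ^ i mod (7::int) = 1 \<longleftrightarrow> k = 0 \<and> even i"
proof -
  have "k = 0 \<or> k = 1 \<or> k = 2"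
    using assms by auto
  then show "2 ^ nat k mod (7::int) = 1 \<longleftrightarrow> k = 0" "2 ^ nat k * (-1) ^ i mod (7::int) = 1 \<longleftrightarrow> k = 0 \<and> even i"
    by (cases "even i"; auto)+
qed

lemma card_torsion_21_1: "card (torsion SmallGroup_21_1 d) = 7 * gcd 3 d - (if 7 dvd d then 0 else 6)"
proof -
  have eq: "SmallGroup_21_1 = semidirect (cyc 7) (cyc 3) (\<lambda>k a. (2 ^ nat k * a) mod int 7)"
    by (simp add: SmallGroup_21_1_def)
  have ker: "{k \<in> torsion (cyc 3) d. 2 ^ nat k mod 7 = (1::int)} = {0}"
    using two_power_mod_7_eq_1 zero_in_torsion_cyc[of 3 d] by (auto simp: torsion_def)
  show ?thesis
    using card_torsion_semidirect_prime[OF group_SmallGroup_21_1[unfolded eq], where d = d and P = "\<lambda>_. True"]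
    by (simp add: SmallGroup_21_1_def ker card_torsion_cyc)
qed

lemma group_1008_factor:
  "Group.group (semidirect (cyc 3) (quaternion_group 16) (\<lambda>(i, j) b. ((-1) ^ nat i * b) mod 3))"
  using group_SmallGroup_1008_289 unfolding SmallGroup_1008_289_def DirProd_eq_semidirect
  by (rule group_semidirect_right_factor[OF group_semidirect_right_factor])

text \<open>Both \<open>C\<^sub>7\<close> and the inner \<open>C\<^sub>3\<close> are acted upon through characters. \<open>T\<close> counts the solutions in \<open>Q\<^sub>1\<^sub>6\<close>, and \<open>E\<close>
  those in its subgroup \<open>{x\<^sup>i y\<^sup>j. even i}\<close>, a quaternion group of order 8, on which the inversions are trivial.\<close>

lemma card_torsion_1008_289:
  "card (torsion SmallGroup_1008_289 d) =
    (let T = gcd 8 d + (if 4 dvd d then 8 else 0); E = gcd 4 d + (if 4 dvd d then 4 else 0) in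
     7 * (gcd 3 d * (3 * T - (if 3 dvd d then 0 else 2 * E)))
       - (if 7 dvd d then 0 else 6 * (if 3 dvd d then 3 * E else E)))"
proof -
  let ?Q = "quaternion_group 16"
  define L where "L = semidirect (cyc 3) ?Q (\<lambda>(i, j) b. ((-1) ^ nat i * b) mod 3)"
  define K where "K = cyc 3 \<times>\<times> L"
  have L: "L = semidirect (cyc 3) ?Q (\<lambda>q b. ((-1) ^ nat (fst q) * b) mod int 3)"
    by (simp add: L_def case_prod_unfold)
  have S: "SmallGroup_1008_289 =
      semidirect (cyc 7) K (\<lambda>x a. ((2 ^ nat (fst x) * (-1) ^ nat (fst (snd (snd x)))) * a) mod int 7)"
    by (simp add: SmallGroup_1008_289_def K_def L_def case_prod_unfold)
  have finQ: "finite (carrier ?Q)"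
    by (simp add: quaternion_group_def)
  have finL: "finite (carrier L)"
    using finQ by (simp add: L_def)
  have nonneg: "0 \<le> i" if "(i, j) \<in> torsion ?Q e" for i j e
    using that by (simp add: torsion_def quaternion_group_def)
  have sgn: "(-1) ^ i mod 3 = (1::int) \<longleftrightarrow> even i" for i :: nat
    by (cases "even i") auto
  have kerL: "{q \<in> torsion ?Q d. even (fst q) \<and> (-1) ^ nat (fst q) mod 3 = (1::int)} = {q \<in> torsion ?Q d. even (fst q)}"
    "{q \<in> torsion ?Q d. (-1) ^ nat (fst q) mod 3 = (1::int)} = {q \<in> torsion ?Q d. even (fst q)}"
    using nonneg by (auto simp: sgn even_nat_iff)
  have G: "Group.group L"
    using group_1008_factor by (simp add: L_def)
  have cardL: "card (torsion L d) = 3 * card (torsion ?Q d) -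
      (if 3 dvd d then 0 else 2 * card {q \<in> torsion ?Q d. even (fst q)})"
    using card_torsion_semidirect_prime[OF G[unfolded L] _ finQ, where d = d and P = "\<lambda>_. True"]
    by (simp add: kerL flip: L[simplified])
  have cardL': "card {y \<in> torsion L d. even (fst (snd y))} =
      (if 3 dvd d then 3 else 1) * card {q \<in> torsion ?Q d. even (fst q)}"
    using card_torsion_semidirect_prime[OF G[unfolded L] _ finQ, where d = d and P = "\<lambda>q. even (fst q)"]
    by (simp add: kerL flip: L[simplified])
  have ker: "{x \<in> torsion K d. 2 ^ nat (fst x) * (-1) ^ nat (fst (snd (snd x))) mod 7 = (1::int)} =
      {0} \<times> {y \<in> torsion L d. even (fst (snd y))}"
  proof -
    have "2 ^ nat k * (-1) ^ nat (fst (snd y)) mod 7 = (1::int) \<longleftrightarrow> k = 0 \<and> even (fst (snd y))"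
      if "k \<in> torsion (cyc 3) d" "y \<in> torsion L d" for k y
    proof -
      have "0 \<le> fst (snd y)"
        using that(2) by (auto simp: torsion_def L_def quaternion_group_def)
      then show ?thesis
        using that(1) two_power_mod_7_eq_1(2)[of k "nat (fst (snd y))"] by (simp add: torsion_def even_nat_iff)
    qed
    moreover have "{0} = {k \<in> torsion (cyc 3) d. k = 0}"
      using zero_in_torsion_cyc[of 3 d] by auto
    ultimately show ?thesis
      unfolding K_def torsion_DirProd set_eq_iff mem_Collect_eq mem_Times_iff by blast
  qed
  have "card (torsion SmallGroup_1008_289 d) = 7 * (gcd 3 d * card (torsion L d)) -
      (if 7 dvd d then 0 else 6 * card {y \<in> torsion L d. even (fst (snd y))})"
    using card_torsion_semidirect_prime[OF group_SmallGroup_1008_289[unfolded S], where d = d and P = "\<lambda>_. True"]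
      finL ker
    by (simp add: card_cartesian_product flip: S[simplified])
      (simp add: K_def torsion_DirProd card_cartesian_product card_torsion_cyc)
  then show ?thesis
    by (simp add: cardL cardL' card_torsion_quaternion_16 Let_def)
qed

lemma funpow_2: "(f ^^ 2) x = f (f x)"
  by (simp add: numeral_2_eq_2)

text \<open>The automorphism of order 3 permutes the three involutions, so the norm \<open>v + \<phi> v + \<phi>\<^sup>2 v\<close> vanishes.\<close>

lemma A4_norm:
  assumes "v \<in> carrier (cyc 2 \<times>\<times> cyc 2)" "c = 1 \<or> c = 2"
  shows "twisted_pow (cyc 2 \<times>\<times> cyc 2) ((\<lambda>(v, w). (w, (v + w) mod 2)) ^^ c) v 3 = (0, 0)"
proof -
  obtain a b where "v = (a, b)" "a = 0 \<or> a = 1" "b = 0 \<or> b = 1"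
    using assms(1) by (auto simp: interval_unfold)
  then show ?thesis
    using assms(2) by (elim disjE) (simp_all add: twisted_pow_3 funpow_2)
qed

lemma card_torsion_A4:
  "card (torsion A4 d) = gcd 2 d * gcd 2 d + (if 3 dvd d then 8 else 0)"
  "card {x \<in> torsion A4 d. snd x = 0} = gcd 2 d * gcd 2 d"
proof -
  let ?V = "cyc 2 \<times>\<times> cyc 2"
  have V: "Group.group ?V" "finite (carrier ?V)"
    by (simp_all add: DirProd_group)
  define \<phi> :: "int \<times> int \<Rightarrow> int \<times> int" where "\<phi> = (\<lambda>(v, w). (w, (v + w) mod 2))"
  have "{v \<in> carrier ?V. twisted_pow ?V (\<phi> ^^ c) v 3 \<in> torsion ?V e} = carrier ?V"
    if "c \<in> {1, 2}" for c e
    using A4_norm[of _ c] that zero_in_torsion_cyc[of 2 e] by (auto simp: torsion_DirProd \<phi>_def)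
  then have "(\<Sum>c\<in>{1, 2}. card {v \<in> carrier ?V. twisted_pow ?V (\<phi> ^^ c) v 3 \<in> torsion ?V e}) =
      (\<Sum>c\<in>{1, 2 :: nat}. card (carrier ?V))" for e
    by (intro sum.cong) simp_all
  also have "(\<Sum>c\<in>{1, 2 :: nat}. card (carrier ?V)) = 8"
    by (simp add: card_cartesian_product)
  finally show "card (torsion A4 d) = gcd 2 d * gcd 2 d + (if 3 dvd d then 8 else 0)"
    using card_torsion_semidirect_cyc3(2)[OF group_A4[unfolded A4_def] V, of d, folded A4_def \<phi>_def]
    by (simp only:) (simp add: torsion_DirProd card_cartesian_product card_torsion_cyc)
  show "card {x \<in> torsion A4 d. snd x = 0} = gcd 2 d * gcd 2 d"
    using card_torsion_semidirect_cyc3(1)[OF group_A4[unfolded A4_def] V, of d "\<lambda>_. True", folded A4_def]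
    by (simp add: torsion_DirProd card_cartesian_product card_torsion_cyc)
qed

lemma card_torsion_336_136:
  "card (torsion SmallGroup_336_136 d) = 7 * (gcd 4 d * (gcd 2 d * gcd 2 d + (if 3 dvd d then 8 else 0)))
     - (if 7 dvd d then 0 else 6 * (gcd 2 d * (gcd 2 d * gcd 2 d)))"
proof -
  define K where "K = cyc 4 \<times>\<times> A4"
  have S: "SmallGroup_336_136 =
      semidirect (cyc 7) K (\<lambda>x a. ((2 ^ nat (snd (snd x)) * (-1) ^ nat (fst x)) * a) mod int 7)"
    by (simp add: SmallGroup_336_136_def K_def case_prod_unfold)
  have fin: "finite (carrier K)"
    by (simp add: K_def A4_def)
  have ker: "{x \<in> torsion K d. 2 ^ nat (snd (snd x)) * (-1) ^ nat (fst x) mod 7 = (1::int)} =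
      {c \<in> torsion (cyc 4) d. even c} \<times> {x \<in> torsion A4 d. snd x = 0}"
  proof -
    have "2 ^ nat (snd y) * (-1) ^ nat c mod 7 = (1::int) \<longleftrightarrow> even c \<and> snd y = 0"
      if "c \<in> torsion (cyc 4) d" "y \<in> torsion A4 d" for c y
    proof -
      have "0 \<le> c" "snd y \<in> {0..<3}"
        using that by (auto simp: torsion_def A4_def)
      then show ?thesis
        using two_power_mod_7_eq_1(2)[of "snd y" "nat c"] by (auto simp: even_nat_iff)
    qed
    then show ?thesis
      unfolding K_def torsion_DirProd set_eq_iff mem_Collect_eq mem_Times_iff by blast
  qed
  show ?thesis
    using card_torsion_semidirect_prime[OF group_SmallGroup_336_136[unfolded S], where d = d and P = "\<lambda>_. True"]
      fin ker card_even_torsion_cyc[of 2 d]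
    by (simp add: card_cartesian_product flip: S[simplified])
      (simp add: K_def torsion_DirProd card_cartesian_product card_torsion_cyc card_torsion_A4)
qed


section \<open>The group of order 1344\<close>

text \<open>The order of an element \<open>y\<close> with \<open>y\<^sup>4 = 1\<close> divides \<open>e\<close> under a condition that sees only \<open>e\<close> modulo 4. The
  function \<open>g\<close> will be the identity or the norm \<open>x \<mapsto> x \<cdot> f x \<cdot> f (f x)\<close>.\<close>

lemma card_pow_eq_one_of_exponent_4:
  assumes "Group.group G" and "finite A"
    and "\<And>x. x \<in> A \<Longrightarrow> g x \<in> carrier G" "\<And>x. x \<in> A \<Longrightarrow> g x [^]\<^bsub>G\<^esub> (4::nat) = \<one>\<^bsub>G\<^esub>"
  shows "card {x \<in> A. g x [^]\<^bsub>G\<^esub> (e :: nat) = \<one>\<^bsub>G\<^esub>} =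
    (if 4 dvd (e :: nat) then card A
     else if 2 dvd e then card {x \<in> A. g x \<otimes>\<^bsub>G\<^esub> g x = \<one>\<^bsub>G\<^esub>} else card {x \<in> A. g x = \<one>\<^bsub>G\<^esub>})"
proof -
  interpret Group.group G by fact
  have "g x [^]\<^bsub>G\<^esub> e = \<one>\<^bsub>G\<^esub> \<longleftrightarrow> (if 4 dvd e then True else if 2 dvd e then g x \<otimes>\<^bsub>G\<^esub> g x = \<one>\<^bsub>G\<^esub> else g x = \<one>\<^bsub>G\<^esub>)"
    if x: "x \<in> A" for x
  proof -
    have gx: "g x \<in> carrier G"
      using assms(3) x by blast
    have "ord (g x) dvd 4"
      using assms(4)[OF x] gx by (simp add: pow_eq_id)
    then have "ord (g x) \<le> 4" "ord (g x) \<noteq> 0" "ord (g x) \<noteq> 3"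
      using dvd_pos_nat[of 4 "ord (g x)"] by (auto dest: dvd_imp_le)
    then have ord: "ord (g x) = 1 \<or> ord (g x) = 2 \<or> ord (g x) = 4"
      by linarith
    have sq: "g x \<otimes>\<^bsub>G\<^esub> g x = \<one>\<^bsub>G\<^esub> \<longleftrightarrow> ord (g x) dvd 2"
      using pow_eq_id[OF gx, of 2] gx by (simp add: numeral_2_eq_2)
    have one: "g x = \<one>\<^bsub>G\<^esub> \<longleftrightarrow> ord (g x) dvd 1"
      using ord_eq_1[OF gx] by simp
    show ?thesis
      unfolding pow_eq_id[OF gx] sq one using ord by (elim disjE) (auto intro: dvd_trans[of 2 4 e])
  qed
  then have "{x \<in> A. g x [^]\<^bsub>G\<^esub> e = \<one>\<^bsub>G\<^esub>} =
      {x \<in> A. if 4 dvd e then True else if 2 dvd e then g x \<otimes>\<^bsub>G\<^esub> g x = \<one>\<^bsub>G\<^esub> else g x = \<one>\<^bsub>G\<^esub>}"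
    by blast
  then show ?thesis
    by simp
qed

definition sylow_elems :: "((int \<times> int \<times> int) \<times> int) list" where
  "sylow_elems = List.product (List.product [0, 1, 2, 3] (List.product [0, 1, 2, 3] [0, 1])) [0, 1]"

text \<open>The operations of the group of order 64 in a form that evaluates by rewriting; the closed forms are those of
  \<open>sylow2_1344_mult\<close> and of the lemma \<open>sylow2_1344_auto\<close>.\<close>

definition sylow_mult :: "(int \<times> int \<times> int) \<times> int \<Rightarrow> (int \<times> int \<times> int) \<times> int \<Rightarrow> (int \<times> int \<times> int) \<times> int" where
  "sylow_mult = (\<lambda>((i, j, k), l) ((i', j', k'), l').
    (((i + (if l = 0 then i' else 2 * k' - i')) mod 4,
      (j + (if k = l then j' else - j')) mod 4, (k + k') mod 2), (l + l') mod 2))"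

definition sylow_auto :: "(int \<times> int \<times> int) \<times> int \<Rightarrow> (int \<times> int \<times> int) \<times> int" where
  "sylow_auto = (\<lambda>((i, j, k), l).
    (if even i then (((i + k + 2 * k * l) mod 4, j, l), k)
     else (((i + 1 - k - 2 * l + 2 * k * l) mod 4, j, 1 - l), 1 - k)))"

text \<open>The cube of \<open>(x, c)\<close> in the extension by the automorphism of order 3.\<close>

definition sylow_norm :: "nat \<Rightarrow> (int \<times> int \<times> int) \<times> int \<Rightarrow> (int \<times> int \<times> int) \<times> int" where
  "sylow_norm c x = (let y = (sylow_auto ^^ c) x; z = (sylow_auto ^^ c) y in sylow_mult x (sylow_mult y z))"

lemma sylow_counts:
  "\<forall>x \<in> set sylow_elems. (let y = sylow_mult x x in sylow_mult y y = ((0, 0, 0), 0))"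
  "length (filter (\<lambda>x. sylow_mult x x = ((0, 0, 0), 0)) sylow_elems) = 28"
  "length (filter (\<lambda>((i, j, k), l). even j \<and> sylow_mult ((i, j, k), l) ((i, j, k), l) = ((0, 0, 0), 0)) sylow_elems) = 16"
  by code_simp+

lemma sylow_norm_counts:
  "length (filter (\<lambda>x. sylow_norm 1 x = ((0, 0, 0), 0)) sylow_elems) = 4"
  "length (filter (\<lambda>x. let y = sylow_norm 1 x in sylow_mult y y = ((0, 0, 0), 0)) sylow_elems) = 16"
  "length (filter (\<lambda>x. sylow_norm 2 x = ((0, 0, 0), 0)) sylow_elems) = 4"
  "length (filter (\<lambda>x. let y = sylow_norm 2 x in sylow_mult y y = ((0, 0, 0), 0)) sylow_elems) = 16"
  by code_simp+

lemma carrier_sylow: "carrier sylow2_1344 = set sylow_elems"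
  by (simp add: sylow2_1344_def dihedral_group_def sylow_elems_def interval_unfold)

lemma distinct_sylow_elems: "distinct sylow_elems"
  unfolding sylow_elems_def by (intro distinct_product) auto

lemma sylow_count:
  assumes "length (filter P sylow_elems) = n" "\<And>x. x \<in> carrier sylow2_1344 \<Longrightarrow> R x \<longleftrightarrow> P x"
  shows "card {x \<in> carrier sylow2_1344. R x} = n"
proof -
  have "{x \<in> carrier sylow2_1344. R x} = set (filter P sylow_elems)"
    using assms(2) by (auto simp: carrier_sylow)
  then show ?thesis
    using assms(1) distinct_card[OF distinct_filter[OF distinct_sylow_elems, of P]] by simp
qed

lemma one_sylow: "\<one>\<^bsub>sylow2_1344\<^esub> = ((0, 0, 0), 0)"
  by (simp add: sylow2_1344_def dihedral_group_def)

lemma sylow_mult_eq: "x \<in> carrier sylow2_1344 \<Longrightarrow> x \<otimes>\<^bsub>sylow2_1344\<^esub> y = sylow_mult x y"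
proof -
  assume "x \<in> carrier sylow2_1344"
  then obtain i j k l where x: "x = ((i, j, k), l)" "k \<in> {0, 1}" "l \<in> {0, 1}"
    unfolding sylow2_1344_carrier by blast
  obtain i' j' k' l' where y: "y = ((i', j', k'), l')"
    by (metis surj_pair)
  show ?thesis
    unfolding x(1) y sylow_mult_def by (simp only: sylow2_1344_mult[OF x(2,3)] case_prod_conv)
qed

lemma sylow_auto_eq: "x \<in> carrier sylow2_1344 \<Longrightarrow> sylow2_1344_auto x = sylow_auto x"
proof -
  assume "x \<in> carrier sylow2_1344"
  then obtain i j k l where x: "x = ((i, j, k), l)" "i \<in> {0, 1, 2, 3}" "j \<in> {0, 1, 2, 3}" "k \<in> {0, 1}" "l \<in> {0, 1}"
    unfolding sylow2_1344_carrier by blast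
  show ?thesis
    unfolding x(1) sylow_auto_def by (simp only: sylow2_1344_auto[OF x(2-5)] case_prod_conv)
qed

lemma sylow_auto_closed: "x \<in> carrier sylow2_1344 \<Longrightarrow> sylow_auto x \<in> carrier sylow2_1344"
proof -
  have "\<forall>x \<in> set sylow_elems. sylow_auto x \<in> set sylow_elems"
    by code_simp
  then show "x \<in> carrier sylow2_1344 \<Longrightarrow> sylow_auto x \<in> carrier sylow2_1344"
    unfolding carrier_sylow by blast
qed

text \<open>Since the automorphism respects products, the nested product unfolds to
  \<open>x \<cdot> f x \<cdot> f (f x)\<close>, which can be evaluated.\<close>

lemma sylow_twisted_cube:
  assumes x: "x \<in> carrier sylow2_1344" and c: "c = 1 \<or> c = 2"
  shows "twisted_pow sylow2_1344 (sylow2_1344_auto ^^ c) x 3 = sylow_norm c x"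
    and "sylow_norm c x \<in> carrier sylow2_1344"
proof -
  interpret Q: Group.group sylow2_1344
    by (rule group_sylow2_1344)
  have cl: "y \<in> carrier sylow2_1344 \<Longrightarrow> (sylow2_1344_auto ^^ n) y = (sylow_auto ^^ n) y \<and> (sylow_auto ^^ n) y \<in> carrier sylow2_1344" for y n
    by (induction n) (simp_all add: sylow_auto_eq sylow_auto_closed)
  have one: "(sylow_auto ^^ n) \<one>\<^bsub>sylow2_1344\<^esub> = \<one>\<^bsub>sylow2_1344\<^esub>" for n
    by (induction n) (simp_all add: one_sylow sylow_auto_def)
  define f where "f = sylow2_1344_auto ^^ c"
  interpret S: Group.group "semidirect sylow2_1344 (cyc 3) (\<lambda>c. sylow2_1344_auto ^^ nat c)"
    by (rule group_sylow2_1344_auto)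
  have f: "f y = (sylow_auto ^^ c) y" "f y \<in> carrier sylow2_1344" if "y \<in> carrier sylow2_1344" for y
    using cl[OF that, of c] by (simp_all add: f_def)
  \<comment> \<open>Associativity in the semidirect product contains the multiplicativity of the action.\<close>
  have f_mult: "f (y \<otimes>\<^bsub>sylow2_1344\<^esub> z) = f y \<otimes>\<^bsub>sylow2_1344\<^esub> f z"
    if "y \<in> carrier sylow2_1344" "z \<in> carrier sylow2_1344" for y z
    using S.m_assoc[of "(\<one>\<^bsub>sylow2_1344\<^esub>, int c)" "(y, 0)" "(z, 0)"] that f c by (auto simp: f_def)
  have "twisted_pow sylow2_1344 f x 3 = x \<otimes>\<^bsub>sylow2_1344\<^esub> (f x \<otimes>\<^bsub>sylow2_1344\<^esub> f (f x))"
  proof -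
    have "f \<one>\<^bsub>sylow2_1344\<^esub> = \<one>\<^bsub>sylow2_1344\<^esub>"
      using f(1)[OF Q.one_closed] one[of c] by simp
    then show ?thesis
      by (simp add: numeral_3_eq_3 x f(2) f_mult)
  qed
  also have norm: "\<dots> = sylow_norm c x"
    using x f(1)[OF x] f(2)[OF x] f(1)[OF f(2)[OF x]] by (simp add: sylow_norm_def sylow_mult_eq Let_def)
  finally have *: "twisted_pow sylow2_1344 f x 3 = sylow_norm c x" .
  then show "twisted_pow sylow2_1344 (sylow2_1344_auto ^^ c) x 3 = sylow_norm c x"
    by (simp add: f_def)
  have "x \<otimes>\<^bsub>sylow2_1344\<^esub> (f x \<otimes>\<^bsub>sylow2_1344\<^esub> f (f x)) \<in> carrier sylow2_1344"
    using x f by simp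
  then show "sylow_norm c x \<in> carrier sylow2_1344"
    using norm by simp
qed

lemma sylow_pow_4: "x \<in> carrier sylow2_1344 \<Longrightarrow> x [^]\<^bsub>sylow2_1344\<^esub> (4::nat) = \<one>\<^bsub>sylow2_1344\<^esub>"
proof -
  assume x: "x \<in> carrier sylow2_1344"
  interpret Q: Group.group sylow2_1344
    by (rule group_sylow2_1344)
  define y where "y = x \<otimes>\<^bsub>sylow2_1344\<^esub> x"
  have y: "y \<in> carrier sylow2_1344" "y = sylow_mult x x"
    using x by (simp_all add: y_def flip: sylow_mult_eq)
  have "x [^]\<^bsub>sylow2_1344\<^esub> (4::nat) = (x [^]\<^bsub>sylow2_1344\<^esub> (2::nat)) [^]\<^bsub>sylow2_1344\<^esub> (2::nat)"
    using x by (simp add: Q.nat_pow_pow)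
  also have "\<dots> = y \<otimes>\<^bsub>sylow2_1344\<^esub> y"
    using x y(1) by (simp add: numeral_2_eq_2 y_def)
  also have "\<dots> = \<one>\<^bsub>sylow2_1344\<^esub>"
    using sylow_counts(1) x y by (simp add: sylow_mult_eq carrier_sylow one_sylow Let_def)
  finally show ?thesis .
qed

lemma card_carrier_sylow: "card (carrier sylow2_1344) = 64" "card {x \<in> carrier sylow2_1344. even (fst (snd (fst x)))} = 32"
proof -
  show "card (carrier sylow2_1344) = 64"
    by (simp add: sylow2_1344_def dihedral_group_def card_cartesian_product)
  have "length (filter (\<lambda>x. even (fst (snd (fst x)))) sylow_elems) = 32"
    by code_simp
  then show "card {x \<in> carrier sylow2_1344. even (fst (snd (fst x)))} = 32"
    by (rule sylow_count) simp
qed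

lemma card_torsion_sylow:
  "card (torsion sylow2_1344 d) = (if 4 dvd d then 64 else if 2 dvd d then 28 else 1)" (is ?thesis1)
  "card {x \<in> torsion sylow2_1344 d. even (fst (snd (fst x)))} = (if 4 dvd d then 32 else if 2 dvd d then 16 else 1)" (is ?thesis2)
proof -
  have fin: "finite (carrier sylow2_1344)"
    by (simp add: carrier_sylow)
  have sq: "card {x \<in> carrier sylow2_1344. x \<otimes>\<^bsub>sylow2_1344\<^esub> x = \<one>\<^bsub>sylow2_1344\<^esub>} = 28"
    by (rule sylow_count[OF sylow_counts(2)]) (simp add: sylow_mult_eq one_sylow)
  have one: "{x \<in> carrier sylow2_1344. x = \<one>\<^bsub>sylow2_1344\<^esub>} = {((0, 0, 0), 0)}"
    using monoid.one_closed[OF group.is_monoid[OF group_sylow2_1344]] by (auto simp: one_sylow)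
  show ?thesis1
    using card_pow_eq_one_of_exponent_4[OF group_sylow2_1344 fin, of "\<lambda>x. x" d] sylow_pow_4
    by (simp add: torsion_def sq one card_carrier_sylow)
  let ?E = "{x \<in> carrier sylow2_1344. even (fst (snd (fst x)))}"
  have "card {x \<in> ?E. x \<otimes>\<^bsub>sylow2_1344\<^esub> x = \<one>\<^bsub>sylow2_1344\<^esub>} =
      card {x \<in> carrier sylow2_1344. even (fst (snd (fst x))) \<and> x \<otimes>\<^bsub>sylow2_1344\<^esub> x = \<one>\<^bsub>sylow2_1344\<^esub>}"
    by (simp add: conj_assoc)
  also have "\<dots> = 16"
    by (rule sylow_count[OF sylow_counts(3)]) (auto simp: sylow_mult_eq one_sylow split: prod.split)
  finally have sq': "card {x \<in> ?E. x \<otimes>\<^bsub>sylow2_1344\<^esub> x = \<one>\<^bsub>sylow2_1344\<^esub>} = 16" .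
  have one': "{x \<in> ?E. x = \<one>\<^bsub>sylow2_1344\<^esub>} = {((0, 0, 0), 0)}"
    using one by (auto simp: one_sylow)
  have "{x \<in> torsion sylow2_1344 d. even (fst (snd (fst x)))} = {x \<in> ?E. x [^]\<^bsub>sylow2_1344\<^esub> d = \<one>\<^bsub>sylow2_1344\<^esub>}"
    by (auto simp: torsion_def)
  moreover have "card {x \<in> ?E. x [^]\<^bsub>sylow2_1344\<^esub> d = \<one>\<^bsub>sylow2_1344\<^esub>} =
      (if 4 dvd d then card ?E else if 2 dvd d then card {x \<in> ?E. x \<otimes>\<^bsub>sylow2_1344\<^esub> x = \<one>\<^bsub>sylow2_1344\<^esub>}
       else card {x \<in> ?E. x = \<one>\<^bsub>sylow2_1344\<^esub>})"
    using fin sylow_pow_4 by (intro card_pow_eq_one_of_exponent_4[OF group_sylow2_1344]) auto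
  ultimately show ?thesis2
    unfolding sq' one' card_carrier_sylow(2) by simp
qed

lemma card_norm_torsion_sylow:
  assumes "c = 1 \<or> c = 2"
  shows "card {x \<in> carrier sylow2_1344. twisted_pow sylow2_1344 (sylow2_1344_auto ^^ c) x 3 \<in> torsion sylow2_1344 d}
    = (if 4 dvd d then 64 else if 2 dvd d then 16 else 4)"
proof -
  have fin: "finite (carrier sylow2_1344)"
    by (simp add: carrier_sylow)
  have "{x \<in> carrier sylow2_1344. twisted_pow sylow2_1344 (sylow2_1344_auto ^^ c) x 3 \<in> torsion sylow2_1344 d} =
      {x \<in> carrier sylow2_1344. sylow_norm c x [^]\<^bsub>sylow2_1344\<^esub> d = \<one>\<^bsub>sylow2_1344\<^esub>}"
  proof -
    have "twisted_pow sylow2_1344 (sylow2_1344_auto ^^ c) x 3 \<in> torsion sylow2_1344 d \<longleftrightarrow>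
        sylow_norm c x [^]\<^bsub>sylow2_1344\<^esub> d = \<one>\<^bsub>sylow2_1344\<^esub>" if "x \<in> carrier sylow2_1344" for x
      using sylow_twisted_cube[OF that assms] by (simp add: torsion_def)
    then show ?thesis
      by blast
  qed
  moreover have "card {x \<in> carrier sylow2_1344. sylow_norm c x [^]\<^bsub>sylow2_1344\<^esub> d = \<one>\<^bsub>sylow2_1344\<^esub>} =
    (if 4 dvd d then card (carrier sylow2_1344)
     else if 2 dvd d then card {x \<in> carrier sylow2_1344. sylow_norm c x \<otimes>\<^bsub>sylow2_1344\<^esub> sylow_norm c x = \<one>\<^bsub>sylow2_1344\<^esub>}
     else card {x \<in> carrier sylow2_1344. sylow_norm c x = \<one>\<^bsub>sylow2_1344\<^esub>})"
    using fin sylow_pow_4 sylow_twisted_cube(2)[OF _ assms]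
    by (intro card_pow_eq_one_of_exponent_4[OF group_sylow2_1344]) auto
  moreover have "card {x \<in> carrier sylow2_1344. sylow_norm c x = \<one>\<^bsub>sylow2_1344\<^esub>} = 4"
    using assms sylow_count[OF sylow_norm_counts(1)] sylow_count[OF sylow_norm_counts(3)]
    by (elim disjE) (simp_all add: one_sylow)
  moreover have "card {x \<in> carrier sylow2_1344. sylow_norm c x \<otimes>\<^bsub>sylow2_1344\<^esub> sylow_norm c x = \<one>\<^bsub>sylow2_1344\<^esub>} = 16"
    using assms sylow_count[OF sylow_norm_counts(2)] sylow_count[OF sylow_norm_counts(4)] sylow_twisted_cube(2)[OF _ assms]
    by (elim disjE) (simp_all add: one_sylow sylow_mult_eq Let_def)
  ultimately show ?thesis
    by (simp add: card_carrier_sylow)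
qed

text \<open>The second count is over the kernel of the character through which the factor acts on \<open>C\<^sub>7\<close>.\<close>

lemma card_torsion_1344_factor:
  defines "K \<equiv> semidirect sylow2_1344 (cyc 3) (\<lambda>c. sylow2_1344_auto ^^ nat c)"
  shows "card (torsion K d) = (if 4 dvd d then 64 else if 2 dvd d then 28 else 1) +
      (if 3 dvd d then (if 4 dvd d then 128 else if 2 dvd d then 32 else 8) else 0)"
    and "card {x \<in> torsion K d. even (fst (snd (fst (fst x)))) \<and> snd x = 0} =
      (if 4 dvd d then 32 else if 2 dvd d then 16 else 1)"
proof -
  have fin: "finite (carrier sylow2_1344)"
    by (simp add: carrier_sylow)
  note K = card_torsion_semidirect_cyc3[OF group_sylow2_1344_auto group_sylow2_1344 fin, of d, folded K_def]
  have "(\<Sum>c\<in>{1, 2}. card {x \<in> carrier sylow2_1344. twisted_pow sylow2_1344 (sylow2_1344_auto ^^ c) x 3 \<in> torsion sylow2_1344 e})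
      = (\<Sum>c\<in>{1, 2 :: nat}. if 4 dvd e then 64 else if 2 dvd e then 16 else 4)" for e
    by (intro sum.cong refl card_norm_torsion_sylow) auto
  then have "card (torsion K d) = (if 4 dvd d then 64 else if 2 dvd d then 28 else 1) +
      (if 3 dvd d then \<Sum>c\<in>{1, 2 :: nat}. if 4 dvd (d div 3) then 64 else if 2 dvd (d div 3) then 16 else 4 else 0)"
    using K(2) card_torsion_sylow(1)[of d] by (simp only:)
  moreover have "4 dvd (d div 3) \<longleftrightarrow> 4 dvd d" "2 dvd (d div 3) \<longleftrightarrow> 2 dvd d" if "3 dvd d"
    using that by presburger+
  ultimately show "card (torsion K d) = (if 4 dvd d then 64 else if 2 dvd d then 28 else 1) +
      (if 3 dvd d then (if 4 dvd d then 128 else if 2 dvd d then 32 else 8) else 0)"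
    by simp
  show "card {x \<in> torsion K d. even (fst (snd (fst (fst x)))) \<and> snd x = 0} =
      (if 4 dvd d then 32 else if 2 dvd d then 16 else 1)"
    using K(1)[of "\<lambda>x. even (fst (snd (fst x)))"] card_torsion_sylow(2)[of d] by simp
qed

lemma card_torsion_1344_6967:
  "card (torsion SmallGroup_1344_6967 d) =
    7 * ((if 4 dvd d then 64 else if 2 dvd d then 28 else 1) +
      (if 3 dvd d then (if 4 dvd d then 128 else if 2 dvd d then 32 else 8) else 0))
    - (if 7 dvd d then 0 else 6 * (if 4 dvd d then 32 else if 2 dvd d then 16 else 1))"
proof -
  define K where "K = semidirect sylow2_1344 (cyc 3) (\<lambda>c. sylow2_1344_auto ^^ nat c)"
  have S: "SmallGroup_1344_6967 =
      semidirect (cyc 7) K (\<lambda>x a. ((2 ^ nat (snd x) * (-1) ^ nat (fst (snd (fst (fst x))))) * a) mod int 7)"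
    by (simp add: SmallGroup_1344_6967_def K_def case_prod_unfold)
  have fin: "finite (carrier K)"
    by (simp add: K_def carrier_sylow)
  have "2 ^ nat (snd x) * (-1) ^ nat (fst (snd (fst (fst x)))) mod 7 = (1::int) \<longleftrightarrow>
      even (fst (snd (fst (fst x)))) \<and> snd x = 0" if "x \<in> torsion K d" for x
  proof -
    have "fst x \<in> carrier sylow2_1344" "snd x \<in> {0..<3}"
      using that by (auto simp: torsion_def K_def)
    moreover from this(1) have "0 \<le> fst (snd (fst (fst x)))"
      by (auto simp: sylow2_1344_def dihedral_group_def)
    ultimately show ?thesis
      using two_power_mod_7_eq_1(2)[of "snd x" "nat (fst (snd (fst (fst x))))"] by (auto simp: even_nat_iff)
  qed
  then have ker: "{x \<in> torsion K d. 2 ^ nat (snd x) * (-1) ^ nat (fst (snd (fst (fst x)))) mod 7 = (1::int)} =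
      {x \<in> torsion K d. even (fst (snd (fst (fst x)))) \<and> snd x = 0}"
    by blast
  have "card (torsion SmallGroup_1344_6967 d) = 7 * card (torsion K d) - (if 7 dvd d then 0 else
      6 * card {x \<in> torsion K d. even (fst (snd (fst (fst x)))) \<and> snd x = 0})"
    using card_torsion_semidirect_prime[OF group_SmallGroup_1344_6967[unfolded S] _ fin, where d = d and P = "\<lambda>_. True"]
    by (simp add: ker flip: S[simplified])
  then show ?thesis
    unfolding card_torsion_1344_factor[of d, folded K_def] .
qed


section \<open>The affine semilinear group of the field with 8 elements\<close>

definition F8_elems :: "(int \<times> int \<times> int) list" where
  "F8_elems = List.product [0, 1] (List.product [0, 1] [0, 1])"

text \<open>Evaluates \<open>v + f v + f (f v) + \<dots>\<close> with \<open>n\<close> summands in the additive group of the field with 8 elements.\<close>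

primrec F8_norm :: "(int \<times> int \<times> int \<Rightarrow> int \<times> int \<times> int) \<Rightarrow> int \<times> int \<times> int \<Rightarrow> nat \<Rightarrow> int \<times> int \<times> int" where
  "F8_norm f v 0 = (0, 0, 0)"
| "F8_norm f v (Suc n) = (case v of (v0, v1, v2) \<Rightarrow> case f (F8_norm f v n) of (w0, w1, w2) \<Rightarrow>
     ((v0 + w0) mod 2, (v1 + w1) mod 2, (v2 + w2) mod 2))"

text \<open>The number of solutions \<open>(v, (u, k))\<close> of \<open>x\<^sup>d = 1\<close> above a solution \<open>(u, k)\<close> in the Frobenius group of
  order 21.\<close>

definition F8_kernel_count :: "nat \<Rightarrow> int \<times> int \<Rightarrow> nat" where
  "F8_kernel_count d = (\<lambda>(u, k).
     length (filter (\<lambda>v. F8_norm ((F8_mult_t ^^ nat u) \<circ> (F8_frobenius ^^ nat k)) v d = (0, 0, 0)) F8_elems))"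

lemma F8_kernel_counts:
  "sum_list (map (F8_kernel_count 2) [(0, 0)]) = 8"
  "sum_list (map (F8_kernel_count 3) ((0, 0) # List.product [0, 1, 2, 3, 4, 5, 6] [1, 2])) = 57"
  "sum_list (map (F8_kernel_count 6) ((0, 0) # List.product [0, 1, 2, 3, 4, 5, 6] [1, 2])) = 120"
  "sum_list (map (F8_kernel_count 7) (List.product [0, 1, 2, 3, 4, 5, 6] [0])) = 49"
  by code_simp+

lemma torsion_21_1:
  "torsion SmallGroup_21_1 2 = set [(0, 0)]"
  "torsion SmallGroup_21_1 3 = set ((0, 0) # List.product [0, 1, 2, 3, 4, 5, 6] [1, 2])"
  "torsion SmallGroup_21_1 6 = set ((0, 0) # List.product [0, 1, 2, 3, 4, 5, 6] [1, 2])"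
  "torsion SmallGroup_21_1 7 = set (List.product [0, 1, 2, 3, 4, 5, 6] [0])"
proof -
  have eq: "SmallGroup_21_1 = semidirect (cyc 7) (cyc 3) (\<lambda>k a. (2 ^ nat k * a) mod int 7)"
    by (simp add: SmallGroup_21_1_def)
  define U where "U = {0, 1, 2, 3, 4, 5, 6 :: int}"
  have U: "{0..<7::int} = U" "0 \<in> U"
    by (auto simp: U_def)
  have cyc3: "torsion (cyc 3) d = (if 3 dvd d then {0, 1, 2} else {0})" for d
    using torsion_cyc_prime[of 3 d] by (simp add: interval_unfold)
  have "(a, k) \<in> torsion SmallGroup_21_1 d \<longleftrightarrow>
      (a, k) \<in> (if 7 dvd d then U else {0}) \<times> {0} \<union> (if 3 dvd d then U \<times> {1, 2} else {})" for a k d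
    using mem_torsion_semidirect_prime[OF group_SmallGroup_21_1[unfolded eq], of a k d] U(2)
    by (simp add: cyc3 U(1) flip: eq[simplified]) (auto simp: two_power_mod_7_eq_1)
  then have tors: "torsion SmallGroup_21_1 d =
      (if 7 dvd d then U else {0}) \<times> {0} \<union> (if 3 dvd d then U \<times> {1, 2} else {})" for d
    by (intro Set.set_eqI) (simp only: split_paired_all)
  show "torsion SmallGroup_21_1 2 = set [(0, 0)]"
    "torsion SmallGroup_21_1 3 = set ((0, 0) # List.product [0, 1, 2, 3, 4, 5, 6] [1, 2])"
    "torsion SmallGroup_21_1 6 = set ((0, 0) # List.product [0, 1, 2, 3, 4, 5, 6] [1, 2])"
    "torsion SmallGroup_21_1 7 = set (List.product [0, 1, 2, 3, 4, 5, 6] [0])"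
    by (auto simp add: tors U_def)
qed

lemma card_torsion_168_43_eq_sum_kernel_counts:
  assumes "torsion SmallGroup_21_1 d = set ks" "distinct ks" "sum_list (map (F8_kernel_count d) ks) = n"
  shows "card (torsion SmallGroup_168_43 d) = n"
proof -
  let ?V = "cyc 2 \<times>\<times> cyc 2 \<times>\<times> cyc 2"
  have norm: "twisted_pow ?V f v n = F8_norm f v n" for f v n
    by (induction n) (simp_all add: DirProd_def case_prod_unfold)
  have V: "carrier ?V = set F8_elems"
    by (simp add: F8_elems_def interval_unfold)
  have dist: "distinct F8_elems"
    unfolding F8_elems_def by (intro distinct_product) auto
  have "card {v \<in> carrier ?V. twisted_pow ?V (case x of (u, k) \<Rightarrow> (F8_mult_t ^^ nat u) \<circ> (F8_frobenius ^^ nat k)) v d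
      = \<one>\<^bsub>?V\<^esub>} = F8_kernel_count d x" for x
    using distinct_card[OF distinct_filter[OF dist]]
    by (simp add: norm V F8_kernel_count_def case_prod_unfold del: carrier_DirProd)
  moreover have "finite (carrier ?V)" "finite (carrier SmallGroup_21_1)"
    by (simp_all add: V SmallGroup_21_1_def)
  ultimately have "card (torsion SmallGroup_168_43 d) = (\<Sum>k \<in> set ks. F8_kernel_count d k)"
    using card_torsion_semidirect[OF group_SmallGroup_168_43[unfolded SmallGroup_168_43_def], of d] assms(1)
    by (simp add: SmallGroup_168_43_def)
  then show ?thesis
    using assms(2,3) by (simp add: sum_list_distinct_conv_sum_set)
qed

lemma card_torsion_168_43_values:
  "card (torsion SmallGroup_168_43 2) = 8" "card (torsion SmallGroup_168_43 3) = 57"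
  "card (torsion SmallGroup_168_43 6) = 120" "card (torsion SmallGroup_168_43 7) = 49"
  by (rule card_torsion_168_43_eq_sum_kernel_counts[OF torsion_21_1(1) _ F8_kernel_counts(1)]
      card_torsion_168_43_eq_sum_kernel_counts[OF torsion_21_1(2) _ F8_kernel_counts(2)]
      card_torsion_168_43_eq_sum_kernel_counts[OF torsion_21_1(3) _ F8_kernel_counts(3)]
      card_torsion_168_43_eq_sum_kernel_counts[OF torsion_21_1(4) _ F8_kernel_counts(4)]; simp)+

text \<open>The exponents 2, 3, 6, 7 suffice, since they account for \<open>1 + 7 + 56 + 56 + 48 = 168\<close> elements.\<close>

lemma card_torsion_168_43:
  "card (torsion SmallGroup_168_43 d) =
    1 + (if 2 dvd d then 7 else 0) + (if 3 dvd d then 56 else 0) + (if 6 dvd d then 56 else 0)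
      + (if 7 dvd d then 48 else 0)"
proof -
  let ?S = SmallGroup_168_43
  have card: "card (carrier ?S) = 168"
    by (simp add: SmallGroup_168_43_def SmallGroup_21_1_def card_cartesian_product)
  then have fin: "finite (carrier ?S)"
    by (simp add: card_ge_0_finite)
  note sums = card_torsion_eq_sum_order_type[OF group_SmallGroup_168_43 fin]
  have one: "order_type ?S (Suc 0) = 1"
    using order_type_1[OF group_SmallGroup_168_43] by simp
  have orders: "order_type ?S 2 = 7" "order_type ?S 3 = 56" "order_type ?S 6 = 56" "order_type ?S 7 = 48"
    using sums[of 2] sums[of 3] sums[of 6] sums[of 7] one
    by (simp_all add: divisor_sets card_torsion_168_43_values)
  show ?thesis
    using card_torsion_by_census[OF group_SmallGroup_168_43 fin, of "{1, 2, 3, 6, 7}" d]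
    by (simp add: card one orders)
qed


section \<open>The projective linear group over the field with 7 elements\<close>

text \<open>The coset of \<open>x\<close> solves \<open>y\<^sup>d = 1\<close> in the quotient iff \<open>x\<^sup>d \<in> N\<close>, and every coset has \<open>card N\<close> elements.\<close>

lemma card_pow_in_normal:
  assumes "N \<lhd> G" "finite (carrier G)"
  shows "card {x \<in> carrier G. x [^]\<^bsub>G\<^esub> d \<in> N} = card N * card (torsion (G Mod N) d)"
proof -
  interpret normal N G by fact
  have pow: "(N #>\<^bsub>G\<^esub> x) [^]\<^bsub>G Mod N\<^esub> d = N #>\<^bsub>G\<^esub> (x [^]\<^bsub>G\<^esub> d)" if "x \<in> carrier G" for x
    using hom_nat_pow[OF r_coset_hom_Mod that is_group factorgroup_is_group, of d] by simp
  have triv: "N #>\<^bsub>G\<^esub> x = N \<longleftrightarrow> x \<in> N" if "x \<in> carrier G" for x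
    using that rcos_self[OF that subgroup_axioms] coset_join2[OF that subgroup_axioms] by blast
  have tors: "torsion (G Mod N) d = (\<lambda>x. N #>\<^bsub>G\<^esub> x) ` {x \<in> carrier G. x [^]\<^bsub>G\<^esub> d \<in> N}"
  proof -
    have "(N #>\<^bsub>G\<^esub> x) [^]\<^bsub>G Mod N\<^esub> d = \<one>\<^bsub>G Mod N\<^esub> \<longleftrightarrow> x [^]\<^bsub>G\<^esub> d \<in> N" if "x \<in> carrier G" for x
      using pow[OF that] triv[of "x [^]\<^bsub>G\<^esub> d"] that by simp
    then show ?thesis
      unfolding torsion_def carrier_FactGroup by blast
  qed
  have Union: "{x \<in> carrier G. x [^]\<^bsub>G\<^esub> d \<in> N} = \<Union> (torsion (G Mod N) d)"
  proof (intro equalityI subsetI)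
    fix x assume x: "x \<in> {x \<in> carrier G. x [^]\<^bsub>G\<^esub> d \<in> N}"
    then show "x \<in> \<Union> (torsion (G Mod N) d)"
      unfolding tors using rcos_self[OF _ subgroup_axioms, of x] by blast
  next
    fix x assume "x \<in> \<Union> (torsion (G Mod N) d)"
    then obtain y where y: "y \<in> carrier G" "y [^]\<^bsub>G\<^esub> d \<in> N" "x \<in> N #>\<^bsub>G\<^esub> y"
      unfolding tors by blast
    then have x: "x \<in> carrier G" "N #>\<^bsub>G\<^esub> x = N #>\<^bsub>G\<^esub> y"
      using r_coset_subset_G[OF subset] repr_independence[OF _ y(1) subgroup_axioms, of x] by blast+
    have "N #>\<^bsub>G\<^esub> (x [^]\<^bsub>G\<^esub> d) = N #>\<^bsub>G\<^esub> (y [^]\<^bsub>G\<^esub> d)"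
      using pow[OF x(1)] pow[OF y(1)] x(2) by simp
    then show "x \<in> {x \<in> carrier G. x [^]\<^bsub>G\<^esub> d \<in> N}"
      using x(1) y(1,2) triv[of "x [^]\<^bsub>G\<^esub> d"] triv[of "y [^]\<^bsub>G\<^esub> d"] by simp
  qed
  have sub: "torsion (G Mod N) d \<subseteq> rcosets\<^bsub>G\<^esub> N"
    by (auto simp: torsion_def carrier_FactGroup RCOSETS_def)
  have "card (\<Union> (torsion (G Mod N) d)) = (\<Sum>c\<in>torsion (G Mod N) d. card c)"
    using sub rcosets_finite[OF _ subset finite_subset[OF subset assms(2)]]
    by (intro card_Union_disjoint pairwise_subset[OF rcos_disjoint[OF subgroup_axioms] sub]) blast
  also have "\<dots> = (\<Sum>c\<in>torsion (G Mod N) d. card N)"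
    using sub card_rcosets_equal[OF _ subset] by (intro sum.cong) auto
  finally show ?thesis
    by (simp add: Union mult.commute)
qed

lemma bij_betw_of_int_7: "bij_betw of_int {0..<7::int} (UNIV :: 7 set)"
proof -
  have inj: "inj_on (of_int :: int \<Rightarrow> 7) {0..<7}"
  proof (rule inj_onI)
    fix x y :: int assume "x \<in> {0..<7}" "y \<in> {0..<7}" "of_int x = (of_int y :: 7)"
    then show "x = y"
      using of_int_eq_0_iff_char_dvd[where 'a = 7, of "x - y"] by simp presburger
  qed
  then have "card (of_int ` {0..<7::int} :: 7 set) = card (UNIV :: 7 set)"
    by (simp add: card_image)
  then have "(of_int ` {0..<7::int} :: 7 set) = UNIV"
    by (intro card_subset_eq) auto
  with inj show ?thesis
    by (simp add: bij_betw_def)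
qed

lemma of_int_7_eq_0_iff: "of_int x = (0 :: 7) \<longleftrightarrow> x mod 7 = 0"
  using of_int_eq_0_iff_char_dvd[where 'a = 7, of x] by (simp add: dvd_eq_mod_eq_0)

lemma sum_UNIV_7: "(\<Sum>x\<in>UNIV. f (x :: 7)) = (\<Sum>i\<in>{0..<7::int}. f (of_int i))"
  using sum.reindex_bij_betw[OF bij_betw_of_int_7, of f] by simp

text \<open>By Fermat's little theorem, \<open>x \<mapsto> x\<^sup>5\<close> is inversion.\<close>

lemma inverse_7:
  fixes x :: 7
  assumes "x \<noteq> 0"
  shows "x ^ 5 * x = 1"
proof -
  obtain i where i: "i \<in> {0..<7::int}" "x = of_int i"
    using bij_betw_imp_surj_on[OF bij_betw_of_int_7] by blast
  then have "i = 0 \<or> i = 1 \<or> i = 2 \<or> i = 3 \<or> i = 4 \<or> i = 5 \<or> i = 6"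
    by auto
  then show ?thesis
    using assms i(2) by (elim disjE) simp_all
qed

lemma mult_eq_0_7: "x * y = 0 \<longleftrightarrow> x = 0 \<or> y = (0 :: 7)"
proof
  assume xy: "x * y = 0"
  show "x = 0 \<or> y = 0"
  proof (cases "x = 0")
    case False
    have "y = (x ^ 5 * x) * y"
      by (simp only: inverse_7[OF False] mult_1)
    also have "\<dots> = 0"
      by (simp only: mult.assoc xy mult_zero_right)
    finally show ?thesis ..
  qed simp
qed auto

text \<open>The adjugate matrix divided by the determinant is the inverse.\<close>

lemma invertible_iff_det_7: "invertible (A :: 7 ^ 2 ^ 2) \<longleftrightarrow> det A \<noteq> 0"
proof
  assume "invertible A"
  then obtain B where "A ** B = mat 1"
    by (auto simp: invertible_def)
  then have "det A * det B = 1"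
    by (metis det_mul det_I)
  then show "det A \<noteq> 0"
    by auto
next
  assume "det A \<noteq> 0"
  define e where "e = det A ^ 5"
  have e: "e * (A $ 1 $ 1 * A $ 2 $ 2 - A $ 1 $ 2 * A $ 2 $ 1) = 1"
    using inverse_7[OF \<open>det A \<noteq> 0\<close>] by (simp add: e_def det_2)
  define B :: "7 ^ 2 ^ 2" where "B = (\<chi> i j. e * (if i = j then (if i = 1 then A $ 2 $ 2 else A $ 1 $ 1) else - A $ i $ j))"
  have "A ** B = mat 1" "B ** A = mat 1"
    using e by (auto simp: vec_eq_iff forall_2 sum_2 matrix_matrix_mult_def mat_def B_def algebra_simps)
  then show "invertible A"
    by (auto simp: invertible_def)
qed

abbreviation "GL7 \<equiv> general_linear_group :: (7 ^ 2 ^ 2) monoid"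

abbreviation "Z7 \<equiv> {A :: 7 ^ 2 ^ 2. invertible A \<and> (\<exists>c. A = mat c)}"

lemma carrier_GL7: "carrier GL7 = {A. invertible A}"
  by (simp add: general_linear_group_def)

lemma scalar_iff: "(\<exists>c. A = mat c) \<longleftrightarrow> A $ 1 $ 2 = 0 \<and> A $ 2 $ 1 = 0 \<and> A $ 1 $ 1 = A $ 2 $ 2"
  for A :: "'a::comm_ring_1 ^ 2 ^ 2"
  by (auto simp: vec_eq_iff forall_2 mat_def)

lemma Z7_normal: "Z7 \<lhd> GL7"
proof -
  interpret GL: Group.group GL7
    by (rule group_general_linear_group)
  have "subgroup Z7 GL7"
  proof (rule GL.subgroupI)
    fix A assume A: "A \<in> Z7"
    define B where "B = inv\<^bsub>GL7\<^esub> A"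
    have AG: "A \<in> carrier GL7"
      using A by (simp add: general_linear_group_def)
    obtain c where c: "A = mat c"
      using A by blast
    have B: "invertible B" "mat c ** B = mat 1"
      using GL.inv_closed[OF AG] GL.r_inv[OF AG] c by (simp_all add: B_def general_linear_group_def)
    then have *: "c * B $ 1 $ 1 = 1" "c * B $ 1 $ 2 = 0" "c * B $ 2 $ 1 = 0" "c * B $ 2 $ 2 = 1"
      by (simp_all add: vec_eq_iff forall_2 sum_2 matrix_matrix_mult_def mat_def)
    then have "c \<noteq> 0"
      by auto
    then have "B $ 1 $ 2 = 0" "B $ 2 $ 1 = 0"
      using * by (simp_all add: mult_eq_0_7)
    moreover have "c * (B $ 1 $ 1 - B $ 2 $ 2) = 0"
      using * by (simp add: right_diff_distrib)
    then have "B $ 1 $ 1 = B $ 2 $ 2"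
      using \<open>c \<noteq> 0\<close> by (simp add: mult_eq_0_7)
    ultimately show "inv\<^bsub>GL7\<^esub> A \<in> Z7"
      using B(1) unfolding B_def[symmetric] mem_Collect_eq scalar_iff by blast
  qed (auto simp: general_linear_group_def mat_mult_mat invertible_mult invertible_def[of "mat 1"] intro!: exI[of _ "mat 1"])
  then show ?thesis
    by (rule GL.normalI) (auto simp: r_coset_def l_coset_def general_linear_group_def mat_mult_commute)
qed

text \<open>The Lucas sequence of the polynomial \<open>x\<^sup>2 - t x + D\<close>, computed by iterating on pairs of consecutive terms so
  that its evaluation takes linear time.\<close>

definition lucas :: "'a::comm_ring_1 \<Rightarrow> 'a \<Rightarrow> nat \<Rightarrow> 'a" where
  "lucas t D n = fst (((\<lambda>(x, y). (y, t * y - D * x)) ^^ n) (0, 1))"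

lemma lucas_rec: "lucas t D 0 = 0" "lucas t D (Suc 0) = 1"
  "lucas t D (Suc (Suc n)) = t * lucas t D (Suc n) - D * lucas t D n"
  by (simp_all add: lucas_def case_prod_unfold)

lemma lucas_of_int: "lucas (of_int t) (of_int D) n = (of_int (lucas t D n) :: 'a::comm_ring_1)"
proof -
  have "lucas (of_int t) (of_int D) n = (of_int (lucas t D n) :: 'a) \<and>
      lucas (of_int t) (of_int D) (Suc n) = (of_int (lucas t D (Suc n)) :: 'a)"
    by (induction n) (simp_all add: lucas_rec)
  then show ?thesis ..
qed

text \<open>For a double root the Lucas sequence is the derivative of \<open>x\<^sup>n\<^sup>+\<^sup>1\<close>.\<close>

lemma lucas_double_root: "lucas (2 * c) (c * c) (Suc n) = of_nat (Suc n) * (c :: 'a::comm_ring_1) ^ n"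
proof -
  have "lucas (2 * c) (c * c) (Suc n) = of_nat (Suc n) * c ^ n \<and>
      lucas (2 * c) (c * c) (Suc (Suc n)) = of_nat (Suc (Suc n)) * c ^ Suc n"
  proof (induction n)
    case (Suc n)
    have "lucas (2 * c) (c * c) (Suc (Suc (Suc n))) =
        2 * c * lucas (2 * c) (c * c) (Suc (Suc n)) - c * c * lucas (2 * c) (c * c) (Suc n)"
      by (rule lucas_rec)
    with Suc show ?case
      by (simp add: algebra_simps)
  qed (simp add: lucas_rec)
  then show ?thesis ..
qed

text \<open>The theorem of Cayley and Hamilton, \<open>A\<^sup>2 = t A - D\<close>, gives \<open>A\<^sup>n\<^sup>+\<^sup>1 = u\<^sub>n\<^sub>+\<^sub>1 A - D u\<^sub>n\<close> by induction.\<close>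

lemma matrix_pow_lucas:
  fixes A :: "'a::comm_ring_1 ^ 2 ^ 2"
  shows "(A [^]\<^bsub>general_linear_group\<^esub> Suc n) $ i $ j =
    lucas (trace A) (det A) (Suc n) * A $ i $ j - (if i = j then det A * lucas (trace A) (det A) n else 0)"
proof -
  define u where "u = lucas (trace A) (det A)"
  have "\<forall>i j. (A [^]\<^bsub>general_linear_group\<^esub> Suc n) $ i $ j = u (Suc n) * A $ i $ j - (if i = j then det A * u n else 0)"
  proof (induction n)
    case 0
    then show ?case
      by (simp add: general_linear_group_def lucas_rec u_def)
  next
    case (Suc n)
    have u: "u (Suc (Suc n)) = (A $ 1 $ 1 + A $ 2 $ 2) * u (Suc n) - (A $ 1 $ 1 * A $ 2 $ 2 - A $ 1 $ 2 * A $ 2 $ 1) * u n"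
      by (simp add: u_def lucas_rec trace_def sum_2 det_2)
    define M where "M = A [^]\<^bsub>general_linear_group\<^esub> Suc n"
    have "A [^]\<^bsub>general_linear_group\<^esub> Suc (Suc n) = M ** A"
      by (simp add: M_def general_linear_group_def)
    moreover have "M $ i $ j = u (Suc n) * A $ i $ j - (if i = j then det A * u n else 0)" for i j
      using Suc by (simp only: M_def)
    ultimately show ?case
      unfolding u by (simp add: forall_2 sum_2 matrix_matrix_mult_def det_2 algebra_simps)
  qed
  then show ?thesis
    by (simp add: u_def)
qed

text \<open>Hence the order of a non-scalar matrix modulo scalars depends on its trace and determinant alone.\<close>

lemma GL7_pow_in_Z7_iff:
  assumes "A \<in> carrier GL7" "d > 0"
  shows "A [^]\<^bsub>GL7\<^esub> d \<in> Z7 \<longleftrightarrow> lucas (trace A) (det A) d = 0 \<or> (\<exists>c. A = mat c)"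
proof -
  interpret GL: Group.group GL7
    by (rule group_general_linear_group)
  obtain n where n: "d = Suc n"
    using assms(2) gr0_implies_Suc by blast
  define u where "u = lucas (trace A) (det A) d"
  have "A [^]\<^bsub>GL7\<^esub> d \<in> carrier GL7"
    using assms(1) by (rule GL.nat_pow_closed)
  then have "A [^]\<^bsub>GL7\<^esub> d \<in> Z7 \<longleftrightarrow> u * A $ 1 $ 2 = 0 \<and> u * A $ 2 $ 1 = 0 \<and> u * A $ 1 $ 1 = u * A $ 2 $ 2"
    unfolding mem_Collect_eq scalar_iff n matrix_pow_lucas by (simp add: carrier_GL7 n u_def)
  also have "u * A $ 1 $ 1 = u * A $ 2 $ 2 \<longleftrightarrow> u * (A $ 1 $ 1 - A $ 2 $ 2) = 0"
    by (simp add: right_diff_distrib)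
  finally show ?thesis
    by (auto simp: mult_eq_0_7 scalar_iff u_def)
qed

lemma card_factors_7: "card {(b, c). b * c = (s :: 7)} = (if s = 0 then 13 else 6)"
proof -
  have "{(b, c). b * c = s} = (SIGMA b:UNIV. {c. b * c = s})"
    by auto
  then have "card {(b, c). b * c = s} = (\<Sum>b\<in>UNIV. card {c. b * c = s})"
    by simp
  also have "\<dots> = (\<Sum>b\<in>(UNIV :: 7 set). if b = 0 then (if s = 0 then 7 else 0) else 1)"
  proof (rule sum.cong[OF refl])
    fix b :: 7
    show "card {c. b * c = s} = (if b = 0 then (if s = 0 then 7 else 0) else 1)"
    proof (cases "b = 0")
      case False
      have inv: "b * (b ^ 5 * y) = y" "b ^ 5 * (b * y) = y" for y
      proof -
        have "b * (b ^ 5 * y) = (b ^ 5 * b) * y" "b ^ 5 * (b * y) = (b ^ 5 * b) * y"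
          by (simp_all only: mult_ac)
        then show "b * (b ^ 5 * y) = y" "b ^ 5 * (b * y) = y"
          by (simp_all only: inverse_7[OF False] mult_1)
      qed
      have "{c. b * c = s} = {b ^ 5 * s}"
        using inv by auto
      with False show ?thesis
        by simp
    qed simp
  qed
  also have "\<dots> = (if s = 0 then 13 else 6)"
    by (subst sum.remove[of _ 0]) (auto simp: sum.If_cases)
  finally show ?thesis .
qed

text \<open>With diagonal entries \<open>a\<close> and \<open>t - a\<close>, the other two entries have product \<open>a (t - a) - D\<close>; there are 13
  such pairs if this is 0, and 6 otherwise.\<close>

lemma card_trace_det_7:
  "card {A :: 7 ^ 2 ^ 2. trace A = t \<and> det A = D} = (\<Sum>a\<in>UNIV. if a * (t - a) = D then 13 else 6)"
proof -
  define M :: "7 \<times> 7 \<times> 7 \<Rightarrow> 7 ^ 2 ^ 2" where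
    "M = (\<lambda>(a, b, c). \<chi> i j. if i = 1 then (if j = 1 then a else b) else (if j = 1 then c else t - a))"
  have "bij_betw (\<lambda>A. (A $ 1 $ 1, A $ 1 $ 2, A $ 2 $ 1)) {A :: 7 ^ 2 ^ 2. trace A = t \<and> det A = D}
      (SIGMA a:UNIV. {(b, c). b * c = a * (t - a) - D})"
    by (rule bij_betw_byWitness[of _ M])
      (auto simp: M_def vec_eq_iff forall_2 trace_def sum_2 det_2 algebra_simps)
  then have "card {A :: 7 ^ 2 ^ 2. trace A = t \<and> det A = D} =
      (\<Sum>a\<in>UNIV. card {(b, c). b * c = a * (t - a) - D})"
    by (simp add: bij_betw_same_card)
  then show ?thesis
    by (simp add: card_factors_7)
qed

lemma card_matrices_7:
  "card {A :: 7 ^ 2 ^ 2. P (trace A) (det A)} =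
    (\<Sum>t\<in>UNIV. \<Sum>D\<in>UNIV. if P t D then \<Sum>a\<in>UNIV. if a * (t - a) = D then 13 else 6 else 0)"
proof -
  have "{A :: 7 ^ 2 ^ 2. P (trace A) (det A)} = (\<Union>(t, D)\<in>UNIV. {A. P t D \<and> trace A = t \<and> det A = D})"
    by auto
  also have "card \<dots> = (\<Sum>(t, D)\<in>UNIV. card {A :: 7 ^ 2 ^ 2. P t D \<and> trace A = t \<and> det A = D})"
    by (subst card_UN_disjoint) (auto simp: case_prod_unfold)
  also have "\<dots> = (\<Sum>t\<in>UNIV. \<Sum>D\<in>UNIV. card {A :: 7 ^ 2 ^ 2. P t D \<and> trace A = t \<and> det A = D})"
    by (simp add: sum.cartesian_product flip: UNIV_Times_UNIV)
  also have "\<dots> = (\<Sum>t\<in>UNIV. \<Sum>D\<in>UNIV. if P t D then \<Sum>a\<in>UNIV. if a * (t - a) = D then 13 else 6 else 0)"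
    by (intro sum.cong refl) (simp add: card_trace_det_7)
  finally show ?thesis .
qed

text \<open>The double sum of \<open>card_matrices_7\<close> over integer representatives, in a form that evaluates by rewriting.\<close>

definition count_7 :: "(int \<Rightarrow> int \<Rightarrow> bool) \<Rightarrow> nat" where
  "count_7 P = sum_list (map (\<lambda>t. sum_list (map (\<lambda>D. if P t D then
     sum_list (map (\<lambda>a. if (a * (t - a) - D) mod 7 = 0 then 13 else 6) [0..6]) else 0) [0..6])) [0..6])"

lemma card_matrices_7_eq_count:
  assumes "\<And>t D. P (of_int t) (of_int D) \<longleftrightarrow> Q t D"
  shows "card {A :: 7 ^ 2 ^ 2. P (trace A) (det A)} = count_7 Q"
proof -
  have list: "sum_list (map f [0..6]) = (\<Sum>i\<in>{0..<7::int}. f i)" for f :: "int \<Rightarrow> nat"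
  proof -
    have "set [0..6] = {0..<7::int}"
      by auto
    then show ?thesis
      by (simp only: interv_sum_list_conv_sum_set_int)
  qed
  have eq: "of_int a * (of_int t - of_int a) = (of_int D :: 7) \<longleftrightarrow> (a * (t - a) - D) mod 7 = 0" for a t D
    using of_int_7_eq_0_iff[of "a * (t - a) - D"] by simp
  show ?thesis
    unfolding card_matrices_7 count_7_def sum_UNIV_7 assms eq list by (rule refl)
qed

lemma count_7_values:
  "map (\<lambda>d. count_7 (\<lambda>t D. D mod 7 \<noteq> 0 \<and> lucas t D d mod 7 = 0)) [2, 3, 4, 6, 7, 8] = [294, 336, 546, 966, 294, 1050]"
  "count_7 (\<lambda>t D. D mod 7 \<noteq> 0) = 2016"
  by code_simp+

text \<open>A nonzero scalar \<open>c\<close> has trace \<open>2 c\<close> and determinant \<open>c\<^sup>2\<close>, so its Lucas sequence is \<open>d c\<^sup>d\<^sup>-\<^sup>1\<close>.\<close>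

lemma card_scalars_7: "card Z7 = 6" "card {A \<in> Z7. lucas (trace A) (det A) d \<noteq> 0} = (if 7 dvd d then 0 else 6)" if d: "d > 0"
proof -
  have nz: "card {c :: 7. c \<noteq> 0} = 6"
  proof -
    have "{c :: 7. c \<noteq> 0} = UNIV - {0}"
      by auto
    then show ?thesis
      by (simp add: card_Diff_subset)
  qed
  have Z7: "Z7 = mat ` {c. c \<noteq> 0}"
    by (auto simp: invertible_iff_det_7 det_2 mat_def mult_eq_0_7)
  moreover have inj: "inj_on (mat :: 7 \<Rightarrow> 7 ^ 2 ^ 2) S" for S
    by (auto simp: inj_on_def vec_eq_iff mat_def)
  ultimately show "card Z7 = 6"
    using nz by (simp add: card_image)
  obtain n where n: "d = Suc n"
    using d gr0_implies_Suc by blast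
  have power: "c ^ n = 0 \<Longrightarrow> c = 0" for c :: 7
    by (induction n) (auto simp: mult_eq_0_7)
  have "lucas (trace (mat c :: 7 ^ 2 ^ 2)) (det (mat c :: 7 ^ 2 ^ 2)) d = of_nat d * c ^ n" for c
    using lucas_double_root[of c n] by (simp add: n trace_def det_2 sum_2 mat_def)
  moreover have "of_nat d = (0 :: 7) \<longleftrightarrow> 7 dvd d"
    using of_nat_eq_0_iff_char_dvd[where 'a = 7, of d] by simp
  ultimately have "lucas (trace (mat c :: 7 ^ 2 ^ 2)) (det (mat c :: 7 ^ 2 ^ 2)) d = 0 \<longleftrightarrow> 7 dvd d" if "c \<noteq> 0" for c
    using that power by (auto simp: mult_eq_0_7)
  then have "{A \<in> Z7. lucas (trace A) (det A) d \<noteq> 0} = (if 7 dvd d then {} else Z7)"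
    unfolding Z7 by auto
  then show "card {A \<in> Z7. lucas (trace A) (det A) d \<noteq> 0} = (if 7 dvd d then 0 else 6)"
    using \<open>card Z7 = 6\<close> by simp
qed

text \<open>The first summand counts the matrices with vanishing Lucas sequence at \<open>d\<close>; the second one adds the
  scalar matrices that are not among them.\<close>

lemma card_torsion_PGL_7:
  assumes "d > 0"
  shows "6 * card (torsion SmallGroup_336_208 d) =
    count_7 (\<lambda>t D. D mod 7 \<noteq> 0 \<and> lucas t D d mod 7 = 0) + (if 7 dvd d then 0 else 6)"
proof -
  have "{A \<in> carrier GL7. A [^]\<^bsub>GL7\<^esub> d \<in> Z7} =
      {A. det A \<noteq> 0 \<and> lucas (trace A) (det A) d = 0} \<union> {A \<in> Z7. lucas (trace A) (det A) d \<noteq> 0}"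
    using GL7_pow_in_Z7_iff[OF _ assms] by (auto simp: carrier_GL7 invertible_iff_det_7)
  then have "card {A \<in> carrier GL7. A [^]\<^bsub>GL7\<^esub> d \<in> Z7} =
      card {A :: 7 ^ 2 ^ 2. det A \<noteq> 0 \<and> lucas (trace A) (det A) d = 0} + (if 7 dvd d then 0 else 6)"
    using card_scalars_7(2)[OF assms] by (simp add: card_Un_disjoint disjoint_iff)
  moreover have "card {A :: 7 ^ 2 ^ 2. det A \<noteq> 0 \<and> lucas (trace A) (det A) d = 0} =
      count_7 (\<lambda>t D. D mod 7 \<noteq> 0 \<and> lucas t D d mod 7 = 0)"
    by (rule card_matrices_7_eq_count) (simp add: lucas_of_int of_int_7_eq_0_iff)
  moreover have "card {A \<in> carrier GL7. A [^]\<^bsub>GL7\<^esub> d \<in> Z7} = card Z7 * card (torsion (GL7 Mod Z7) d)"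
    by (rule card_pow_in_normal[OF Z7_normal]) simp
  ultimately show ?thesis
    by (simp add: card_scalars_7(1)[OF assms] SmallGroup_336_208_def projective_linear_group_def)
qed

lemma card_carrier_PGL_7: "card (carrier SmallGroup_336_208) = 336"
proof -
  have "\<one>\<^bsub>GL7\<^esub> \<in> Z7"
    using normal.axioms(1)[OF Z7_normal] by (rule subgroup.one_closed)
  \<comment> \<open>The exponent 0 imposes no condition.\<close>
  then have "card (carrier GL7) = card Z7 * card (carrier (GL7 Mod Z7))"
    using card_pow_in_normal[OF Z7_normal, of 0] by (simp add: torsion_def)
  moreover have "card (carrier GL7) = 2016"
    using card_matrices_7_eq_count[of "\<lambda>_ D. D \<noteq> 0" "\<lambda>_ D. D mod 7 \<noteq> 0"] count_7_values(2)
    by (simp add: carrier_GL7 invertible_iff_det_7 of_int_7_eq_0_iff)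
  ultimately show ?thesis
    by (simp add: card_scalars_7(1)[of 1] SmallGroup_336_208_def projective_linear_group_def)
qed

text \<open>The exponents 2, 3, 4, 6, 7, 8 suffice, since they account for
  \<open>1 + 49 + 56 + 42 + 56 + 48 + 84 = 336\<close> elements.\<close>

lemma card_torsion_336_208:
  "card (torsion SmallGroup_336_208 d) =
    1 + (if 2 dvd d then 49 else 0) + (if 3 dvd d then 56 else 0) + (if 4 dvd d then 42 else 0)
      + (if 6 dvd d then 56 else 0) + (if 7 dvd d then 48 else 0) + (if 8 dvd d then 84 else 0)"
proof -
  let ?S = SmallGroup_336_208
  have fin: "finite (carrier ?S)"
    using card_carrier_PGL_7 by (simp add: card_ge_0_finite)
  note sums = card_torsion_eq_sum_order_type[OF group_SmallGroup_336_208 fin]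
  have one: "order_type ?S (Suc 0) = 1"
    using order_type_1[OF group_SmallGroup_336_208] by simp
  define N where "N d = count_7 (\<lambda>t D. D mod 7 \<noteq> 0 \<and> lucas t D d mod 7 = 0)" for d
  have N: "map N [2, 3, 4, 6, 7, 8] = [294, 336, 546, 966, 294, 1050]"
    unfolding N_def by (rule count_7_values)
  have "6 * card (torsion ?S d) = N d + (if 7 dvd d then 0 else 6)" if "d > 0" for d
    unfolding N_def using that by (rule card_torsion_PGL_7)
  from this[of 2] this[of 3] this[of 4] this[of 6] this[of 7] this[of 8] N
  have "card (torsion ?S 2) = 50" "card (torsion ?S 3) = 57" "card (torsion ?S 4) = 92"
    "card (torsion ?S 6) = 162" "card (torsion ?S 7) = 49" "card (torsion ?S 8) = 176"
    by simp_all
  then have orders: "order_type ?S 2 = 49" "order_type ?S 3 = 56" "order_type ?S 4 = 42"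
      "order_type ?S 6 = 56" "order_type ?S 7 = 48" "order_type ?S 8 = 84"
    using sums[of 2] sums[of 3] sums[of 4] sums[of 6] sums[of 7] sums[of 8] one
    by (simp_all add: divisor_sets)
  show ?thesis
    using card_torsion_by_census[OF group_SmallGroup_336_208 fin, of "{1, 2, 3, 4, 6, 7, 8}" d]
    by (simp add: card_carrier_PGL_7 one orders)
qed


section \<open>Solvability\<close>

lemma solvable_comm_group: "comm_group G \<Longrightarrow> solvable G"
proof -
  assume "comm_group G"
  then interpret comm_group G .
  have "(derived G ^^ 1) (carrier G) = {\<one>\<^bsub>G\<^esub>}"
    using derived_eq_singleton[of "carrier G"] by simp
  then show ?thesis
    using solvable_iff_trivial_derived_seq by blast
qed

lemma solvable_cyc [simp]: "solvable (cyc n)"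
  by (simp add: solvable_comm_group)

lemma solvable_semidirect:
  assumes "Group.group N" "Group.group (semidirect N K \<phi>)"
    and "\<And>n. n \<in> carrier N \<Longrightarrow> \<phi> \<one>\<^bsub>K\<^esub> n = n" and "solvable N" "solvable K"
  shows "solvable (semidirect N K \<phi>)"
proof -
  let ?S = "semidirect N K \<phi>"
  interpret N: Group.group N by fact
  interpret S: Group.group ?S by fact
  interpret K: Group.group K
    using assms(2) by (rule group_semidirect_right_factor)
  have "group_hom N ?S (\<lambda>n. (n, \<one>\<^bsub>K\<^esub>))"
    using assms(3) by unfold_locales (auto intro!: homI)
  moreover have "group_hom ?S K snd"
    by unfold_locales (auto intro!: homI)
  moreover have "snd ` carrier ?S = carrier K"
    using N.one_closed by force
  moreover have "kernel ?S K snd \<subseteq> (\<lambda>n. (n, \<one>\<^bsub>K\<^esub>)) ` carrier N"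
    by (auto simp: kernel_def)
  ultimately show ?thesis
    using assms(4,5) by (rule solvable_condition)
qed

lemma solvable_DirProd:
  assumes "Group.group G" "Group.group H" "solvable G" "solvable H"
  shows "solvable (G \<times>\<times> H)"
  using assms DirProd_group[OF assms(1,2)] unfolding DirProd_eq_semidirect
  by (intro solvable_semidirect) auto

lemma solvable_DirProd_right:
  assumes "Group.group G" "Group.group H" "solvable (G \<times>\<times> H)"
  shows "solvable H"
proof -
  interpret G: Group.group G by fact
  have "group_hom (G \<times>\<times> H) H snd"
    using assms(1,2) by (auto simp: group_hom_def group_hom_axioms_def DirProd_group intro!: homI)
  then have "solvable_seq H (snd ` carrier (G \<times>\<times> H))"
    using assms(3) unfolding solvable_def by (rule group_hom.solvable_imp_solvable_img)
  moreover have "snd ` carrier (G \<times>\<times> H) = carrier H"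
    using G.one_closed by force
  ultimately show ?thesis
    by (simp add: solvable_def)
qed

lemma solvable_iso:
  assumes "Group.group G" "Group.group H" "G \<cong> H" "solvable G"
  shows "solvable H"
proof -
  obtain f where f: "f \<in> Group.iso G H"
    using assms(3) by (auto simp: is_iso_def)
  interpret group_hom G H f
    using assms f by (simp add: group_hom_def group_hom_axioms_def Group.iso_def)
  have "f ` carrier G = carrier H"
    using f by (simp add: Group.iso_def bij_betw_def)
  then show ?thesis
    using solvable_imp_solvable_img[of "carrier G"] assms(4) by (simp add: solvable_def)
qed

lemma solvable_quaternion_group:
  assumes "4 dvd n" "n > 0"
  shows "solvable (quaternion_group n)"
proof -
  interpret Q: Group.group "quaternion_group n"
    using assms by (rule group_quaternion)
  obtain h where h: "n = 4 * h" "h > 0"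
    using assms by auto
  have cyc: "carrier (cyc (2 * h)) = {0..<2 * int h}"
    using h by (simp add: carrier_integer_mod_group)
  have Q: "quaternion_group n = \<lparr>carrier = {0..<2 * int h} \<times> {0..<2},
      monoid.mult = (\<lambda>(i, j) (i', j'). ((i + (-1) ^ nat j * i' + int h * (j * j')) mod (2 * int h), (j + j') mod 2)),
      one = (0, 0)\<rparr>"
    by (simp add: quaternion_group_def h)
  have "group_hom (cyc (2 * h)) (quaternion_group n) (\<lambda>i. (i, 0))"
    using Q.is_group h(2) by (intro group_hom.intro group_hom_axioms.intro homI) (simp_all add: Q cyc)
  moreover have "group_hom (quaternion_group n) (cyc 2) snd"
    using Q.is_group by (intro group_hom.intro group_hom_axioms.intro homI) (auto simp: Q)
  moreover have "snd ` carrier (quaternion_group n) = carrier (cyc 2)"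
    using h(2) by (simp add: Q snd_image_times)
  moreover have "kernel (quaternion_group n) (cyc 2) snd \<subseteq> (\<lambda>i. (i, 0)) ` carrier (cyc (2 * h))"
    by (auto simp: kernel_def Q cyc)
  ultimately show ?thesis
    using solvable_cyc solvable_cyc by (rule solvable_condition)
qed

lemma solvable_SmallGroup_21_1: "solvable SmallGroup_21_1"
  using group_SmallGroup_21_1 unfolding SmallGroup_21_1_def
  by (intro solvable_semidirect) auto

lemma solvable_SmallGroup_168_43: "solvable SmallGroup_168_43"
  using group_SmallGroup_168_43 unfolding SmallGroup_168_43_def
  by (intro solvable_semidirect solvable_DirProd solvable_SmallGroup_21_1)
    (auto intro!: DirProd_group simp: SmallGroup_21_1_def)

lemma solvable_SmallGroup_1008_289: "solvable SmallGroup_1008_289"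
  using group_SmallGroup_1008_289 unfolding SmallGroup_1008_289_def
  by (intro solvable_semidirect solvable_DirProd solvable_quaternion_group)
    (auto intro!: DirProd_group group_1008_factor simp: group_quaternion)

lemma solvable_SmallGroup_1344_6967: "solvable SmallGroup_1344_6967"
proof -
  have dih: "solvable (dihedral_group 8)"
    using group_dihedral_8 unfolding dihedral_group_def by (intro solvable_semidirect) auto
  have one: "\<one>\<^bsub>sylow2_1344\<^esub> = ((0, 0, 0), 0)"
    by (simp add: sylow2_1344_def dihedral_group_def)
  have syl: "solvable sylow2_1344"
    using group_sylow2_1344 dih unfolding sylow2_1344_def
    by (intro solvable_semidirect solvable_DirProd) (auto intro!: DirProd_group group_dihedral_8)
  have K: "solvable (semidirect sylow2_1344 (cyc 3) (\<lambda>c. sylow2_1344_auto ^^ nat c))"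
    using group_sylow2_1344_auto syl group_sylow2_1344 by (intro solvable_semidirect) auto
  show ?thesis
    unfolding SmallGroup_1344_6967_def
    by (rule solvable_semidirect[OF group_integer_mod_group group_SmallGroup_1344_6967[unfolded SmallGroup_1344_6967_def]
          _ solvable_cyc K]) (auto simp: one)
qed

text \<open>In an abelian group \<open>a\<close> is the inverse of \<open>b c\<close>, so its order divides both \<open>p\<close> and \<open>q r\<close>.\<close>

lemma (in comm_group) coprime_torsion_product_trivial:
  assumes "a \<in> carrier G" "b \<in> carrier G" "c \<in> carrier G" "a \<otimes> b \<otimes> c = \<one>"
    and "a [^] p = \<one>" "b [^] q = \<one>" "c [^] r = \<one>" "coprime p (q * r :: nat)"
  shows "a = \<one>"
proof -
  have "a [^] (q * r) \<otimes> b [^] (q * r) \<otimes> c [^] (q * r) = (a \<otimes> b \<otimes> c) [^] (q * r)"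
    using assms(1-3) by (simp add: nat_pow_distrib)
  moreover have "b [^] (q * r) = \<one>"
    using assms by (simp flip: nat_pow_pow)
  moreover have "c [^] (q * r) = \<one>"
    using assms by (subst mult.commute) (simp flip: nat_pow_pow)
  ultimately have "a [^] (q * r) = \<one>"
    using assms by simp
  then have "ord a dvd q * r" "ord a dvd p"
    using assms(1,5) by (simp_all add: pow_eq_id)
  then have "ord a = 1"
    using assms(8) by (metis coprime_common_divisor nat_dvd_1_iff_1)
  then show ?thesis
    using ord_eq_1[OF assms(1)] by blast
qed

text \<open>The three elements are trivial in the abelian quotient on top of the series, hence lie in the next
  subgroup, and so on down to the trivial group. In particular, no
  nontrivial quotient of the \<open>(2, 3, 7)\<close> triangle group is solvable.\<close>

lemma (in group) solvable_seq_coprime_triple: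
  assumes "solvable_seq G H" "a \<in> H" "b \<in> H" "c \<in> H" "a \<otimes> b \<otimes> c = \<one>"
    and "a [^] p = \<one>" "b [^] q = \<one>" "c [^] r = \<one>"
    and "coprime p q" "coprime p r" "coprime q (r :: nat)"
  shows "a = \<one> \<and> b = \<one> \<and> c = \<one>"
  using assms(1-4)
proof (induction rule: solvable_seq.induct)
  case (extension K H)
  interpret N: normal K "G\<lparr>carrier := H\<rparr>" by fact
  interpret Q: comm_group "G\<lparr>carrier := H\<rparr> Mod K" by fact
  interpret H: subgroup H G by fact
  let ?Q = "G\<lparr>carrier := H\<rparr> Mod K"
  define \<pi> where "\<pi> = (\<lambda>x. K #>\<^bsub>G\<lparr>carrier := H\<rparr>\<^esub> x)"
  have hom: "group_hom (G\<lparr>carrier := H\<rparr>) ?Q \<pi>"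
    unfolding \<pi>_def
    by (simp add: group_hom_def group_hom_axioms_def N.is_group Q.is_group N.r_coset_hom_Mod)
  interpret \<pi>: group_hom "G\<lparr>carrier := H\<rparr>" ?Q \<pi> by fact
  have cl: "\<pi> x \<in> carrier ?Q" if "x \<in> H" for x
    using \<pi>.hom_closed[of x] that by simp
  have pow: "\<pi> x [^]\<^bsub>?Q\<^esub> n = \<one>\<^bsub>?Q\<^esub>" if "x \<in> H" "x [^] n = \<one>" for x and n :: nat
    using \<pi>.hom_nat_pow[of x n] that \<pi>.hom_one by (simp flip: nat_pow_consistent)
  have mult: "\<pi> (x \<otimes> y) = \<pi> x \<otimes>\<^bsub>?Q\<^esub> \<pi> y" if "x \<in> H" "y \<in> H" for x y
    using \<pi>.hom_mult[of x y] that by simp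
  have one_H: "\<one>\<^bsub>G\<lparr>carrier := H\<rparr>\<^esub> = \<one>"
    by simp
  have prod: "\<pi> a \<otimes>\<^bsub>?Q\<^esub> \<pi> b \<otimes>\<^bsub>?Q\<^esub> \<pi> c = \<one>\<^bsub>?Q\<^esub>"
    using extension.prems assms(5) \<pi>.hom_one mult H.m_closed by (metis one_H)
  have ker: "x \<in> K" if "x \<in> H" "\<pi> x = \<one>\<^bsub>?Q\<^esub>" for x
    using that N.rcos_self[OF _ N.subgroup_axioms, of x] by (simp add: \<pi>_def)
  have abc: "\<pi> a \<in> carrier ?Q" "\<pi> b \<in> carrier ?Q" "\<pi> c \<in> carrier ?Q"
    using extension.prems cl by auto
  have tors: "\<pi> a [^]\<^bsub>?Q\<^esub> p = \<one>\<^bsub>?Q\<^esub>" "\<pi> b [^]\<^bsub>?Q\<^esub> q = \<one>\<^bsub>?Q\<^esub>" "\<pi> c [^]\<^bsub>?Q\<^esub> r = \<one>\<^bsub>?Q\<^esub>"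
    using pow extension.prems assms(6-8) by auto
  have cop: "coprime p (q * r)" "coprime q (p * r)" "coprime r (p * q)"
    using assms(9-11) by (simp_all add: coprime_commute)
  have "\<pi> a = \<one>\<^bsub>?Q\<^esub>"
    by (rule Q.coprime_torsion_product_trivial[OF abc prod tors cop(1)])
  moreover have "\<pi> b \<otimes>\<^bsub>?Q\<^esub> \<pi> a \<otimes>\<^bsub>?Q\<^esub> \<pi> c = \<one>\<^bsub>?Q\<^esub>"
    unfolding Q.m_comm[OF abc(2,1)] by (rule prod)
  then have "\<pi> b = \<one>\<^bsub>?Q\<^esub>"
    by (rule Q.coprime_torsion_product_trivial[OF abc(2,1,3) _ tors(2,1,3) cop(2)])
  moreover have "\<pi> c \<otimes>\<^bsub>?Q\<^esub> \<pi> a \<otimes>\<^bsub>?Q\<^esub> \<pi> b = \<one>\<^bsub>?Q\<^esub>"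
    unfolding Q.m_assoc[OF abc(3,1,2)] Q.m_comm[OF abc(3) Q.m_closed[OF abc(1,2)]] by (rule prod)
  then have "\<pi> c = \<one>\<^bsub>?Q\<^esub>"
    by (rule Q.coprime_torsion_product_trivial[OF abc(3,1,2) _ tors(3,1,2) cop(3)])
  ultimately show ?case
    using extension.IH extension.prems ker by blast
qed auto

text \<open>\<open>PGL\<^sub>2(7)\<close> contains \<open>PSL\<^sub>2(7)\<close>, which is a quotient of the \<open>(2, 3, 7)\<close> triangle group.\<close>

lemma not_solvable_PGL_7: "\<not> solvable SmallGroup_336_208"
proof
  interpret Z: normal Z7 GL7
    by (rule Z7_normal)
  interpret P: Group.group "GL7 Mod Z7"
    by (rule Z.factorgroup_is_group)
  assume "solvable SmallGroup_336_208"
  then have solv: "solvable_seq (GL7 Mod Z7) (carrier (GL7 Mod Z7))"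
    by (simp add: SmallGroup_336_208_def projective_linear_group_def solvable_def)
  define \<pi> where "\<pi> = (\<lambda>L. Z7 #>\<^bsub>GL7\<^esub> L)"
  interpret \<pi>: group_hom GL7 "GL7 Mod Z7" \<pi>
    using Z.r_coset_hom_Mod by (simp add: \<pi>_def group_hom_def group_hom_axioms_def Z.is_group P.is_group)
  have triv: "\<pi> L = \<one>\<^bsub>GL7 Mod Z7\<^esub> \<longleftrightarrow> L \<in> Z7" if "L \<in> carrier GL7" for L
    using Z.rcos_self[OF that Z.subgroup_axioms] Z.coset_join2[OF that Z.subgroup_axioms]
    unfolding \<pi>_def one_FactGroup by blast
  define M :: "7 \<Rightarrow> 7 \<Rightarrow> 7 \<Rightarrow> 7 \<Rightarrow> 7 ^ 2 ^ 2" where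
    "M = (\<lambda>a b c d. \<chi> i j. if i = 1 then (if j = 1 then a else b) else (if j = 1 then c else d))"
  have M: "det (M a b c d) = a * d - b * c" "trace (M a b c d) = a + d" for a b c d
    by (simp_all add: M_def det_2 trace_def sum_2)
  have M_mult: "M a b c d ** M a' b' c' d' = M (a * a' + b * c') (a * b' + b * d') (c * a' + d * c') (c * b' + d * d')"
    for a b c d a' b' c' d'
    by (simp add: M_def vec_eq_iff forall_2 matrix_matrix_mult_def sum_2)
  have one: "M 1 0 0 1 = mat 1"
    by (simp add: M_def vec_eq_iff forall_2 mat_def)
  \<comment> \<open>\<open>A\<close> has trace 0, and \<open>C\<close> is a transvection. Then \<open>B = A\<^sup>-\<^sup>1 C\<^sup>-\<^sup>1\<close> has trace and determinant 1,
    so \<open>u\<^sub>3 = t\<^sup>2 - D\<close> vanishes.\<close>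
  define A where "A = M 0 (-1) 1 0"
  define B where "B = M 0 1 (-1) 1"
  define C where "C = M 1 1 0 1"
  have carr: "A \<in> carrier GL7" "B \<in> carrier GL7" "C \<in> carrier GL7"
    by (simp_all add: carrier_GL7 invertible_iff_det_7 A_def B_def C_def M)
  have lucas_2: "lucas t D 2 = t" and lucas_3: "lucas t D 3 = t * t - D" for t D :: 7
    by (simp_all add: numeral_2_eq_2 numeral_3_eq_3 lucas_rec)
  have pow: "A [^]\<^bsub>GL7\<^esub> (2::nat) \<in> Z7" "B [^]\<^bsub>GL7\<^esub> (3::nat) \<in> Z7" "C [^]\<^bsub>GL7\<^esub> (7::nat) \<in> Z7"
  proof -
    show "A [^]\<^bsub>GL7\<^esub> (2::nat) \<in> Z7"
      using GL7_pow_in_Z7_iff[OF carr(1), of 2] by (simp add: A_def M lucas_2)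
    show "B [^]\<^bsub>GL7\<^esub> (3::nat) \<in> Z7"
      using GL7_pow_in_Z7_iff[OF carr(2), of 3] by (simp add: B_def M lucas_3)
    have "lucas (2 * 1) (1 * 1) (Suc 6) = (0 :: 7)"
      by (subst lucas_double_root) simp
    then show "C [^]\<^bsub>GL7\<^esub> (7::nat) \<in> Z7"
      using GL7_pow_in_Z7_iff[OF carr(3), of 7] by (simp add: C_def M)
  qed
  have "A ** B ** C = mat 1"
    by (simp add: A_def B_def C_def M_mult one)
  then have "A \<otimes>\<^bsub>GL7\<^esub> B \<otimes>\<^bsub>GL7\<^esub> C = \<one>\<^bsub>GL7\<^esub>"
    by (simp add: general_linear_group_def)
  then have prod: "\<pi> A \<otimes>\<^bsub>GL7 Mod Z7\<^esub> \<pi> B \<otimes>\<^bsub>GL7 Mod Z7\<^esub> \<pi> C = \<one>\<^bsub>GL7 Mod Z7\<^esub>"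
    using \<pi>.hom_mult[OF carr(1,2)] \<pi>.hom_mult[OF Z.m_closed[OF carr(1,2)] carr(3)] \<pi>.hom_one by metis
  have tors: "\<pi> L [^]\<^bsub>GL7 Mod Z7\<^esub> n = \<one>\<^bsub>GL7 Mod Z7\<^esub>" if "L \<in> carrier GL7" "L [^]\<^bsub>GL7\<^esub> n \<in> Z7" for L and n :: nat
    using \<pi>.hom_nat_pow[OF that(1), of n] triv[OF Z.nat_pow_closed[OF that(1)], of n] that(2) by metis
  have "coprime (2::nat) 3" "coprime (2::nat) 7" "coprime (3::nat) 7"
    by (simp_all add: coprime_iff_gcd_eq_1 gcd_non_0_nat)
  then have "\<pi> A = \<one>\<^bsub>GL7 Mod Z7\<^esub>"
    using P.solvable_seq_coprime_triple[OF solv \<pi>.hom_closed[OF carr(1)] \<pi>.hom_closed[OF carr(2)]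
        \<pi>.hom_closed[OF carr(3)] prod tors[OF carr(1) pow(1)] tors[OF carr(2) pow(2)] tors[OF carr(3) pow(3)]]
    by blast
  then have "A \<in> Z7"
    using triv[OF carr(1)] by blast
  then show False
    unfolding mem_Collect_eq scalar_iff by (simp add: A_def M_def)
qed


section \<open>Two products with the same order type\<close>

lemma finite_carrier_iso: "G \<cong> H \<Longrightarrow> finite (carrier H) \<Longrightarrow> finite (carrier G)"
  by (auto simp: is_iso_def Group.iso_def bij_betw_finite)

text \<open>Rewrites the counts for cyclic groups in terms of divisibility of \<open>d\<close>, the form of all other counts.\<close>

lemma gcd_numeral_cases:
  "gcd 2 d = (if 2 dvd d then 2 else 1 :: nat)"
  "gcd 3 d = (if 3 dvd d then 3 else 1 :: nat)"
  "gcd 4 d = (if 4 dvd d then 4 else if 2 dvd d then 2 else 1 :: nat)"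
  "gcd 8 d = (if 8 dvd d then 8 else if 4 dvd d then 4 else if 2 dvd d then 2 else 1 :: nat)"
  "gcd 12 d = (if 4 dvd d then 4 else if 2 dvd d then 2 else 1) * (if 3 dvd d then 3 else 1 :: nat)"
proof -
  have gcd_red: "gcd m d = gcd m (d mod m)" for m :: nat
    using gcd_red_nat[of d m] by (simp add: gcd.commute)
  have "\<forall>r \<in> set [0..<2]. gcd 2 r = (if 2 dvd r then 2 else 1)"
    by code_simp
  moreover have "d mod 2 \<in> set [0..<2]"
    by simp
  ultimately have "gcd 2 (d mod 2) = (if 2 dvd d mod 2 then 2 else 1)"
    by (rule bspec)
  moreover have "2 dvd d mod 2 \<longleftrightarrow> 2 dvd d"
    by presburger+
  ultimately show "gcd 2 d = (if 2 dvd d then 2 else 1)"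
    by (simp only: gcd_red[of 2])
  have "\<forall>r \<in> set [0..<3]. gcd 3 r = (if 3 dvd r then 3 else 1)"
    by code_simp
  moreover have "d mod 3 \<in> set [0..<3]"
    by simp
  ultimately have "gcd 3 (d mod 3) = (if 3 dvd d mod 3 then 3 else 1)"
    by (rule bspec)
  moreover have "3 dvd d mod 3 \<longleftrightarrow> 3 dvd d"
    by presburger+
  ultimately show "gcd 3 d = (if 3 dvd d then 3 else 1)"
    by (simp only: gcd_red[of 3])
  have "\<forall>r \<in> set [0..<4]. gcd 4 r = (if 4 dvd r then 4 else if 2 dvd r then 2 else 1)"
    by code_simp
  moreover have "d mod 4 \<in> set [0..<4]"
    by simp
  ultimately have "gcd 4 (d mod 4) = (if 4 dvd d mod 4 then 4 else if 2 dvd d mod 4 then 2 else 1)"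
    by (rule bspec)
  moreover have "4 dvd d mod 4 \<longleftrightarrow> 4 dvd d" "2 dvd d mod 4 \<longleftrightarrow> 2 dvd d"
    by presburger+
  ultimately show "gcd 4 d = (if 4 dvd d then 4 else if 2 dvd d then 2 else 1)"
    by (simp only: gcd_red[of 4])
  have "\<forall>r \<in> set [0..<8]. gcd 8 r = (if 8 dvd r then 8 else if 4 dvd r then 4 else if 2 dvd r then 2 else 1)"
    by code_simp
  moreover have "d mod 8 \<in> set [0..<8]"
    by simp
  ultimately have "gcd 8 (d mod 8) = (if 8 dvd d mod 8 then 8 else if 4 dvd d mod 8 then 4 else if 2 dvd d mod 8 then 2 else 1)"
    by (rule bspec)
  moreover have "8 dvd d mod 8 \<longleftrightarrow> 8 dvd d" "4 dvd d mod 8 \<longleftrightarrow> 4 dvd d" "2 dvd d mod 8 \<longleftrightarrow> 2 dvd d"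
    by presburger+
  ultimately show "gcd 8 d = (if 8 dvd d then 8 else if 4 dvd d then 4 else if 2 dvd d then 2 else 1)"
    by (simp only: gcd_red[of 8])
  have "\<forall>r \<in> set [0..<12]. gcd 12 r = (if 4 dvd r then 4 else if 2 dvd r then 2 else 1) * (if 3 dvd r then 3 else (1 :: nat))"
    by code_simp
  moreover have "d mod 12 \<in> set [0..<12]"
    by simp
  ultimately have "gcd 12 (d mod 12) = (if 4 dvd d mod 12 then 4 else if 2 dvd d mod 12 then 2 else 1) * (if 3 dvd d mod 12 then 3 else 1)"
    by (rule bspec)
  moreover have "4 dvd d mod 12 \<longleftrightarrow> 4 dvd d" "2 dvd d mod 12 \<longleftrightarrow> 2 dvd d" "3 dvd d mod 12 \<longleftrightarrow> 3 dvd d"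
    by presburger+
  ultimately show "gcd 12 d = (if 4 dvd d then 4 else if 2 dvd d then 2 else 1) * (if 3 dvd d then 3 else 1)"
    by (simp only: gcd_red[of 12])
qed

text \<open>All counts depend only on which of 2, 4, 8, 3 and 7 divide \<open>d\<close>, which leaves 16 numerical identities.\<close>

lemma card_torsion_products_eq:
  "card (torsion SmallGroup_168_43 d) * (card (torsion SmallGroup_1008_289 d) * card (torsion SmallGroup_1344_6967 d)) =
   card (torsion SmallGroup_21_1 d) * (card (torsion SmallGroup_96_166 d) *
     (card (torsion SmallGroup_336_136 d) * card (torsion SmallGroup_336_208 d)))"
proof -
  have dvds: "8 dvd d \<Longrightarrow> 4 dvd d" "4 dvd d \<Longrightarrow> 2 dvd d" "6 dvd d \<longleftrightarrow> 2 dvd d \<and> 3 dvd d"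
    by presburger+
  note formulas = card_torsion_168_43 card_torsion_1008_289 card_torsion_1344_6967 card_torsion_21_1
    card_torsion_96_166 card_torsion_336_136 card_torsion_336_208 gcd_numeral_cases dvds(3) Let_def
  consider "2 dvd d" "4 dvd d" "8 dvd d" | "2 dvd d" "4 dvd d" "\<not> 8 dvd d"
    | "2 dvd d" "\<not> 4 dvd d" "\<not> 8 dvd d" | "\<not> 2 dvd d" "\<not> 4 dvd d" "\<not> 8 dvd d"
    using dvds by blast
  then show ?thesis
  proof cases
    case 1
    then show ?thesis
      by (cases "3 dvd d"; cases "7 dvd d") (simp_all add: formulas)
  next
    case 2
    then show ?thesis
      by (cases "3 dvd d"; cases "7 dvd d") (simp_all add: formulas)
  next
    case 3
    then show ?thesis
      by (cases "3 dvd d"; cases "7 dvd d") (simp_all add: formulas)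
  next
    case 4
    then show ?thesis
      by (cases "3 dvd d"; cases "7 dvd d") (simp_all add: formulas)
  qed
qed

theorem theorem1:
  fixes S1 :: "'a1 monoid" and S2 :: "'a2 monoid" and S3 :: "'a3 monoid"
    and S4 :: "'a4 monoid" and S5 :: "'a5 monoid" and S6 :: "'a6 monoid" and S7 :: "'a7 monoid"
    and G :: "('a1 \<times> 'a2 \<times> 'a3) monoid" and H :: "('a4 \<times> 'a5 \<times> 'a6 \<times> 'a7) monoid"
  assumes "group S1" and "S1 \<cong> SmallGroup_168_43"
    and "group S2" and "S2 \<cong> SmallGroup_1008_289"
    and "group S3" and "S3 \<cong> SmallGroup_1344_6967"
    and "group S4" and "S4 \<cong> SmallGroup_21_1"
    and "group S5" and "S5 \<cong> SmallGroup_96_166"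
    and "group S6" and "S6 \<cong> SmallGroup_336_136"
    and "group S7" and "S7 \<cong> SmallGroup_336_208"
    and "G = S1 \<times>\<times> S2 \<times>\<times> S3"
    and "H = S4 \<times>\<times> S5 \<times>\<times> S6 \<times>\<times> S7"
  shows "(\<forall>n>0. order_type G n = order_type H n) \<and> solvable G \<and> \<not> solvable H"
proof -
  have gG: "Group.group (S1 \<times>\<times> S2 \<times>\<times> S3)"
    using assms(1,3,5) by (intro DirProd_group)
  have gH: "Group.group (S4 \<times>\<times> S5 \<times>\<times> S6 \<times>\<times> S7)"
    using assms(7,9,11,13) by (intro DirProd_group)
  have fin: "finite (carrier S1)" "finite (carrier S2)" "finite (carrier S3)" "finite (carrier S4)"
    "finite (carrier S5)" "finite (carrier S6)" "finite (carrier S7)"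
  proof -
    show "finite (carrier S1)"
      by (rule finite_carrier_iso[OF assms(2)]) (simp add: SmallGroup_168_43_def SmallGroup_21_1_def)
    show "finite (carrier S2)"
      by (rule finite_carrier_iso[OF assms(4)]) (simp add: SmallGroup_1008_289_def quaternion_group_def)
    show "finite (carrier S3)"
      by (rule finite_carrier_iso[OF assms(6)]) (simp add: SmallGroup_1344_6967_def carrier_sylow)
    show "finite (carrier S4)"
      by (rule finite_carrier_iso[OF assms(8)]) (simp add: SmallGroup_21_1_def)
    show "finite (carrier S5)"
      by (rule finite_carrier_iso[OF assms(10)]) (simp add: SmallGroup_96_166_def quaternion_group_def)
    show "finite (carrier S6)"
      by (rule finite_carrier_iso[OF assms(12)]) (simp add: SmallGroup_336_136_def A4_def)
    show "finite (carrier S7)"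
      by (rule finite_carrier_iso[OF assms(14)]) (use card_carrier_PGL_7 in \<open>simp add: card_ge_0_finite\<close>)
  qed
  note iso_eqs = card_torsion_iso[OF assms(1) group_SmallGroup_168_43 assms(2)]
    card_torsion_iso[OF assms(3) group_SmallGroup_1008_289 assms(4)]
    card_torsion_iso[OF assms(5) group_SmallGroup_1344_6967 assms(6)]
    card_torsion_iso[OF assms(7) group_SmallGroup_21_1 assms(8)]
    card_torsion_iso[OF assms(9) group_SmallGroup_96_166 assms(10)]
    card_torsion_iso[OF assms(11) group_SmallGroup_336_136 assms(12)]
    card_torsion_iso[OF assms(13) group_SmallGroup_336_208 assms(14)]
  have "card (torsion G d) = card (torsion H d)" for d
    unfolding assms(15,16) torsion_DirProd card_cartesian_product iso_eqs by (rule card_torsion_products_eq)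
  then have "\<forall>n>0. order_type G n = order_type H n"
    using gG gH fin order_type_eqI[of G H] by (simp add: assms(15,16))
  moreover have "solvable G"
    unfolding assms(15)
    using assms(1,3,5) solvable_SmallGroup_168_43 solvable_SmallGroup_1008_289 solvable_SmallGroup_1344_6967
      solvable_iso[OF group_SmallGroup_168_43 assms(1) group.iso_sym[OF assms(1,2)]]
      solvable_iso[OF group_SmallGroup_1008_289 assms(3) group.iso_sym[OF assms(3,4)]]
      solvable_iso[OF group_SmallGroup_1344_6967 assms(5) group.iso_sym[OF assms(5,6)]]
    by (simp add: solvable_DirProd DirProd_group)
  moreover have "\<not> solvable H"
  proof
    assume "solvable H"
    then have "solvable (S5 \<times>\<times> S6 \<times>\<times> S7)"
      unfolding assms(16)
      by (rule solvable_DirProd_right[OF assms(7) DirProd_group[OF assms(9) DirProd_group[OF assms(11,13)]]])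
    then have "solvable S7"
      by (intro solvable_DirProd_right[OF assms(11,13)]
          solvable_DirProd_right[OF assms(9) DirProd_group[OF assms(11,13)]])
    then show False
      using solvable_iso[OF assms(13) group_SmallGroup_336_208 assms(14)] not_solvable_PGL_7 by blast
  qed
  ultimately show ?thesis
    by blast
qed

end
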